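(* $\mathsf{RCA}_0+\mathsf{I}\Sigma^0_2 \vdash \mathsf{STS}(2) \rightarrow \mathsf{SRRT}^2_2$.
   Context: $\mathsf{RCA}_0$ is the usual base system of reverse mathematics, and $\mathsf{I}\Sigma^0_2$ is the induction scheme for $\Sigma^0_2$ formulas. Colorings $f:[\mathbb{N}]^2\to\mathbb{N}$ are defined on pairs $x<s$. $f:[\mathbb{N}]^2\to\mathbb{N}$ is stable if $\lim_s f(x,s)$ exists for every $x$. A set $A$ is thin for $f$ if $f([A]^2)\neq\mathbb{N}$. $\mathsf{STS}(2)$ is the statement "every stable $f:[\mathbb{N}]^2\to\mathbb{N}$ has an infinite set thin for $f$". $f:[\mathbb{N}]^2\to\mathbb{N}$ is 2-bounded if $|f^{-1}(y)|\le2$ for every $y$. It is rainbow-stable if for every $x$ one of the following holds: (a) there is $y\neq x$ with $f(x,s)=f(y,s)$ for all but finitely many $s$; or (b) for all but finitely many $s$ there is no $y\ne x$ with $f(x,s)=f(y,s)$. A set $R$ is a rainbow for $f$ if $f$ is injective on $[R]^2$. $\mathsf{SRRT}^2_2$ is the statement "every rainbow-stable 2-bounded coloring $f:[\mathbb{N}]^2\to\mathbb{N}$ has an infinite rainbow". *)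

theory Defs
  imports Main
begin

section \<open>The language of second-order arithmetic\<close>

text \<open>
  A two-sorted language with numbers and sets of numbers. Bound variables are named; parameters
  (\<open>NPar\<close>, \<open>SPar\<close>) are never bound and serve as eigenvariables in derivations. They occur
  neither in the axioms nor in the theorems of interest. Equality is primitive for numbers only;
  equality of sets is not part of the language.
\<close>

datatype tm =
    NVar string
  | NPar nat
  | Zero  ("\<^bold>0")
  | One  ("\<^bold>1")
  | Add tm tm  (infixl "\<^bold>+" 65)
  | Mul tm tm  (infixl "\<^bold>*" 70)

datatype stm = SVar string | SPar nat

datatype fm =
    Fls  ("\<^bold>\<bottom>")
  | Eq tm tm  (infix "\<^bold>=" 50)
  | Less tm tm  (infix "\<^bold><" 50)
  | Mem tm stm  (infix "\<^bold>\<in>" 50)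
  | Imp fm fm  (infixr "\<^bold>\<longrightarrow>" 25)
  | AllN string fm
  | AllS string fm

definition Neg :: "fm \<Rightarrow> fm"  ("\<^bold>\<not> _" [40] 40)
  where "(\<^bold>\<not> \<phi>) = (\<phi> \<^bold>\<longrightarrow> \<^bold>\<bottom>)"

definition Or :: "fm \<Rightarrow> fm \<Rightarrow> fm"  (infixr "\<^bold>\<or>" 30)
  where "(\<phi> \<^bold>\<or> \<psi>) = (\<^bold>\<not> \<phi> \<^bold>\<longrightarrow> \<psi>)"

definition And :: "fm \<Rightarrow> fm \<Rightarrow> fm"  (infixr "\<^bold>\<and>" 35)
  where "(\<phi> \<^bold>\<and> \<psi>) = (\<^bold>\<not> (\<phi> \<^bold>\<longrightarrow> \<^bold>\<not> \<psi>))"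

definition Iff :: "fm \<Rightarrow> fm \<Rightarrow> fm"  (infix "\<^bold>\<longleftrightarrow>" 25)
  where "(\<phi> \<^bold>\<longleftrightarrow> \<psi>) = ((\<phi> \<^bold>\<longrightarrow> \<psi>) \<^bold>\<and> (\<psi> \<^bold>\<longrightarrow> \<phi>))"

definition ExN :: "string \<Rightarrow> fm \<Rightarrow> fm"
  where "ExN x \<phi> = (\<^bold>\<not> AllN x (\<^bold>\<not> \<phi>))"

definition ExS :: "string \<Rightarrow> fm \<Rightarrow> fm"
  where "ExS X \<phi> = (\<^bold>\<not> AllS X (\<^bold>\<not> \<phi>))"

abbreviation AllNs :: "string list \<Rightarrow> fm \<Rightarrow> fm"
  where "AllNs xs \<phi> \<equiv> foldr AllN xs \<phi>"

abbreviation ExNs :: "string list \<Rightarrow> fm \<Rightarrow> fm"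
  where "ExNs xs \<phi> \<equiv> foldr ExN xs \<phi>"

abbreviation AllSs :: "string list \<Rightarrow> fm \<Rightarrow> fm"
  where "AllSs Xs \<phi> \<equiv> foldr AllS Xs \<phi>"

primrec tm_vars :: "tm \<Rightarrow> string set" where
  "tm_vars (NVar x) = {x}"
| "tm_vars (NPar a) = {}"
| "tm_vars \<^bold>0 = {}"
| "tm_vars \<^bold>1 = {}"
| "tm_vars (t \<^bold>+ u) = tm_vars t \<union> tm_vars u"
| "tm_vars (t \<^bold>* u) = tm_vars t \<union> tm_vars u"

primrec tm_pars :: "tm \<Rightarrow> nat set" where
  "tm_pars (NVar x) = {}"
| "tm_pars (NPar a) = {a}"
| "tm_pars \<^bold>0 = {}"
| "tm_pars \<^bold>1 = {}"
| "tm_pars (t \<^bold>+ u) = tm_pars t \<union> tm_pars u"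
| "tm_pars (t \<^bold>* u) = tm_pars t \<union> tm_pars u"

primrec stm_vars :: "stm \<Rightarrow> string set" where
  "stm_vars (SVar X) = {X}"
| "stm_vars (SPar A) = {}"

primrec stm_pars :: "stm \<Rightarrow> nat set" where
  "stm_pars (SVar X) = {}"
| "stm_pars (SPar A) = {A}"

primrec free_nvars :: "fm \<Rightarrow> string set" where
  "free_nvars \<^bold>\<bottom> = {}"
| "free_nvars (t \<^bold>= u) = tm_vars t \<union> tm_vars u"
| "free_nvars (t \<^bold>< u) = tm_vars t \<union> tm_vars u"
| "free_nvars (t \<^bold>\<in> T) = tm_vars t"
| "free_nvars (\<phi> \<^bold>\<longrightarrow> \<psi>) = free_nvars \<phi> \<union> free_nvars \<psi>"
| "free_nvars (AllN x \<phi>) = free_nvars \<phi> - {x}"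
| "free_nvars (AllS X \<phi>) = free_nvars \<phi>"

primrec free_svars :: "fm \<Rightarrow> string set" where
  "free_svars \<^bold>\<bottom> = {}"
| "free_svars (t \<^bold>= u) = {}"
| "free_svars (t \<^bold>< u) = {}"
| "free_svars (t \<^bold>\<in> T) = stm_vars T"
| "free_svars (\<phi> \<^bold>\<longrightarrow> \<psi>) = free_svars \<phi> \<union> free_svars \<psi>"
| "free_svars (AllN x \<phi>) = free_svars \<phi>"
| "free_svars (AllS X \<phi>) = free_svars \<phi> - {X}"

primrec npars :: "fm \<Rightarrow> nat set" where
  "npars \<^bold>\<bottom> = {}"
| "npars (t \<^bold>= u) = tm_pars t \<union> tm_pars u"
| "npars (t \<^bold>< u) = tm_pars t \<union> tm_pars u"
| "npars (t \<^bold>\<in> T) = tm_pars t"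
| "npars (\<phi> \<^bold>\<longrightarrow> \<psi>) = npars \<phi> \<union> npars \<psi>"
| "npars (AllN x \<phi>) = npars \<phi>"
| "npars (AllS X \<phi>) = npars \<phi>"

primrec spars :: "fm \<Rightarrow> nat set" where
  "spars \<^bold>\<bottom> = {}"
| "spars (t \<^bold>= u) = {}"
| "spars (t \<^bold>< u) = {}"
| "spars (t \<^bold>\<in> T) = stm_pars T"
| "spars (\<phi> \<^bold>\<longrightarrow> \<psi>) = spars \<phi> \<union> spars \<psi>"
| "spars (AllN x \<phi>) = spars \<phi>"
| "spars (AllS X \<phi>) = spars \<phi>"

definition sentence :: "fm \<Rightarrow> bool" where
  "sentence \<phi> \<longleftrightarrow> free_nvars \<phi> = {} \<and> free_svars \<phi> = {} \<and> npars \<phi> = {} \<and> spars \<phi> = {}"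

primrec tm_subst :: "string \<Rightarrow> tm \<Rightarrow> tm \<Rightarrow> tm" where
  "tm_subst x r (NVar y) = (if y = x then r else NVar y)"
| "tm_subst x r (NPar a) = NPar a"
| "tm_subst x r \<^bold>0 = \<^bold>0"
| "tm_subst x r \<^bold>1 = \<^bold>1"
| "tm_subst x r (t \<^bold>+ u) = tm_subst x r t \<^bold>+ tm_subst x r u"
| "tm_subst x r (t \<^bold>* u) = tm_subst x r t \<^bold>* tm_subst x r u"

primrec stm_subst :: "string \<Rightarrow> stm \<Rightarrow> stm \<Rightarrow> stm" where
  "stm_subst X R (SVar Y) = (if Y = X then R else SVar Y)"
| "stm_subst X R (SPar A) = SPar A"

text \<open>
  Substitution does not rename bound variables. It is only used where no capture can occur:
  the substituted term contains no variable, or (in the induction axiom) no variable other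
  than the one it replaces.
\<close>

primrec nsubst :: "string \<Rightarrow> tm \<Rightarrow> fm \<Rightarrow> fm" where
  "nsubst x r \<^bold>\<bottom> = \<^bold>\<bottom>"
| "nsubst x r (t \<^bold>= u) = (tm_subst x r t \<^bold>= tm_subst x r u)"
| "nsubst x r (t \<^bold>< u) = (tm_subst x r t \<^bold>< tm_subst x r u)"
| "nsubst x r (t \<^bold>\<in> T) = (tm_subst x r t \<^bold>\<in> T)"
| "nsubst x r (\<phi> \<^bold>\<longrightarrow> \<psi>) = (nsubst x r \<phi> \<^bold>\<longrightarrow> nsubst x r \<psi>)"
| "nsubst x r (AllN y \<phi>) = AllN y (if y = x then \<phi> else nsubst x r \<phi>)"
| "nsubst x r (AllS Y \<phi>) = AllS Y (nsubst x r \<phi>)"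

primrec ssubst :: "string \<Rightarrow> stm \<Rightarrow> fm \<Rightarrow> fm" where
  "ssubst X R \<^bold>\<bottom> = \<^bold>\<bottom>"
| "ssubst X R (t \<^bold>= u) = (t \<^bold>= u)"
| "ssubst X R (t \<^bold>< u) = (t \<^bold>< u)"
| "ssubst X R (t \<^bold>\<in> T) = (t \<^bold>\<in> stm_subst X R T)"
| "ssubst X R (\<phi> \<^bold>\<longrightarrow> \<psi>) = (ssubst X R \<phi> \<^bold>\<longrightarrow> ssubst X R \<psi>)"
| "ssubst X R (AllN y \<phi>) = AllN y (ssubst X R \<phi>)"
| "ssubst X R (AllS Y \<phi>) = AllS Y (if Y = X then \<phi> else ssubst X R \<phi>)"


section \<open>Derivability\<close>

text \<open>
  Classical two-sorted natural deduction with equality. The sort of sets carries no comprehension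
  of its own: set quantifiers are only instantiated by set parameters.
\<close>

inductive derives :: "fm set \<Rightarrow> fm \<Rightarrow> bool"  (infix "\<^bold>\<turnstile>" 20) where
  Assm: "\<phi> \<in> \<Gamma> \<Longrightarrow> \<Gamma> \<^bold>\<turnstile> \<phi>"
| Weaken: "\<Gamma> \<^bold>\<turnstile> \<phi> \<Longrightarrow> \<Gamma> \<subseteq> \<Delta> \<Longrightarrow> \<Delta> \<^bold>\<turnstile> \<phi>"
| ImpI: "insert \<phi> \<Gamma> \<^bold>\<turnstile> \<psi> \<Longrightarrow> \<Gamma> \<^bold>\<turnstile> (\<phi> \<^bold>\<longrightarrow> \<psi>)"
| ImpE: "\<Gamma> \<^bold>\<turnstile> (\<phi> \<^bold>\<longrightarrow> \<psi>) \<Longrightarrow> \<Gamma> \<^bold>\<turnstile> \<phi> \<Longrightarrow> \<Gamma> \<^bold>\<turnstile> \<psi>"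
| Contr: "insert (\<^bold>\<not> \<phi>) \<Gamma> \<^bold>\<turnstile> \<^bold>\<bottom> \<Longrightarrow> \<Gamma> \<^bold>\<turnstile> \<phi>"
| AllNI: "\<Gamma> \<^bold>\<turnstile> nsubst x (NPar a) \<phi> \<Longrightarrow> a \<notin> npars \<phi> \<union> \<Union>(npars ` \<Gamma>) \<Longrightarrow> \<Gamma> \<^bold>\<turnstile> AllN x \<phi>"
| AllNE: "\<Gamma> \<^bold>\<turnstile> AllN x \<phi> \<Longrightarrow> tm_vars t = {} \<Longrightarrow> \<Gamma> \<^bold>\<turnstile> nsubst x t \<phi>"
| AllSI: "\<Gamma> \<^bold>\<turnstile> ssubst X (SPar A) \<phi> \<Longrightarrow> A \<notin> spars \<phi> \<union> \<Union>(spars ` \<Gamma>) \<Longrightarrow> \<Gamma> \<^bold>\<turnstile> AllS X \<phi>"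
| AllSE: "\<Gamma> \<^bold>\<turnstile> AllS X \<phi> \<Longrightarrow> \<Gamma> \<^bold>\<turnstile> ssubst X (SPar A) \<phi>"
| Refl: "tm_vars t = {} \<Longrightarrow> \<Gamma> \<^bold>\<turnstile> (t \<^bold>= t)"
| Subst: "\<Gamma> \<^bold>\<turnstile> (t \<^bold>= u) \<Longrightarrow> \<Gamma> \<^bold>\<turnstile> nsubst x t \<phi> \<Longrightarrow> tm_vars t = {} \<Longrightarrow> tm_vars u = {}
    \<Longrightarrow> \<Gamma> \<^bold>\<turnstile> nsubst x u \<phi>"


section \<open>The arithmetical hierarchy\<close>

definition BAllN :: "string \<Rightarrow> tm \<Rightarrow> fm \<Rightarrow> fm"
  where "BAllN x t \<phi> = AllN x (NVar x \<^bold>< t \<^bold>\<longrightarrow> \<phi>)"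

text \<open>
  Set parameters are allowed. Bounded existential quantifiers are covered as negated bounded
  universal ones.
\<close>

inductive delta0 :: "fm \<Rightarrow> bool" where
  "delta0 \<^bold>\<bottom>"
| "delta0 (t \<^bold>= u)"
| "delta0 (t \<^bold>< u)"
| "delta0 (t \<^bold>\<in> T)"
| "delta0 \<phi> \<Longrightarrow> delta0 \<psi> \<Longrightarrow> delta0 (\<phi> \<^bold>\<longrightarrow> \<psi>)"
| "delta0 \<phi> \<Longrightarrow> x \<notin> tm_vars t \<Longrightarrow> delta0 (BAllN x t \<phi>)"

inductive is_Sigma :: "nat \<Rightarrow> fm \<Rightarrow> bool" and is_Pi :: "nat \<Rightarrow> fm \<Rightarrow> bool" where
  "delta0 \<phi> \<Longrightarrow> is_Sigma 0 \<phi>"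
| "delta0 \<phi> \<Longrightarrow> is_Pi 0 \<phi>"
| "is_Pi k \<phi> \<Longrightarrow> is_Sigma (Suc k) (ExN x \<phi>)"
| "is_Sigma k \<phi> \<Longrightarrow> is_Pi (Suc k) (AllN x \<phi>)"


section \<open>The axiom systems\<close>

definition universal_closures :: "fm set \<Rightarrow> fm set" where
  "universal_closures \<Phi> = {AllSs Xs (AllNs xs \<phi>) | Xs xs \<phi>. \<phi> \<in> \<Phi> \<and> sentence (AllSs Xs (AllNs xs \<phi>))}"

definition basic_axioms :: "fm set" where
  "basic_axioms =
    (let m = NVar ''m''; n = NVar ''n'' in
     {\<^bold>\<not> n \<^bold>+ \<^bold>1 \<^bold>= \<^bold>0,
      m \<^bold>+ \<^bold>1 \<^bold>= n \<^bold>+ \<^bold>1 \<^bold>\<longrightarrow> m \<^bold>= n,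
      m \<^bold>+ \<^bold>0 \<^bold>= m,
      m \<^bold>+ (n \<^bold>+ \<^bold>1) \<^bold>= (m \<^bold>+ n) \<^bold>+ \<^bold>1,
      m \<^bold>* \<^bold>0 \<^bold>= \<^bold>0,
      m \<^bold>* (n \<^bold>+ \<^bold>1) \<^bold>= (m \<^bold>* n) \<^bold>+ m,
      \<^bold>\<not> m \<^bold>< \<^bold>0,
      m \<^bold>< n \<^bold>+ \<^bold>1 \<^bold>\<longleftrightarrow> (m \<^bold>< n \<^bold>\<or> m \<^bold>= n)})"

definition induction_axiom :: "string \<Rightarrow> fm \<Rightarrow> fm" where
  "induction_axiom n \<phi> =
    (nsubst n \<^bold>0 \<phi> \<^bold>\<and> AllN n (\<phi> \<^bold>\<longrightarrow> nsubst n (NVar n \<^bold>+ \<^bold>1) \<phi>) \<^bold>\<longrightarrow> AllN n \<phi>)"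

definition ISigma :: "nat \<Rightarrow> fm set" where
  "ISigma k = universal_closures {induction_axiom n \<phi> | n \<phi>. is_Sigma k \<phi>}"

definition Delta1_CA :: "fm set" where
  "Delta1_CA = universal_closures
    {AllN n (\<phi> \<^bold>\<longleftrightarrow> \<psi>) \<^bold>\<longrightarrow> ExS X (AllN n (NVar n \<^bold>\<in> SVar X \<^bold>\<longleftrightarrow> \<phi>)) | n \<phi> \<psi> X.
      is_Sigma 1 \<phi> \<and> is_Pi 1 \<psi> \<and> X \<notin> free_svars \<phi>}"

definition RCA0 :: "fm set" where
  "RCA0 = universal_closures basic_axioms \<union> ISigma 1 \<union> Delta1_CA"


section \<open>Colorings of pairs\<close>

definition pair :: "tm \<Rightarrow> tm \<Rightarrow> tm" where
  "pair t u = (t \<^bold>+ u) \<^bold>* (t \<^bold>+ u) \<^bold>+ t"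

text \<open>
  A coloring of the pairs \<open>x < s\<close> is coded by the set of triples \<open>((x, s), y)\<close> such that the
  pair has color \<open>y\<close>. The formulas below take the name of a set variable; all number variables
  they bind are fixed names. The terms given to \<open>color\<close> and \<open>same_color\<close> must not contain the
  variable \<open>c\<close>.
\<close>

definition color :: "string \<Rightarrow> tm \<Rightarrow> tm \<Rightarrow> tm \<Rightarrow> fm" where
  "color F x s y = (pair (pair x s) y \<^bold>\<in> SVar F)"

definition same_color :: "string \<Rightarrow> tm \<Rightarrow> tm \<Rightarrow> tm \<Rightarrow> tm \<Rightarrow> fm" where
  "same_color F x s x' s' = ExN ''c'' (color F x s (NVar ''c'') \<^bold>\<and> color F x' s' (NVar ''c''))"

definition coloring :: "string \<Rightarrow> fm" where
  "coloring F =
    (let n = NVar ''n''; x = NVar ''x''; s = NVar ''s''; y = NVar ''y''; z = NVar ''z'' in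
     AllN ''n'' (n \<^bold>\<in> SVar F \<^bold>\<longrightarrow> ExNs [''x'', ''s'', ''y''] (x \<^bold>< s \<^bold>\<and> n \<^bold>= pair (pair x s) y)) \<^bold>\<and>
     AllNs [''x'', ''s''] (x \<^bold>< s \<^bold>\<longrightarrow> ExN ''y'' (color F x s y)) \<^bold>\<and>
     AllNs [''x'', ''s'', ''y'', ''z''] (color F x s y \<^bold>\<and> color F x s z \<^bold>\<longrightarrow> y \<^bold>= z))"

definition infinite_set :: "string \<Rightarrow> fm" where
  "infinite_set A = AllN ''b'' (ExN ''x'' (NVar ''b'' \<^bold>< NVar ''x'' \<^bold>\<and> NVar ''x'' \<^bold>\<in> SVar A))"

definition stable :: "string \<Rightarrow> fm" where
  "stable F =
    (let x = NVar ''x''; s = NVar ''s''; y = NVar ''y''; b = NVar ''b'' in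
     AllN ''x'' (ExNs [''y'', ''b''] (AllN ''s'' (b \<^bold>< s \<^bold>\<and> x \<^bold>< s \<^bold>\<longrightarrow> color F x s y))))"

definition thin :: "string \<Rightarrow> string \<Rightarrow> fm" where
  "thin A F =
    (let x = NVar ''x''; s = NVar ''s''; y = NVar ''y'' in
     ExN ''y'' (\<^bold>\<not> ExNs [''x'', ''s'']
       (x \<^bold>\<in> SVar A \<^bold>\<and> s \<^bold>\<in> SVar A \<^bold>\<and> x \<^bold>< s \<^bold>\<and> color F x s y)))"

definition STS2 :: fm where
  "STS2 = AllS ''F'' (coloring ''F'' \<^bold>\<and> stable ''F'' \<^bold>\<longrightarrow>
    ExS ''A'' (infinite_set ''A'' \<^bold>\<and> thin ''A'' ''F''))"

text \<open>\<open>|f\<^sup>-\<^sup>1(y)| \<le> 2\<close> is expressed as: among any three pairs of color \<open>y\<close>, two are equal.\<close>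

definition two_bounded :: "string \<Rightarrow> fm" where
  "two_bounded F =
    (let y = NVar ''y''; x1 = NVar ''x1''; s1 = NVar ''s1''; x2 = NVar ''x2''; s2 = NVar ''s2'';
         x3 = NVar ''x3''; s3 = NVar ''s3'' in
     AllNs [''y'', ''x1'', ''s1'', ''x2'', ''s2'', ''x3'', ''s3'']
       (color F x1 s1 y \<^bold>\<and> color F x2 s2 y \<^bold>\<and> color F x3 s3 y \<^bold>\<longrightarrow>
        (x1 \<^bold>= x2 \<^bold>\<and> s1 \<^bold>= s2) \<^bold>\<or> (x1 \<^bold>= x3 \<^bold>\<and> s1 \<^bold>= s3) \<^bold>\<or> (x2 \<^bold>= x3 \<^bold>\<and> s2 \<^bold>= s3)))"

text \<open>
  \<open>f(x, s)\<close> is undefined unless \<open>x < s\<close>; \<open>same_color F x s y s\<close> therefore entails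
  \<open>x < s\<close> and \<open>y < s\<close>.
\<close>

definition rainbow_stable :: "string \<Rightarrow> fm" where
  "rainbow_stable F =
    (let x = NVar ''x''; s = NVar ''s''; y = NVar ''y''; b = NVar ''b'' in
     AllN ''x''
       (ExN ''y'' (\<^bold>\<not> y \<^bold>= x \<^bold>\<and> ExN ''b'' (AllN ''s'' (b \<^bold>< s \<^bold>\<longrightarrow> same_color F x s y s)))
        \<^bold>\<or> ExN ''b'' (AllN ''s'' (b \<^bold>< s \<^bold>\<longrightarrow> \<^bold>\<not> ExN ''y'' (\<^bold>\<not> y \<^bold>= x \<^bold>\<and> same_color F x s y s)))))"

definition rainbow :: "string \<Rightarrow> string \<Rightarrow> fm" where
  "rainbow R F =
    (let x1 = NVar ''x1''; s1 = NVar ''s1''; x2 = NVar ''x2''; s2 = NVar ''s2'' in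
     AllNs [''x1'', ''s1'', ''x2'', ''s2'']
       (x1 \<^bold>\<in> SVar R \<^bold>\<and> s1 \<^bold>\<in> SVar R \<^bold>\<and> x1 \<^bold>< s1 \<^bold>\<and> x2 \<^bold>\<in> SVar R \<^bold>\<and> s2 \<^bold>\<in> SVar R \<^bold>\<and> x2 \<^bold>< s2 \<^bold>\<and>
        same_color F x1 s1 x2 s2 \<^bold>\<longrightarrow> x1 \<^bold>= x2 \<^bold>\<and> s1 \<^bold>= s2))"

definition SRRT22 :: fm where
  "SRRT22 = AllS ''F'' (coloring ''F'' \<^bold>\<and> rainbow_stable ''F'' \<^bold>\<and> two_bounded ''F'' \<^bold>\<longrightarrow>
    ExS ''R'' (infinite_set ''R'' \<^bold>\<and> rainbow ''R'' ''F''))"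

end

theory Submission
  imports Defs "HOL-Library.Countable_Set"
begin

text \<open>
  By the completeness theorem for the calculus, proved here with Henkin sets, it suffices to show
  the implication in every countable model \<open>M\<close> of the axioms. There, let \<open>f\<close> be \<open>2\<close>-bounded and
  rainbow-stable. Call \<open>y \<noteq> x\<close> the partner of \<open>x\<close> if \<open>f(x, s) = f(y, s)\<close> for all large \<open>s\<close>; by
  \<open>2\<close>-boundedness it is unique, and it can be guessed at each stage \<open>s\<close>. If no two elements
  of a finite set are partners, then all large numbers are compatible with it, so that a rainbow can be
  built greedily as long as partners are avoided.

  To avoid them, restrict the rainbow to codes of sequences from a set \<open>A\<close> that is thin for a stable coloring \<open>g\<close>.
  The limit colors of \<open>g\<close> are chosen such that, for every \<open>x\<close> and every color \<open>i\<close>, if the partner of \<open>x\<close>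
  codes a sequence that is long compared with \<open>(x, i)\<close>, then some member of that sequence receives color
  \<open>i\<close>. If \<open>A\<close> omits the color \<open>i\<close>, then no code of a long sequence from \<open>A\<close> is the partner of \<open>x\<close>.
\<close>

section \<open>Structures and satisfaction\<close>

text \<open>The coloring \<open>g\<close> must be built before its thin set \<open>A\<close>, and
  hence the omitted color \<open>i\<close>, is known, so every pair (x, i) becomes a requirement.
  Many requirements may compete for members of the same code. They are therefore ordered by the
  number \<open>pr x i\<close>, and "long" is measured against that number: each stronger
  requirement takes at most one member, so one is left over. Guesses at partners may change, but
  they have limits; this is why a stable coloring suffices.

  The main obstacle is induction. The model may be nonstandard, so codes of finite sets, the
  pigeonhole principle and recursion all have to come from Sigma_1 induction inside it. Sigma_2
  induction serves to find one stage by which all requirements below a given number have settled,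
  and, in the form of collection, one number beyond which everything is compatible with a bounded
  rainbow.

  To keep this manageable, definability is proved for predicates on environments by introduction
  rules and translated into formulas only where an axiom is invoked, and the carrier of the model is
  made a type class instance so that ordinary algebra applies to it.\<close>

record 'n struct =
  zero_of :: 'n
  one_of :: 'n
  add_of :: "'n \<Rightarrow> 'n \<Rightarrow> 'n"
  mul_of :: "'n \<Rightarrow> 'n \<Rightarrow> 'n"
  less_of :: "'n \<Rightarrow> 'n \<Rightarrow> bool"
  sets_of :: "'n set set"
  npar_of :: "nat \<Rightarrow> 'n"
  spar_of :: "nat \<Rightarrow> 'n set"

primrec eval_tm :: "'n struct \<Rightarrow> (string \<Rightarrow> 'n) \<Rightarrow> tm \<Rightarrow> 'n" where
  "eval_tm M \<rho> (NVar x) = \<rho> x"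
| "eval_tm M \<rho> (NPar a) = npar_of M a"
| "eval_tm M \<rho> \<^bold>0 = zero_of M"
| "eval_tm M \<rho> \<^bold>1 = one_of M"
| "eval_tm M \<rho> (t \<^bold>+ u) = add_of M (eval_tm M \<rho> t) (eval_tm M \<rho> u)"
| "eval_tm M \<rho> (t \<^bold>* u) = mul_of M (eval_tm M \<rho> t) (eval_tm M \<rho> u)"

primrec eval_stm :: "'n struct \<Rightarrow> (string \<Rightarrow> 'n set) \<Rightarrow> stm \<Rightarrow> 'n set" where
  "eval_stm M E (SVar X) = E X"
| "eval_stm M E (SPar A) = spar_of M A"

primrec sat :: "'n struct \<Rightarrow> (string \<Rightarrow> 'n) \<Rightarrow> (string \<Rightarrow> 'n set) \<Rightarrow> fm \<Rightarrow> bool" where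
  "sat M \<rho> E \<^bold>\<bottom> \<longleftrightarrow> False"
| "sat M \<rho> E (t \<^bold>= u) \<longleftrightarrow> eval_tm M \<rho> t = eval_tm M \<rho> u"
| "sat M \<rho> E (t \<^bold>< u) \<longleftrightarrow> less_of M (eval_tm M \<rho> t) (eval_tm M \<rho> u)"
| "sat M \<rho> E (t \<^bold>\<in> T) \<longleftrightarrow> eval_tm M \<rho> t \<in> eval_stm M E T"
| "sat M \<rho> E (\<phi> \<^bold>\<longrightarrow> \<psi>) \<longleftrightarrow> (sat M \<rho> E \<phi> \<longrightarrow> sat M \<rho> E \<psi>)"
| "sat M \<rho> E (AllN x \<phi>) \<longleftrightarrow> (\<forall>v. sat M (\<rho>(x := v)) E \<phi>)"
| "sat M \<rho> E (AllS X \<phi>) \<longleftrightarrow> (\<forall>V\<in>sets_of M. sat M \<rho> (E(X := V)) \<phi>)"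

lemma sat_connectives [simp]:
  "sat M \<rho> E (\<^bold>\<not> \<phi>) \<longleftrightarrow> \<not> sat M \<rho> E \<phi>"
  "sat M \<rho> E (\<phi> \<^bold>\<or> \<psi>) \<longleftrightarrow> sat M \<rho> E \<phi> \<or> sat M \<rho> E \<psi>"
  "sat M \<rho> E (\<phi> \<^bold>\<and> \<psi>) \<longleftrightarrow> sat M \<rho> E \<phi> \<and> sat M \<rho> E \<psi>"
  "sat M \<rho> E (\<phi> \<^bold>\<longleftrightarrow> \<psi>) \<longleftrightarrow> (sat M \<rho> E \<phi> \<longleftrightarrow> sat M \<rho> E \<psi>)"
  "sat M \<rho> E (ExN x \<phi>) \<longleftrightarrow> (\<exists>v. sat M (\<rho>(x := v)) E \<phi>)"
  "sat M \<rho> E (ExS X \<phi>) \<longleftrightarrow> (\<exists>V\<in>sets_of M. sat M \<rho> (E(X := V)) \<phi>)"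
  by (auto simp: Neg_def Or_def And_def Iff_def ExN_def ExS_def)

lemma eval_tm_cong: "(\<And>x. x \<in> tm_vars t \<Longrightarrow> \<rho> x = \<rho>' x) \<Longrightarrow> eval_tm M \<rho> t = eval_tm M \<rho>' t"
  by (induction t) auto

lemma sat_cong:
  assumes "\<And>x. x \<in> free_nvars \<phi> \<Longrightarrow> \<rho> x = \<rho>' x" "\<And>X. X \<in> free_svars \<phi> \<Longrightarrow> E X = E' X"
  shows "sat M \<rho> E \<phi> \<longleftrightarrow> sat M \<rho>' E' \<phi>"
  using assms
proof (induction \<phi> arbitrary: \<rho> \<rho>' E E')
  case (AllN x \<phi>)
  have "sat M (\<rho>(x := v)) E \<phi> = sat M (\<rho>'(x := v)) E' \<phi>" for v
    by (rule AllN.IH) (use AllN.prems in auto)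
  then show ?case by simp
next
  case (AllS X \<phi>)
  have "sat M \<rho> (E(X := v)) \<phi> = sat M \<rho>' (E'(X := v)) \<phi>" for v
    by (rule AllS.IH) (use AllS.prems in auto)
  then show ?case by simp
next
  case (Mem t T)
  then show ?case using eval_tm_cong[of t \<rho> \<rho>'] by (cases T) auto
next
  case (Imp \<phi> \<psi>)
  then show ?case by (metis UnCI free_nvars.simps(5) free_svars.simps(5) sat.simps(5))
next
  case (Eq t u)
  then show ?case using eval_tm_cong[of t \<rho> \<rho>'] eval_tm_cong[of u \<rho> \<rho>'] by simp
next
  case (Less t u)
  then show ?case using eval_tm_cong[of t \<rho> \<rho>'] eval_tm_cong[of u \<rho> \<rho>'] by simp
qed auto

lemma eval_tm_subst: "eval_tm M \<rho> (tm_subst x r t) = eval_tm M (\<rho>(x := eval_tm M \<rho> r)) t"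
  by (induction t) auto

text \<open>The hypothesis admits closed terms and the successor term of the induction axiom. A
  quantifier over a variable other than \<open>x\<close> captures nothing in \<open>r\<close>, and a
  quantifier over \<open>x\<close> blocks the substitution and overrides the assignment
  alike.\<close>

lemma sat_nsubst:
  assumes "tm_vars r \<subseteq> {x}"
  shows "sat M \<rho> E (nsubst x r \<phi>) \<longleftrightarrow> sat M (\<rho>(x := eval_tm M \<rho> r)) E \<phi>"
proof (induction \<phi> arbitrary: \<rho> E)
  case (AllN y \<phi>)
  show ?case
  proof (cases "y = x")
    case False
    have "eval_tm M (\<rho>(y := v)) r = eval_tm M \<rho> r" for v
      by (rule eval_tm_cong) (use assms False in auto)
    then have "sat M (\<rho>(y := v)) E (nsubst x r \<phi>) \<longleftrightarrow> sat M (\<rho>(x := eval_tm M \<rho> r, y := v)) E \<phi>" for v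
      using AllN.IH[of "\<rho>(y := v)" E] fun_upd_twist[OF False, of \<rho> v "eval_tm M \<rho> r"] by metis
    then show ?thesis using False by (simp only: nsubst.simps sat.simps if_False simp_thms)
  qed (simp only: nsubst.simps sat.simps if_True fun_upd_upd simp_thms)
qed (auto simp: eval_tm_subst)

lemma sat_ssubst:
  "sat M \<rho> E (ssubst X (SPar A) \<phi>) \<longleftrightarrow> sat M \<rho> (E(X := spar_of M A)) \<phi>"
proof (induction \<phi> arbitrary: \<rho> E)
  case (Mem t T)
  then show ?case by (cases T) auto
next
  case (AllS Y \<phi>)
  show ?case
  proof (cases "Y = X")
    case False
    then have "sat M \<rho> (E(Y := V)) (ssubst X (SPar A) \<phi>) \<longleftrightarrow> sat M \<rho> (E(X := spar_of M A, Y := V)) \<phi>" for V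
      using AllS[of \<rho> "E(Y := V)"] fun_upd_twist[OF False, of E V "spar_of M A"] by metis
    then show ?thesis using False by (simp only: ssubst.simps sat.simps if_False simp_thms)
  qed (simp only: ssubst.simps sat.simps if_True fun_upd_upd simp_thms)
qed auto

section \<open>Maximal consistent sets\<close>

instance tm :: countable by countable_datatype
instance stm :: countable by countable_datatype
instance fm :: countable by countable_datatype

definition consistent :: "fm set \<Rightarrow> bool" where
  "consistent \<Gamma> \<longleftrightarrow> \<not> (\<Gamma> \<^bold>\<turnstile> \<^bold>\<bottom>)"

text \<open>Assumptions discharged by a rule are removed from the finite set again, and
  eigenvariables stay fresh because fewer assumptions mention fewer parameters.\<close>

lemma derives_finite:
  "\<Gamma> \<^bold>\<turnstile> \<phi> \<Longrightarrow> \<exists>\<Delta>. finite \<Delta> \<and> \<Delta> \<subseteq> \<Gamma> \<and> (\<Delta> \<^bold>\<turnstile> \<phi>)"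
proof (induction rule: derives.induct)
  case (Assm \<phi> \<Gamma>)
  then show ?case by (intro exI[of _ "{\<phi>}"]) (auto intro: derives.Assm)
next
  case (Weaken \<Gamma> \<phi> \<Delta>)
  then show ?case by blast
next
  case (ImpI \<phi> \<Gamma> \<psi>)
  then obtain \<Delta> where \<Delta>: "finite \<Delta>" "\<Delta> \<subseteq> insert \<phi> \<Gamma>" "\<Delta> \<^bold>\<turnstile> \<psi>" by blast
  have "insert \<phi> (\<Delta> - {\<phi>}) \<^bold>\<turnstile> \<psi>" by (rule derives.Weaken[OF \<Delta>(3)]) blast
  then have "\<Delta> - {\<phi>} \<^bold>\<turnstile> (\<phi> \<^bold>\<longrightarrow> \<psi>)" by (rule derives.ImpI)
  with \<Delta> show ?case by (intro exI[of _ "\<Delta> - {\<phi>}"]) auto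
next
  case (Contr \<phi> \<Gamma>)
  then obtain \<Delta> where \<Delta>: "finite \<Delta>" "\<Delta> \<subseteq> insert (\<^bold>\<not> \<phi>) \<Gamma>" "\<Delta> \<^bold>\<turnstile> \<^bold>\<bottom>" by blast
  have "insert (\<^bold>\<not> \<phi>) (\<Delta> - {\<^bold>\<not> \<phi>}) \<^bold>\<turnstile> \<^bold>\<bottom>" by (rule derives.Weaken[OF \<Delta>(3)]) blast
  then have "\<Delta> - {\<^bold>\<not> \<phi>} \<^bold>\<turnstile> \<phi>" by (rule derives.Contr)
  with \<Delta> show ?case by (intro exI[of _ "\<Delta> - {\<^bold>\<not> \<phi>}"]) auto
next
  case (ImpE \<Gamma> \<phi> \<psi>)
  then obtain \<Delta> \<Delta>' where \<Delta>: "finite \<Delta>" "\<Delta> \<subseteq> \<Gamma>" "\<Delta> \<^bold>\<turnstile> (\<phi> \<^bold>\<longrightarrow> \<psi>)" "finite \<Delta>'" "\<Delta>' \<subseteq> \<Gamma>" "\<Delta>' \<^bold>\<turnstile> \<phi>"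
    by blast
  have "\<Delta> \<union> \<Delta>' \<^bold>\<turnstile> \<psi>"
    by (rule derives.ImpE[OF derives.Weaken[OF \<Delta>(3)] derives.Weaken[OF \<Delta>(6)]]) auto
  with \<Delta> show ?case by (intro exI[of _ "\<Delta> \<union> \<Delta>'"]) auto
next
  case (Subst \<Gamma> t u x \<phi>)
  then obtain \<Delta> \<Delta>' where \<Delta>: "finite \<Delta>" "\<Delta> \<subseteq> \<Gamma>" "\<Delta> \<^bold>\<turnstile> (t \<^bold>= u)" "finite \<Delta>'" "\<Delta>' \<subseteq> \<Gamma>"
    "\<Delta>' \<^bold>\<turnstile> nsubst x t \<phi>"
    by blast
  have "\<Delta> \<union> \<Delta>' \<^bold>\<turnstile> nsubst x u \<phi>"
    by (rule derives.Subst[OF derives.Weaken[OF \<Delta>(3)] derives.Weaken[OF \<Delta>(6)]]) (use Subst.hyps in auto)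
  with \<Delta> show ?case by (intro exI[of _ "\<Delta> \<union> \<Delta>'"]) auto
next
  case (AllNI \<Gamma> x a \<phi>)
  then obtain \<Delta> where \<Delta>: "finite \<Delta>" "\<Delta> \<subseteq> \<Gamma>" "\<Delta> \<^bold>\<turnstile> nsubst x (NPar a) \<phi>" by blast
  have "\<Delta> \<^bold>\<turnstile> AllN x \<phi>" by (rule derives.AllNI[OF \<Delta>(3)]) (use AllNI.hyps \<Delta>(2) in auto)
  with \<Delta> show ?case by blast
next
  case (AllSI \<Gamma> X A \<phi>)
  then obtain \<Delta> where \<Delta>: "finite \<Delta>" "\<Delta> \<subseteq> \<Gamma>" "\<Delta> \<^bold>\<turnstile> ssubst X (SPar A) \<phi>" by blast
  have "\<Delta> \<^bold>\<turnstile> AllS X \<phi>" by (rule derives.AllSI[OF \<Delta>(3)]) (use AllSI.hyps \<Delta>(2) in auto)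
  with \<Delta> show ?case by blast
next
  case (AllNE \<Gamma> x \<phi> t)
  then show ?case by (blast intro: derives.AllNE)
next
  case (AllSE \<Gamma> X \<phi> A)
  then show ?case by (blast intro: derives.AllSE)
next
  case (Refl t \<Gamma>)
  then show ?case by (blast intro: derives.Refl)
qed

text \<open>Only negated universal formulas get a witness. Its parameter is fresh for all of
  \<open>\<Delta>\<close>, to which \<open>\<phi>\<close> itself belongs wherever the definition is
  used.\<close>

definition witnesses :: "fm set \<Rightarrow> fm \<Rightarrow> fm set" where
  "witnesses \<Delta> \<phi> = (case \<phi> of
      (AllN x \<psi> \<^bold>\<longrightarrow> \<^bold>\<bottom>) \<Rightarrow> {\<^bold>\<not> nsubst x (NPar (SOME a. a \<notin> \<Union>(npars ` \<Delta>))) \<psi>}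
    | (AllS X \<psi> \<^bold>\<longrightarrow> \<^bold>\<bottom>) \<Rightarrow> {\<^bold>\<not> ssubst X (SPar (SOME A. A \<notin> \<Union>(spars ` \<Delta>))) \<psi>}
    | _ \<Rightarrow> {})"

definition henkin_step :: "fm set \<Rightarrow> fm \<Rightarrow> fm set" where
  "henkin_step \<Gamma> \<phi> =
    (if consistent (insert \<phi> \<Gamma>) then insert \<phi> \<Gamma> \<union> witnesses (insert \<phi> \<Gamma>) \<phi> else \<Gamma>)"

text \<open>The step at index \<open>to_nat \<phi>\<close> decides \<open>\<phi>\<close> and adds
  its witness at once.\<close>

primrec henkin_chain :: "fm set \<Rightarrow> nat \<Rightarrow> fm set" where
  "henkin_chain \<Gamma> 0 = \<Gamma>"
| "henkin_chain \<Gamma> (Suc n) = henkin_step (henkin_chain \<Gamma> n) (from_nat n)"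

definition henkin_ext :: "fm set \<Rightarrow> fm set" where
  "henkin_ext \<Gamma> = (\<Union>n. henkin_chain \<Gamma> n)"

lemma tm_pars_finite: "finite (tm_pars t)"
  by (induction t) auto

lemma pars_finite: "finite (npars \<phi>)" "finite (spars \<phi>)"
proof (induction \<phi>)
  case (Mem t T)
  { case 1 show ?case by (simp add: tm_pars_finite) }
  { case 2 show ?case by (cases T) auto }
qed (auto simp: tm_pars_finite)

text \<open>The invariant that keeps fresh parameters available: a theory of sentences mentions
  none, and each step adds finitely many.\<close>

definition few_pars :: "fm set \<Rightarrow> bool" where
  "few_pars \<Gamma> \<longleftrightarrow> finite (\<Union>(npars ` \<Gamma>)) \<and> finite (\<Union>(spars ` \<Gamma>))"

lemma witnesses_cases:
  obtains "witnesses \<Delta> \<phi> = {}"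
  | x \<psi> where "\<phi> = (AllN x \<psi> \<^bold>\<longrightarrow> \<^bold>\<bottom>)"
      "witnesses \<Delta> \<phi> = {\<^bold>\<not> nsubst x (NPar (SOME a. a \<notin> \<Union>(npars ` \<Delta>))) \<psi>}"
  | X \<psi> where "\<phi> = (AllS X \<psi> \<^bold>\<longrightarrow> \<^bold>\<bottom>)"
      "witnesses \<Delta> \<phi> = {\<^bold>\<not> ssubst X (SPar (SOME A. A \<notin> \<Union>(spars ` \<Delta>))) \<psi>}"
proof (cases "\<exists>\<psi>. \<phi> = (\<psi> \<^bold>\<longrightarrow> \<^bold>\<bottom>)")
  case True
  then obtain \<psi> where "\<phi> = (\<psi> \<^bold>\<longrightarrow> \<^bold>\<bottom>)" by blast
  then show thesis by (cases \<psi>) (auto simp: witnesses_def intro: that)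
next
  case False
  then have "witnesses \<Delta> \<phi> = {}" by (auto simp: witnesses_def split: fm.splits)
  then show thesis by (rule that(1))
qed

lemma few_pars_step: "few_pars \<Gamma> \<Longrightarrow> few_pars (henkin_step \<Gamma> \<phi>)"
  by (cases rule: witnesses_cases[of "insert \<phi> \<Gamma>" \<phi>]) (auto simp: few_pars_def henkin_step_def pars_finite)

text \<open>If a fresh witness led to a contradiction, the denied instance would be derivable, and
  generalising over the fresh parameter would derive the universal formula whose negation has just
  been added.\<close>

lemma consistent_step:
  assumes "consistent \<Gamma>" "few_pars \<Gamma>"
  shows "consistent (henkin_step \<Gamma> \<phi>)"
proof (cases "consistent (insert \<phi> \<Gamma>)")
  case True
  let ?\<Delta> = "insert \<phi> \<Gamma>"
  have fresh: "(SOME a. a \<notin> \<Union>(npars ` ?\<Delta>)) \<notin> \<Union>(npars ` ?\<Delta>)"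
    "(SOME a. a \<notin> \<Union>(spars ` ?\<Delta>)) \<notin> \<Union>(spars ` ?\<Delta>)"
    by (rule someI_ex, rule ex_new_if_finite, simp,
        use assms(2) in \<open>simp add: few_pars_def pars_finite\<close>)+
  show ?thesis
  proof (cases rule: witnesses_cases[of ?\<Delta> \<phi>])
    case 1
    then show ?thesis using True by (simp add: henkin_step_def)
  next
    case (2 x \<psi>)
    let ?a = "SOME a. a \<notin> \<Union>(npars ` ?\<Delta>)"
    have "\<not> (insert (\<^bold>\<not> nsubst x (NPar ?a) \<psi>) ?\<Delta> \<^bold>\<turnstile> \<^bold>\<bottom>)"
    proof
      assume "insert (\<^bold>\<not> nsubst x (NPar ?a) \<psi>) ?\<Delta> \<^bold>\<turnstile> \<^bold>\<bottom>"
      then have "?\<Delta> \<^bold>\<turnstile> nsubst x (NPar ?a) \<psi>" by (rule Contr)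
      then have "?\<Delta> \<^bold>\<turnstile> AllN x \<psi>" by (rule AllNI) (use fresh(1) 2(1) in auto)
      moreover have "?\<Delta> \<^bold>\<turnstile> (AllN x \<psi> \<^bold>\<longrightarrow> \<^bold>\<bottom>)" by (rule Assm) (simp add: 2(1))
      ultimately have "?\<Delta> \<^bold>\<turnstile> \<^bold>\<bottom>" by (blast intro: ImpE)
      with True show False by (simp add: consistent_def)
    qed
    then show ?thesis using True 2(2) by (simp add: henkin_step_def consistent_def)
  next
    case (3 X \<psi>)
    let ?a = "SOME a. a \<notin> \<Union>(spars ` ?\<Delta>)"
    have "\<not> (insert (\<^bold>\<not> ssubst X (SPar ?a) \<psi>) ?\<Delta> \<^bold>\<turnstile> \<^bold>\<bottom>)"
    proof
      assume "insert (\<^bold>\<not> ssubst X (SPar ?a) \<psi>) ?\<Delta> \<^bold>\<turnstile> \<^bold>\<bottom>"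
      then have "?\<Delta> \<^bold>\<turnstile> ssubst X (SPar ?a) \<psi>" by (rule Contr)
      then have "?\<Delta> \<^bold>\<turnstile> AllS X \<psi>" by (rule AllSI) (use fresh(2) 3(1) in auto)
      moreover have "?\<Delta> \<^bold>\<turnstile> (AllS X \<psi> \<^bold>\<longrightarrow> \<^bold>\<bottom>)" by (rule Assm) (simp add: 3(1))
      ultimately have "?\<Delta> \<^bold>\<turnstile> \<^bold>\<bottom>" by (blast intro: ImpE)
      with True show False by (simp add: consistent_def)
    qed
    then show ?thesis using True 3(2) by (simp add: henkin_step_def consistent_def)
  qed
qed (use assms in \<open>simp add: henkin_step_def\<close>)

locale henkin =
  fixes H :: "fm set"
  assumes consistent: "consistent H"
    and closed: "H \<^bold>\<turnstile> \<phi> \<Longrightarrow> \<phi> \<in> H"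
    and complete: "\<phi> \<notin> H \<Longrightarrow> (\<^bold>\<not> \<phi>) \<in> H"
    and nwitness: "(\<^bold>\<not> AllN x \<psi>) \<in> H \<Longrightarrow> \<exists>a. (\<^bold>\<not> nsubst x (NPar a) \<psi>) \<in> H"
    and switness: "(\<^bold>\<not> AllS X \<psi>) \<in> H \<Longrightarrow> \<exists>A. (\<^bold>\<not> ssubst X (SPar A) \<psi>) \<in> H"

lemma henkin_ext:
  assumes "consistent \<Gamma>" "few_pars \<Gamma>"
  shows "henkin (henkin_ext \<Gamma>)"
proof
  let ?C = "henkin_chain \<Gamma>" and ?H = "henkin_ext \<Gamma>"
  have chain: "consistent (?C n) \<and> few_pars (?C n)" for n
    by (induction n) (use assms consistent_step few_pars_step in auto)
  have "?C n \<subseteq> ?C (Suc n)" for n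
    by (auto simp: henkin_step_def)
  then have mono: "?C m \<subseteq> ?C n" if "m \<le> n" for m n
    using lift_Suc_mono_le[of ?C] that by blast
  have sub: "?C n \<subseteq> ?H" for n by (auto simp: henkin_ext_def)
  have step: "insert \<phi> (?C (to_nat \<phi>)) \<union> witnesses (insert \<phi> (?C (to_nat \<phi>))) \<phi> \<subseteq> ?H"
    if "consistent (insert \<phi> (?C (to_nat \<phi>)))" for \<phi>
    using sub[of "Suc (to_nat \<phi>)"] that by (simp add: henkin_step_def)
  have compact: "\<exists>n. \<Delta> \<subseteq> ?C n" if "finite \<Delta>" "\<Delta> \<subseteq> ?H" for \<Delta>
    using that
  proof (induction \<Delta>)
    case (insert \<phi> \<Delta>)
    then obtain m n where "\<Delta> \<subseteq> ?C m" "\<phi> \<in> ?C n" by (auto simp: henkin_ext_def)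
    then have "insert \<phi> \<Delta> \<subseteq> ?C (max m n)" using mono[of m "max m n"] mono[of n "max m n"] by auto
    then show ?case by blast
  qed auto
  show cons: "consistent ?H"
    unfolding consistent_def
  proof
    assume "?H \<^bold>\<turnstile> \<^bold>\<bottom>"
    then obtain \<Delta> n where "\<Delta> \<^bold>\<turnstile> \<^bold>\<bottom>" "\<Delta> \<subseteq> ?C n" using derives_finite compact by blast
    then have "?C n \<^bold>\<turnstile> \<^bold>\<bottom>" by (blast intro: Weaken)
    then show False using chain by (simp add: consistent_def)
  qed
  show closed: "\<phi> \<in> ?H" if "?H \<^bold>\<turnstile> \<phi>" for \<phi>
  proof -
    \<comment> \<open>Otherwise \<open>?H\<close> would derive both \<open>\<phi>\<close> and its
      negation.\<close>
    have "consistent (insert \<phi> (?C (to_nat \<phi>)))"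
      unfolding consistent_def
    proof
      assume "insert \<phi> (?C (to_nat \<phi>)) \<^bold>\<turnstile> \<^bold>\<bottom>"
      then have "?H \<^bold>\<turnstile> (\<phi> \<^bold>\<longrightarrow> \<^bold>\<bottom>)" using sub by (blast intro: ImpI Weaken)
      then show False using that cons by (blast intro: ImpE[of _ \<phi>] dest: consistent_def[THEN iffD1])
    qed
    from step[OF this] show ?thesis by blast
  qed
  show "(\<^bold>\<not> \<phi>) \<in> ?H" if "\<phi> \<notin> ?H" for \<phi>
  proof -
    have "consistent (insert (\<^bold>\<not> \<phi>) (?C (to_nat (\<^bold>\<not> \<phi>))))"
      unfolding consistent_def
    proof
      assume "insert (\<^bold>\<not> \<phi>) (?C (to_nat (\<^bold>\<not> \<phi>))) \<^bold>\<turnstile> \<^bold>\<bottom>"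
      then have "?H \<^bold>\<turnstile> \<phi>" using sub by (blast intro: Contr Weaken)
      then show False using that closed by blast
    qed
    from step[OF this] show ?thesis by blast
  qed
  have sub_cons: "consistent (insert \<phi> (?C n))" if "\<phi> \<in> ?H" for \<phi> n
    using cons that sub[of n] Weaken[of "insert \<phi> (?C n)" "\<^bold>\<bottom>" ?H] by (auto simp: consistent_def)
  show "\<exists>a. (\<^bold>\<not> nsubst x (NPar a) \<psi>) \<in> ?H" if "(\<^bold>\<not> AllN x \<psi>) \<in> ?H" for x \<psi>
    using step[OF sub_cons[OF that]] by (auto simp: witnesses_def Neg_def)
  show "\<exists>A. (\<^bold>\<not> ssubst X (SPar A) \<psi>) \<in> ?H" if "(\<^bold>\<not> AllS X \<psi>) \<in> ?H" for X \<psi>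
    using step[OF sub_cons[OF that]] by (auto simp: witnesses_def Neg_def)
qed

section \<open>Truth in a Henkin set and the term model\<close>

lemma tm_subst_closed: "tm_vars t = {} \<Longrightarrow> tm_subst x r t = t"
  by (induction t) auto

text \<open>The truth lemma descends from a quantified formula to its instances, which are not
  subformulas; this measure is unchanged by substitution.\<close>

primrec depth :: "fm \<Rightarrow> nat" where
  "depth \<^bold>\<bottom> = 0"
| "depth (t \<^bold>= u) = 0"
| "depth (t \<^bold>< u) = 0"
| "depth (t \<^bold>\<in> T) = 0"
| "depth (\<phi> \<^bold>\<longrightarrow> \<psi>) = Suc (max (depth \<phi>) (depth \<psi>))"
| "depth (AllN x \<phi>) = Suc (depth \<phi>)"
| "depth (AllS X \<phi>) = Suc (depth \<phi>)"

lemma depth_subst [simp]: "depth (nsubst x t \<phi>) = depth \<phi>" "depth (ssubst X T \<phi>) = depth \<phi>"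
  by (induction \<phi>) auto

lemma tm_vars_subst: "tm_vars r = {} \<Longrightarrow> tm_vars (tm_subst x r t) = tm_vars t - {x}"
  by (induction t) auto

lemma free_nsubst:
  "tm_vars r = {} \<Longrightarrow> free_nvars (nsubst x r \<phi>) = free_nvars \<phi> - {x}"
  "free_svars (nsubst x r \<phi>) = free_svars \<phi>"
  by (induction \<phi>) (auto simp: tm_vars_subst)

lemma free_ssubst:
  "free_nvars (ssubst X (SPar A) \<phi>) = free_nvars \<phi>"
  "free_svars (ssubst X (SPar A) \<phi>) = free_svars \<phi> - {X}"
proof (induction \<phi>)
  case (Mem t T)
  { case 1 show ?case by simp }
  { case 2 show ?case by (cases T) auto }
qed auto

context henkin
begin

lemma bot: "\<^bold>\<bottom> \<notin> H"
  using consistent Assm unfolding consistent_def by blast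

lemma mp: "(\<phi> \<^bold>\<longrightarrow> \<psi>) \<in> H \<Longrightarrow> \<phi> \<in> H \<Longrightarrow> \<psi> \<in> H"
  by (rule closed[OF ImpE[OF Assm Assm]])

lemma neg: "(\<^bold>\<not> \<phi>) \<in> H \<longleftrightarrow> \<phi> \<notin> H"
  using mp bot complete unfolding Neg_def by blast

lemma imp: "(\<phi> \<^bold>\<longrightarrow> \<psi>) \<in> H \<longleftrightarrow> (\<phi> \<in> H \<longrightarrow> \<psi> \<in> H)"
proof
  show "(\<phi> \<^bold>\<longrightarrow> \<psi>) \<in> H" if "\<phi> \<in> H \<longrightarrow> \<psi> \<in> H"
  proof (rule closed, rule ImpI)
    show "insert \<phi> H \<^bold>\<turnstile> \<psi>"
    proof (cases "\<phi> \<in> H")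
      case True
      then show ?thesis using that by (blast intro: Assm)
    next
      case False
      then have "insert \<phi> H \<^bold>\<turnstile> (\<phi> \<^bold>\<longrightarrow> \<^bold>\<bottom>)" using complete by (auto simp: Neg_def intro: Assm)
      then have "insert \<phi> H \<^bold>\<turnstile> \<^bold>\<bottom>" by (rule ImpE) (auto intro: Assm)
      then show ?thesis by (blast intro: Contr Weaken)
    qed
  qed
qed (use mp in blast)

lemma all_n: "AllN x \<phi> \<in> H \<longleftrightarrow> (\<forall>t. tm_vars t = {} \<longrightarrow> nsubst x t \<phi> \<in> H)"
proof
  show "AllN x \<phi> \<in> H" if "\<forall>t. tm_vars t = {} \<longrightarrow> nsubst x t \<phi> \<in> H"
    using that nwitness[of x \<phi>] neg by fastforce
qed (use closed[OF AllNE[OF Assm]] in blast)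

lemma all_s: "AllS X \<phi> \<in> H \<longleftrightarrow> (\<forall>A. ssubst X (SPar A) \<phi> \<in> H)"
proof
  show "AllS X \<phi> \<in> H" if "\<forall>A. ssubst X (SPar A) \<phi> \<in> H"
    using that switness[of X \<phi>] neg by fastforce
qed (use closed[OF AllSE[OF Assm]] in blast)

lemma eq_refl: "tm_vars t = {} \<Longrightarrow> (t \<^bold>= t) \<in> H"
  by (rule closed[OF Refl])

lemma eq_subst:
  "(t \<^bold>= u) \<in> H \<Longrightarrow> nsubst x t \<phi> \<in> H \<Longrightarrow> tm_vars t = {} \<Longrightarrow> tm_vars u = {} \<Longrightarrow> nsubst x u \<phi> \<in> H"
  by (rule closed[OF Subst[OF Assm Assm]])

lemma eq_sym: "(t \<^bold>= u) \<in> H \<Longrightarrow> tm_vars t = {} \<Longrightarrow> tm_vars u = {} \<Longrightarrow> (u \<^bold>= t) \<in> H"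
  using eq_subst[of t u x "NVar x \<^bold>= t"] eq_refl[of t] by (simp add: tm_subst_closed)

lemma eq_trans:
  "(t \<^bold>= u) \<in> H \<Longrightarrow> (u \<^bold>= v) \<in> H \<Longrightarrow> tm_vars t = {} \<Longrightarrow> tm_vars u = {} \<Longrightarrow> tm_vars v = {} \<Longrightarrow> (t \<^bold>= v) \<in> H"
  using eq_subst[of u v x "t \<^bold>= NVar x"] by (simp add: tm_subst_closed)

lemma eq_cong:
  assumes "(t \<^bold>= t') \<in> H" "(u \<^bold>= u') \<in> H"
    and [simp]: "tm_vars t = {}" "tm_vars t' = {}" "tm_vars u = {}" "tm_vars u' = {}"
  shows "(t \<^bold>+ u \<^bold>= t' \<^bold>+ u') \<in> H" "(t \<^bold>* u \<^bold>= t' \<^bold>* u') \<in> H"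
    "(t \<^bold>< u) \<in> H \<Longrightarrow> (t' \<^bold>< u') \<in> H"
proof -
  have "(t \<^bold>+ u \<^bold>= t' \<^bold>+ u) \<in> H" "(t \<^bold>* u \<^bold>= t' \<^bold>* u) \<in> H"
    using eq_subst[OF assms(1), of x "t \<^bold>+ u \<^bold>= NVar x \<^bold>+ u"] eq_subst[OF assms(1), of x "t \<^bold>* u \<^bold>= NVar x \<^bold>* u"]
      eq_refl[of "t \<^bold>+ u"] eq_refl[of "t \<^bold>* u"]
    by (simp_all add: tm_subst_closed)
  then show "(t \<^bold>+ u \<^bold>= t' \<^bold>+ u') \<in> H" "(t \<^bold>* u \<^bold>= t' \<^bold>* u') \<in> H"
    using eq_subst[OF assms(2), of x "t \<^bold>+ u \<^bold>= t' \<^bold>+ NVar x"] eq_subst[OF assms(2), of x "t \<^bold>* u \<^bold>= t' \<^bold>* NVar x"]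
    by (simp_all add: tm_subst_closed)
  show "(t' \<^bold>< u') \<in> H" if "(t \<^bold>< u) \<in> H"
    using eq_subst[OF assms(1), of x "NVar x \<^bold>< u"] eq_subst[OF assms(2), of x "t' \<^bold>< NVar x"] that
    by (simp add: tm_subst_closed)
qed

lemma eq_mem: "(t \<^bold>= t') \<in> H \<Longrightarrow> tm_vars t = {} \<Longrightarrow> tm_vars t' = {} \<Longrightarrow> (t \<^bold>\<in> T) \<in> H \<Longrightarrow> (t' \<^bold>\<in> T) \<in> H"
  using eq_subst[of t t' x "NVar x \<^bold>\<in> T"] by simp

end

text \<open>Numerals show that the term model is infinite: by the successor axioms no two of them
  are equal in \<open>H\<close>.\<close>

primrec numeral_tm :: "nat \<Rightarrow> tm" where
  "numeral_tm 0 = \<^bold>0"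
| "numeral_tm (Suc n) = numeral_tm n \<^bold>+ \<^bold>1"

lemma numeral_tm_closed [simp]: "tm_vars (numeral_tm n) = {}"
  by (induction n) auto

lemma successor_axioms:
  "AllN ''n'' (\<^bold>\<not> NVar ''n'' \<^bold>+ \<^bold>1 \<^bold>= \<^bold>0) \<in> universal_closures basic_axioms"
  "AllN ''m'' (AllN ''n'' (NVar ''m'' \<^bold>+ \<^bold>1 \<^bold>= NVar ''n'' \<^bold>+ \<^bold>1 \<^bold>\<longrightarrow> NVar ''m'' \<^bold>= NVar ''n''))
    \<in> universal_closures basic_axioms"
proof -
  have *: "AllSs [] (AllNs xs \<phi>) \<in> universal_closures basic_axioms"
    if "\<phi> \<in> basic_axioms" "sentence (AllSs [] (AllNs xs \<phi>))" for xs \<phi>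
    using that unfolding universal_closures_def by blast
  show "AllN ''n'' (\<^bold>\<not> NVar ''n'' \<^bold>+ \<^bold>1 \<^bold>= \<^bold>0) \<in> universal_closures basic_axioms"
    using *[of "\<^bold>\<not> NVar ''n'' \<^bold>+ \<^bold>1 \<^bold>= \<^bold>0" "[''n'']"] by (simp add: basic_axioms_def Let_def sentence_def Neg_def)
  show "AllN ''m'' (AllN ''n'' (NVar ''m'' \<^bold>+ \<^bold>1 \<^bold>= NVar ''n'' \<^bold>+ \<^bold>1 \<^bold>\<longrightarrow> NVar ''m'' \<^bold>= NVar ''n''))
    \<in> universal_closures basic_axioms"
    using *[of "NVar ''m'' \<^bold>+ \<^bold>1 \<^bold>= NVar ''n'' \<^bold>+ \<^bold>1 \<^bold>\<longrightarrow> NVar ''m'' \<^bold>= NVar ''n''" "[''m'',''n'']"]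
    by (simp add: basic_axioms_def Let_def sentence_def)
qed

context henkin
begin

lemma numerals_distinct:
  assumes "universal_closures basic_axioms \<subseteq> H" "(numeral_tm m \<^bold>= numeral_tm n) \<in> H"
  shows "m = n"
proof -
  have ax1: "(t \<^bold>+ \<^bold>1 \<^bold>= \<^bold>0) \<notin> H" if "tm_vars t = {}" for t
    using successor_axioms(1) assms(1) that by (fastforce simp: all_n neg Neg_def imp bot)
  have ax2: "(t \<^bold>= u) \<in> H" if "(t \<^bold>+ \<^bold>1 \<^bold>= u \<^bold>+ \<^bold>1) \<in> H" and [simp]: "tm_vars t = {}" "tm_vars u = {}" for t u
  proof -
    have "nsubst ''n'' u (nsubst ''m'' t (NVar ''m'' \<^bold>+ \<^bold>1 \<^bold>= NVar ''n'' \<^bold>+ \<^bold>1 \<^bold>\<longrightarrow> NVar ''m'' \<^bold>= NVar ''n'')) \<in> H"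
      using successor_axioms(2) assms(1) by (auto simp: all_n simp del: nsubst.simps(5) nsubst.simps(2))
    then show ?thesis using that by (simp add: tm_subst_closed imp)
  qed
  show ?thesis using assms(2)
  proof (induction m arbitrary: n)
    case 0
    then show ?case using ax1 eq_sym by (cases n) fastforce+
  next
    case (Suc m)
    then show ?case using ax1 ax2 by (cases n) fastforce+
  qed
qed

text \<open>The domain of the term model is a type given in advance. Closed terms modulo the
  equations in \<open>H\<close> form countably many classes, infinitely many because of the
  numerals, so they can be matched one to one with that type.\<close>

lemma denotation:
  assumes "universal_closures basic_axioms \<subseteq> H" "infinite (UNIV :: 'n::countable set)"
  obtains d :: "tm \<Rightarrow> 'n::countable" where
    "\<And>t u. tm_vars t = {} \<Longrightarrow> tm_vars u = {} \<Longrightarrow> d t = d u \<longleftrightarrow> (t \<^bold>= u) \<in> H"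
    "\<And>v. \<exists>t. tm_vars t = {} \<and> d t = v"
proof -
  define C where "C = {t. tm_vars t = {}}"
  define cl where "cl t = {u \<in> C. (t \<^bold>= u) \<in> H}" for t
  have cl: "cl t = cl u \<longleftrightarrow> (t \<^bold>= u) \<in> H" if "t \<in> C" "u \<in> C" for t u
    using that eq_refl eq_sym eq_trans unfolding cl_def C_def by blast
  have "infinite (cl ` C)"
  proof -
    have "inj (\<lambda>n. cl (numeral_tm n))"
      using numerals_distinct[OF assms(1)] cl by (auto simp: inj_def C_def)
    then have "infinite (range (\<lambda>n. cl (numeral_tm n)))" by (rule range_inj_infinite)
    then show ?thesis by (rule contrapos_nn) (rule finite_subset, auto simp: C_def)
  qed
  moreover have "countable (cl ` C)" by simp
  ultimately have "bij_betw (to_nat_on (cl ` C)) (cl ` C) UNIV" by (intro to_nat_on_infinite)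
  moreover have "bij_betw (from_nat_into (UNIV :: 'n set)) UNIV UNIV"
    using assms(2) by (intro bij_betw_from_nat_into) auto
  ultimately obtain g where g: "bij_betw g (cl ` C) (UNIV :: 'n set)" using bij_betw_trans by blast
  show thesis
  proof (rule that)
    show "g (cl t) = g (cl u) \<longleftrightarrow> (t \<^bold>= u) \<in> H" if "tm_vars t = {}" "tm_vars u = {}" for t u
      using cl[of t u] inj_on_eq_iff[OF bij_betw_imp_inj_on[OF g], of "cl t" "cl u"] that by (simp add: C_def)
    show "\<exists>t. tm_vars t = {} \<and> g (cl t) = v" for v
    proof -
      have "v \<in> g ` cl ` C" by (simp only: bij_betw_imp_surj_on[OF g] UNIV_I)
      then show ?thesis by (auto simp: C_def)
    qed
  qed
qed

text \<open>Every element is denoted by a closed term and every set by a set parameter, so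
  quantifiers in the model reduce to the closed instances that the Henkin properties govern. Only
  sets named by parameters are present, which makes their family countable.\<close>

lemma term_model:
  assumes "universal_closures basic_axioms \<subseteq> H" "infinite (UNIV :: 'n::countable set)"
  shows "\<exists>M :: 'n::countable struct. countable (sets_of M) \<and> sets_of M \<noteq> {} \<and>
    (\<forall>\<phi> \<rho> E. free_nvars \<phi> = {} \<longrightarrow> free_svars \<phi> = {} \<longrightarrow> (sat M \<rho> E \<phi> \<longleftrightarrow> \<phi> \<in> H))"
proof -
  obtain d :: "tm \<Rightarrow> 'n" where
    d: "\<And>t u. tm_vars t = {} \<Longrightarrow> tm_vars u = {} \<Longrightarrow> d t = d u \<longleftrightarrow> (t \<^bold>= u) \<in> H"
    and surj: "\<And>v. \<exists>t. tm_vars t = {} \<and> d t = v"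
    using denotation[OF assms] by blast
  \<comment> \<open>A chosen closed term for each element. The operations below do not depend on the
    choice, because \<open>H\<close> is closed under congruence.\<close>
  define r where "r v = (SOME t. tm_vars t = {} \<and> d t = v)" for v
  have r: "tm_vars (r v) = {}" "d (r v) = v" for v
    using someI_ex[OF surj[of v]] by (auto simp: r_def)
  have rd: "(r (d t) \<^bold>= t) \<in> H" if "tm_vars t = {}" for t
    using d r that by metis
  define setof where "setof A = {d t | t. tm_vars t = {} \<and> (t \<^bold>\<in> SPar A) \<in> H}" for A
  define M where "M = \<lparr>zero_of = d \<^bold>0, one_of = d \<^bold>1, add_of = (\<lambda>v w. d (r v \<^bold>+ r w)),
    mul_of = (\<lambda>v w. d (r v \<^bold>* r w)), less_of = (\<lambda>v w. (r v \<^bold>< r w) \<in> H),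
    sets_of = range setof, npar_of = (\<lambda>a. d (NPar a)), spar_of = setof\<rparr>"
  have M_sets: "sets_of M = range setof" "spar_of M = setof"
    by (simp_all add: M_def)
  have ev: "eval_tm M \<rho> t = d t" if "tm_vars t = {}" for \<rho> t
    using that
  proof (induction t)
    case (Add t u)
    then show ?case using eq_cong(1)[of "r (d t)" t "r (d u)" u] rd r by (auto simp: M_def d)
  next
    case (Mul t u)
    then show ?case using eq_cong(2)[of "r (d t)" t "r (d u)" u] rd r by (auto simp: M_def d)
  qed (auto simp: M_def)
  have lt: "less_of M (d t) (d u) \<longleftrightarrow> (t \<^bold>< u) \<in> H" if "tm_vars t = {}" "tm_vars u = {}" for t u
  proof -
    have "(r (d t) \<^bold>< r (d u)) \<in> H \<longleftrightarrow> (t \<^bold>< u) \<in> H"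
      using eq_cong(3)[OF rd rd r(1) _ r(1), of t u]
        eq_cong(3)[OF eq_sym[OF rd r(1)] eq_sym[OF rd r(1)], of t u] that r(1) by blast
    then show ?thesis by (simp add: M_def)
  qed
  have mem: "d t \<in> setof A \<longleftrightarrow> (t \<^bold>\<in> SPar A) \<in> H" if "tm_vars t = {}" for t A
    using eq_mem[OF eq_sym] d that by (auto simp: setof_def)
  have "sat M \<rho> E \<phi> \<longleftrightarrow> \<phi> \<in> H" if "free_nvars \<phi> = {}" "free_svars \<phi> = {}" for \<phi> \<rho> E
    using that
  proof (induction "depth \<phi>" arbitrary: \<phi> \<rho> E rule: less_induct)
    case (less \<phi>)
    show ?case
    proof (cases \<phi>)
      case Fls
      then show ?thesis using bot by simp
    next
      case (Eq t u)
      then show ?thesis using less.prems by (simp add: ev d)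
    next
      case (Less t u)
      then show ?thesis using less.prems by (simp add: ev lt)
    next
      case (Mem t T)
      then show ?thesis using less.prems by (cases T) (simp_all add: ev mem M_sets)
    next
      case (Imp \<psi> \<chi>)
      then show ?thesis using less.prems less.hyps[of \<psi> \<rho> E] less.hyps[of \<chi> \<rho> E]
        by (simp add: imp less_Suc_eq_le)
    next
      case (AllN x \<psi>)
      have "sat M (\<rho>(x := d t)) E \<psi> \<longleftrightarrow> nsubst x t \<psi> \<in> H" if "tm_vars t = {}" for t
      proof -
        have "sat M (\<rho>(x := d t)) E \<psi> \<longleftrightarrow> sat M \<rho> E (nsubst x t \<psi>)"
          using that by (subst sat_nsubst) (auto simp: ev)
        also have "\<dots> \<longleftrightarrow> nsubst x t \<psi> \<in> H"
          using less.prems AllN that by (intro less.hyps) (auto simp: free_nsubst)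
        finally show ?thesis .
      qed
      moreover have "(\<forall>v. sat M (\<rho>(x := v)) E \<psi>) \<longleftrightarrow> (\<forall>t. tm_vars t = {} \<longrightarrow> sat M (\<rho>(x := d t)) E \<psi>)"
        using surj by metis
      ultimately show ?thesis using AllN by (simp add: all_n)
    next
      case (AllS X \<psi>)
      have "sat M \<rho> (E(X := setof A)) \<psi> \<longleftrightarrow> ssubst X (SPar A) \<psi> \<in> H" for A
      proof -
        have "sat M \<rho> (E(X := setof A)) \<psi> \<longleftrightarrow> sat M \<rho> E (ssubst X (SPar A) \<psi>)"
          by (subst sat_ssubst) (simp add: M_sets)
        also have "\<dots> \<longleftrightarrow> ssubst X (SPar A) \<psi> \<in> H"
          using less.prems AllS by (intro less.hyps) (auto simp: free_ssubst)
        finally show ?thesis .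
      qed
      then show ?thesis using AllS by (simp add: all_s M_sets)
    qed
  qed
  then show ?thesis by (intro exI[of _ M]) (auto simp: M_sets)
qed

end

theorem model_existence:
  assumes "consistent \<Gamma>" "\<forall>\<phi>\<in>\<Gamma>. sentence \<phi>" "universal_closures basic_axioms \<subseteq> \<Gamma>"
    and "infinite (UNIV :: 'n::countable set)"
  shows "\<exists>M :: 'n::countable struct. countable (sets_of M) \<and> sets_of M \<noteq> {} \<and> (\<forall>\<phi>\<in>\<Gamma>. \<forall>\<rho> E. sat M \<rho> E \<phi>)"
proof -
  have "few_pars \<Gamma>" using assms(2) by (auto simp: few_pars_def sentence_def)
  then interpret henkin "henkin_ext \<Gamma>" using henkin_ext assms(1) by blast
  have "henkin_chain \<Gamma> 0 \<subseteq> henkin_ext \<Gamma>" unfolding henkin_ext_def by blast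
  then have sub: "\<Gamma> \<subseteq> henkin_ext \<Gamma>" by simp
  from term_model[OF order_trans[OF assms(3) sub] assms(4)] sub assms(2) show ?thesis
    unfolding sentence_def by blast
qed

section \<open>Definable predicates\<close>

text \<open>Definability concerns functions of environments rather than formulas, with elements of
  the model as constants. Parameters of axiom instances are thereby built in, and closure under
  definitions becomes a matter of introduction rules.\<close>

inductive trm :: "((nat \<Rightarrow> 'n::{plus,times}) \<Rightarrow> 'n) \<Rightarrow> bool" where
  trm_var: "trm (\<lambda>e. e k)"
| trm_const: "trm (\<lambda>e. c)"
| trm_add: "trm t \<Longrightarrow> trm u \<Longrightarrow> trm (\<lambda>e. t e + u e)"
| trm_mul: "trm t \<Longrightarrow> trm u \<Longrightarrow> trm (\<lambda>e. t e * u e)"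

text \<open>De Bruijn environments: \<open>case_nat y e\<close> binds index \<open>0\<close> to \<open>y\<close> and shifts the rest.\<close>

inductive D0 :: "'n::{plus,times,ord} set set \<Rightarrow> ((nat \<Rightarrow> 'n) \<Rightarrow> bool) \<Rightarrow> bool" for S where
  D0_False: "D0 S (\<lambda>e. False)"
| D0_eq: "trm t \<Longrightarrow> trm u \<Longrightarrow> D0 S (\<lambda>e. t e = u e)"
| D0_less: "trm t \<Longrightarrow> trm u \<Longrightarrow> D0 S (\<lambda>e. t e < u e)"
| D0_mem: "trm t \<Longrightarrow> A \<in> S \<Longrightarrow> D0 S (\<lambda>e. t e \<in> A)"
| D0_imp: "D0 S P \<Longrightarrow> D0 S Q \<Longrightarrow> D0 S (\<lambda>e. P e \<longrightarrow> Q e)"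
| D0_ball': "trm t \<Longrightarrow> D0 S P \<Longrightarrow> D0 S (\<lambda>e. \<forall>y<t e. P (case_nat y e))"

definition Sig1 :: "'n::{plus,times,ord} set set \<Rightarrow> ((nat \<Rightarrow> 'n) \<Rightarrow> bool) \<Rightarrow> bool" where
  "Sig1 S P \<longleftrightarrow> (\<exists>Q. D0 S Q \<and> P = (\<lambda>e. \<exists>y. Q (case_nat y e)))"

definition Sig2 :: "'n::{plus,times,ord} set set \<Rightarrow> ((nat \<Rightarrow> 'n) \<Rightarrow> bool) \<Rightarrow> bool" where
  "Sig2 S P \<longleftrightarrow> (\<exists>Q. Sig1 S (\<lambda>e. \<not> Q e) \<and> P = (\<lambda>e. \<exists>y. Q (case_nat y e)))"

text \<open>The matrix is given as \<open>Q y e\<close>, the shape in which it occurs in goals, so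
  that the rule applies by unification; reading \<open>y\<close> off index \<open>0\<close> and
  shifting the rest restores the de Bruijn body.\<close>

lemma D0_ball:
  assumes "trm t" "D0 S (\<lambda>e. Q (e 0) (\<lambda>k. e (Suc k)))"
  shows "D0 S (\<lambda>e. \<forall>y<t e. Q y e)"
  using D0_ball'[OF assms] by simp

lemma D0_not: "D0 S P \<Longrightarrow> D0 S (\<lambda>e. \<not> P e)"
  using D0_imp[OF _ D0_False, of S P] by simp

lemma D0_or: "D0 S P \<Longrightarrow> D0 S Q \<Longrightarrow> D0 S (\<lambda>e. P e \<or> Q e)"
  using D0_imp[OF D0_not, of S P Q] by (simp add: disj_imp)

lemma D0_and: "D0 S P \<Longrightarrow> D0 S Q \<Longrightarrow> D0 S (\<lambda>e. P e \<and> Q e)"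
  using D0_not[OF D0_or[OF D0_not D0_not], of S P Q] by simp

lemma Sig1_exI:
  assumes "D0 S (\<lambda>e. Q (e 0) (\<lambda>k. e (Suc k)))"
  shows "Sig1 S (\<lambda>e. \<exists>y. Q y e)"
  unfolding Sig1_def by (rule exI, rule conjI, rule assms) simp

lemmas trm_intros = trm_var trm_const trm_add trm_mul
lemmas D0_intros = D0_False D0_eq D0_less D0_mem D0_imp D0_ball D0_not D0_or D0_and

lemma trm_subst: "trm t \<Longrightarrow> (\<And>k. trm (\<sigma> k)) \<Longrightarrow> trm (\<lambda>e. t (\<lambda>k. \<sigma> k e))"
  by (induction rule: trm.induct) (auto intro: trm_const trm_add trm_mul)

lemma trm_shift: "trm t \<Longrightarrow> trm (\<lambda>e. t (\<lambda>k. e (f k)))"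
  by (rule trm_subst[where \<sigma> = "\<lambda>k e. e (f k)", OF _ trm_var])

lemma D0_subst: "D0 S P \<Longrightarrow> (\<And>k. trm (\<sigma> k)) \<Longrightarrow> D0 S (\<lambda>e. P (\<lambda>k. \<sigma> k e))"
proof (induction arbitrary: \<sigma> rule: D0.induct)
  case (D0_ball' t P)
  \<comment> \<open>Under the quantifier index \<open>0\<close> stays bound, and the substituted
    terms read their variables one place further up.\<close>
  let ?\<sigma> = "case_nat (\<lambda>e. e 0) (\<lambda>k e. \<sigma> k (\<lambda>i. e (Suc i)))"
  have *: "(\<lambda>e. \<forall>y<t (\<lambda>k. \<sigma> k e). P (case_nat y (\<lambda>k. \<sigma> k e)))
    = (\<lambda>e. \<forall>y<t (\<lambda>k. \<sigma> k e). P (\<lambda>k. ?\<sigma> k (case_nat y e)))"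
    by (intro ext all_cong arg_cong[of _ _ P]) (auto split: nat.split)
  have "trm (?\<sigma> k)" for k
    using trm_shift[OF D0_ball'.prems, of "k - 1" Suc] by (cases k) (auto intro: trm_var)
  then show ?case unfolding *
    by (rule D0.D0_ball'[OF trm_subst[OF D0_ball'.hyps(1) D0_ball'.prems] D0_ball'.IH])
next
  case (D0_eq t u)
  show ?case
    by (rule D0.D0_eq[OF trm_subst[OF D0_eq.hyps(1) D0_eq.prems] trm_subst[OF D0_eq.hyps(2) D0_eq.prems]])
next
  case (D0_less t u)
  show ?case
    by (rule D0.D0_less[OF trm_subst[OF D0_less.hyps(1) D0_less.prems] trm_subst[OF D0_less.hyps(2) D0_less.prems]])
next
  case (D0_mem t A)
  show ?case by (rule D0.D0_mem[OF trm_subst[OF D0_mem.hyps(1) D0_mem.prems] D0_mem.hyps(2)])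
next
  case (D0_imp P Q)
  show ?case by (rule D0.D0_imp[OF D0_imp.IH]) (rule D0_imp.prems)+
qed (rule D0_False)

lemma D0_shift: "D0 S P \<Longrightarrow> D0 S (\<lambda>e. P (\<lambda>k. e (f k)))"
  by (rule D0_subst[where \<sigma> = "\<lambda>k e. e (f k)", OF _ trm_var])

lemma D0_Sig1: "D0 S P \<Longrightarrow> Sig1 S P"
  using Sig1_exI[of S "\<lambda>_. P"] D0_shift[of S P Suc] by simp

section \<open>Realising definable predicates by formulas\<close>

lemma free_closures:
  "free_nvars (AllSs Xs (AllNs xs \<phi>)) = free_nvars \<phi> - set xs"
  "free_svars (AllSs Xs (AllNs xs \<phi>)) = free_svars \<phi> - set Xs"
  "npars (AllSs Xs (AllNs xs \<phi>)) = npars \<phi>"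
  "spars (AllSs Xs (AllNs xs \<phi>)) = spars \<phi>"
proof -
  have 1: "free_nvars (AllNs xs \<phi>) = free_nvars \<phi> - set xs" "free_svars (AllNs xs \<phi>) = free_svars \<phi>"
    "npars (AllNs xs \<phi>) = npars \<phi>" "spars (AllNs xs \<phi>) = spars \<phi>"
    by (induction xs) auto
  have 2: "free_nvars (AllSs Xs \<psi>) = free_nvars \<psi>" "free_svars (AllSs Xs \<psi>) = free_svars \<psi> - set Xs"
    "npars (AllSs Xs \<psi>) = npars \<psi>" "spars (AllSs Xs \<psi>) = spars \<psi>" for \<psi>
    by (induction Xs) auto
  show "free_nvars (AllSs Xs (AllNs xs \<phi>)) = free_nvars \<phi> - set xs"
    "free_svars (AllSs Xs (AllNs xs \<phi>)) = free_svars \<phi> - set Xs"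
    "npars (AllSs Xs (AllNs xs \<phi>)) = npars \<phi>"
    "spars (AllSs Xs (AllNs xs \<phi>)) = spars \<phi>"
    by (simp_all only: 1 2)
qed

lemma free_vars_finite: "finite (free_nvars \<phi>)" "finite (free_svars \<phi>)"
proof -
  have t: "finite (tm_vars t)" for t by (induction t) auto
  have s: "finite (stm_vars T)" for T by (cases T) auto
  show "finite (free_nvars \<phi>)" "finite (free_svars \<phi>)"
    by (induction \<phi>) (auto simp: t s)
qed

text \<open>The closure is instantiated by the values that \<open>\<rho>\<close> and
  \<open>E\<close> already give, so free variables act as parameters from the model. Set quantifiers
  range over \<open>sets_of M\<close>, whence the condition on \<open>E\<close>.\<close>

lemma sat_closure:
  assumes "\<forall>\<psi>\<in>universal_closures \<Phi>. \<forall>\<rho> E. sat M \<rho> E \<psi>"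
    and "\<phi> \<in> \<Phi>" "npars \<phi> = {}" "spars \<phi> = {}" "\<forall>X. E X \<in> sets_of M"
  shows "sat M \<rho> E \<phi>"
proof -
  obtain Xs xs where "set Xs = free_svars \<phi>" "set xs = free_nvars \<phi>"
    using finite_list free_vars_finite by metis
  then have "sentence (AllSs Xs (AllNs xs \<phi>))"
    using assms(3,4) unfolding sentence_def free_closures by simp
  then have "sat M \<rho> E (AllSs Xs (AllNs xs \<phi>))"
    using assms(1,2) unfolding universal_closures_def by blast
  then have "sat M \<rho> E (AllNs xs \<phi>)"
  proof (induction Xs)
    case (Cons X Xs)
    from Cons.prems assms(5) have "sat M \<rho> (E(X := E X)) (AllSs Xs (AllNs xs \<phi>))"
      unfolding foldr.simps o_apply sat.simps by blast
    then show ?case using Cons.IH by simp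
  qed simp
  then show ?thesis
  proof (induction xs)
    case (Cons x xs)
    from Cons.prems have "sat M (\<rho>(x := \<rho> x)) E (AllNs xs \<phi>)"
      unfolding foldr.simps o_apply sat.simps by blast
    then show ?case using Cons.IH by simp
  qed simp
qed

locale countable_struct =
  fixes M :: "'n::{zero,one,plus,times,ord,countable} struct"
  assumes ops: "zero_of M = 0" "one_of M = 1" "add_of M = (+)" "mul_of M = (*)" "less_of M = (<)"
    and sets: "countable (sets_of M)" "sets_of M \<noteq> {}"
begin

text \<open>Besides the bound variables (integer de Bruijn levels) every number has a name of its own,
  which stands for it as a parameter; \<open>snames\<close> names all the sets.\<close>

definition nm :: "int + 'n \<Rightarrow> string" where
  "nm z = replicate (to_nat z) undefined"

definition snames :: "string \<Rightarrow> 'n set" where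
  "snames X = from_nat_into (sets_of M) (length X)"

definition names :: "(string \<Rightarrow> 'n) \<Rightarrow> bool" where
  "names \<rho> \<longleftrightarrow> (\<forall>c. \<rho> (nm (Inr c)) = c)"

lemma nm_eq [simp]: "nm z = nm z' \<longleftrightarrow> z = z'"
  by (auto simp: nm_def replicate_eq_replicate)

lemma names_upd [simp]: "names (\<rho>(nm (Inl k) := v)) \<longleftrightarrow> names \<rho>"
  by (simp add: names_def)

lemma names_ex: "\<exists>\<rho>. names \<rho>"
  by (rule exI[of _ "\<lambda>x. case inv nm x of Inl _ \<Rightarrow> undefined | Inr c \<Rightarrow> c"])
    (simp add: names_def inv_f_f inj_def)

lemma snames_in: "snames X \<in> sets_of M"
  using sets by (simp add: snames_def from_nat_into)

lemma snames_ex: "A \<in> sets_of M \<Longrightarrow> \<exists>X. snames X = A"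
  using from_nat_into_surj[OF sets(1)] unfolding snames_def by (metis length_replicate)

abbreviation denv :: "(string \<Rightarrow> 'n) \<Rightarrow> int \<Rightarrow> nat \<Rightarrow> 'n" where
  "denv \<rho> d \<equiv> \<lambda>i. \<rho> (nm (Inl (d - int i)))"

lemma denv_upd: "denv (\<rho>(nm (Inl (d + 1)) := v)) (d + 1) = case_nat v (denv \<rho> d)"
  by (auto simp: fun_eq_iff split: nat.split)

text \<open>Here \<open>d\<close> is the current level of quantifier nesting. Since only level names
  up to \<open>d\<close> occur, the name of level \<open>d + 1\<close> is still free for the next
  quantifier, as a bounded quantifier requires of its bound.\<close>

lemma trm_formula:
  assumes "trm t"
  shows "\<exists>s. tm_vars s \<subseteq> nm ` (Inl ` {..d} \<union> range Inr) \<and> tm_pars s = {} \<and>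
    (\<forall>\<rho>. names \<rho> \<longrightarrow> eval_tm M \<rho> s = t (denv \<rho> d))"
  using assms
proof induction
  case (trm_var k)
  then show ?case by (intro exI[of _ "NVar (nm (Inl (d - int k)))"]) auto
next
  case (trm_const c)
  then show ?case by (intro exI[of _ "NVar (nm (Inr c))"]) (auto simp: names_def)
next
  case (trm_add t u)
  then obtain s r where "tm_vars s \<subseteq> nm ` (Inl ` {..d} \<union> range Inr) \<and> tm_pars s = {} \<and>
    (\<forall>\<rho>. names \<rho> \<longrightarrow> eval_tm M \<rho> s = t (denv \<rho> d))"
    "tm_vars r \<subseteq> nm ` (Inl ` {..d} \<union> range Inr) \<and> tm_pars r = {} \<and>
    (\<forall>\<rho>. names \<rho> \<longrightarrow> eval_tm M \<rho> r = u (denv \<rho> d))" by blast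
  then show ?case by (intro exI[of _ "s \<^bold>+ r"]) (simp add: ops)
next
  case (trm_mul t u)
  then obtain s r where "tm_vars s \<subseteq> nm ` (Inl ` {..d} \<union> range Inr) \<and> tm_pars s = {} \<and>
    (\<forall>\<rho>. names \<rho> \<longrightarrow> eval_tm M \<rho> s = t (denv \<rho> d))"
    "tm_vars r \<subseteq> nm ` (Inl ` {..d} \<union> range Inr) \<and> tm_pars r = {} \<and>
    (\<forall>\<rho>. names \<rho> \<longrightarrow> eval_tm M \<rho> r = u (denv \<rho> d))" by blast
  then show ?case by (intro exI[of _ "s \<^bold>* r"]) (simp add: ops)
qed

lemma D0_formula:
  assumes "D0 (sets_of M) P"
  shows "\<exists>\<phi>. delta0 \<phi> \<and> npars \<phi> = {} \<and> spars \<phi> = {} \<and>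
    (\<forall>\<rho>. names \<rho> \<longrightarrow> (sat M \<rho> snames \<phi> \<longleftrightarrow> P (denv \<rho> d)))"
  using assms
proof (induction arbitrary: d)
  case D0_False
  show ?case by (intro exI[of _ "\<^bold>\<bottom>"]) (auto intro: delta0.intros)
next
  case (D0_eq t u)
  then obtain s r where "tm_pars s = {}" "\<forall>\<rho>. names \<rho> \<longrightarrow> eval_tm M \<rho> s = t (denv \<rho> d)"
    "tm_pars r = {}" "\<forall>\<rho>. names \<rho> \<longrightarrow> eval_tm M \<rho> r = u (denv \<rho> d)"
    using trm_formula by metis
  then show ?case by (intro exI[of _ "s \<^bold>= r"]) (auto intro: delta0.intros)
next
  case (D0_less t u)
  then obtain s r where "tm_pars s = {}" "\<forall>\<rho>. names \<rho> \<longrightarrow> eval_tm M \<rho> s = t (denv \<rho> d)"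
    "tm_pars r = {}" "\<forall>\<rho>. names \<rho> \<longrightarrow> eval_tm M \<rho> r = u (denv \<rho> d)"
    using trm_formula by metis
  then show ?case by (intro exI[of _ "s \<^bold>< r"]) (auto intro: delta0.intros simp: ops)
next
  case (D0_mem t A)
  then obtain s X where "tm_pars s = {}" "\<forall>\<rho>. names \<rho> \<longrightarrow> eval_tm M \<rho> s = t (denv \<rho> d)" "snames X = A"
    using trm_formula snames_ex by metis
  then show ?case by (intro exI[of _ "s \<^bold>\<in> SVar X"]) (auto intro: delta0.intros)
next
  case (D0_imp P Q)
  obtain \<phi> where "delta0 \<phi> \<and> npars \<phi> = {} \<and> spars \<phi> = {} \<and>
    (\<forall>\<rho>. names \<rho> \<longrightarrow> (sat M \<rho> snames \<phi> \<longleftrightarrow> P (denv \<rho> d)))" using D0_imp.IH(1) by blast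
  moreover obtain \<psi> where "delta0 \<psi> \<and> npars \<psi> = {} \<and> spars \<psi> = {} \<and>
    (\<forall>\<rho>. names \<rho> \<longrightarrow> (sat M \<rho> snames \<psi> \<longleftrightarrow> Q (denv \<rho> d)))" using D0_imp.IH(2) by blast
  ultimately show ?case by (intro exI[of _ "\<phi> \<^bold>\<longrightarrow> \<psi>"]) (auto intro: delta0.intros)
next
  case (D0_ball' t P)
  obtain s where s: "tm_vars s \<subseteq> nm ` (Inl ` {..d} \<union> range Inr)" "tm_pars s = {}"
    "\<And>\<rho>. names \<rho> \<Longrightarrow> eval_tm M \<rho> s = t (denv \<rho> d)"
    using trm_formula[OF D0_ball'.hyps(1), of d] by auto
  obtain \<phi> where \<phi>: "delta0 \<phi>" "npars \<phi> = {}" "spars \<phi> = {}"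
    "\<And>\<rho>. names \<rho> \<Longrightarrow> sat M \<rho> snames \<phi> \<longleftrightarrow> P (denv \<rho> (d + 1))" using D0_ball'.IH[of "d + 1"] by auto
  let ?x = "nm (Inl (d + 1))"
  have fresh: "?x \<notin> tm_vars s" using s(1) by auto
  have "sat M \<rho> snames (BAllN ?x s \<phi>) \<longleftrightarrow> (\<forall>y<t (denv \<rho> d). P (case_nat y (denv \<rho> d)))" if "names \<rho>" for \<rho>
  proof -
    have "eval_tm M (\<rho>(?x := v)) s = eval_tm M \<rho> s" for v
      by (rule eval_tm_cong) (use fresh in auto)
    then have s': "eval_tm M (\<rho>(?x := v)) s = t (denv \<rho> d)" for v
      using s(3)[OF that] by simp
    have \<phi>': "sat M (\<rho>(?x := v)) snames \<phi> \<longleftrightarrow> P (case_nat v (denv \<rho> d))" for v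
      using \<phi>(4)[of "\<rho>(?x := v)"] that unfolding denv_upd by simp
    show ?thesis
      by (simp only: BAllN_def sat.simps ops s' \<phi>' eval_tm.simps fun_upd_same)
  qed
  moreover have "delta0 (BAllN ?x s \<phi>)"
    using \<phi>(1) fresh by (rule delta0.intros)
  moreover have "npars (BAllN ?x s \<phi>) = {}" "spars (BAllN ?x s \<phi>) = {}"
    using \<phi>(2,3) s(2) by (auto simp: BAllN_def)
  ultimately show ?case by blast
qed

lemma Sig1_formula:
  assumes "Sig1 (sets_of M) P"
  shows "\<exists>\<phi>. is_Sigma 1 \<phi> \<and> npars \<phi> = {} \<and> spars \<phi> = {} \<and>
    (\<forall>\<rho>. names \<rho> \<longrightarrow> (sat M \<rho> snames \<phi> \<longleftrightarrow> P (denv \<rho> d)))"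
proof -
  obtain Q where Q: "D0 (sets_of M) Q" "P = (\<lambda>e. \<exists>y. Q (case_nat y e))"
    using assms by (auto simp: Sig1_def)
  obtain \<phi> where \<phi>: "delta0 \<phi>" "npars \<phi> = {}" "spars \<phi> = {}"
    "\<And>\<rho>. names \<rho> \<Longrightarrow> sat M \<rho> snames \<phi> \<longleftrightarrow> Q (denv \<rho> (d + 1))"
    using D0_formula[OF Q(1), of "d + 1"] by auto
  have "is_Sigma (Suc 0) (ExN (nm (Inl (d + 1))) \<phi>)"
    using \<phi>(1) by (intro is_Sigma_is_Pi.intros)
  then show ?thesis using \<phi> Q(2)
    by (intro exI[of _ "ExN (nm (Inl (d + 1))) \<phi>"])
      (auto simp: denv_upd ExN_def Neg_def simp del: fun_upd_apply)
qed

lemma Pi1_formula: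
  assumes "Sig1 (sets_of M) (\<lambda>e. \<not> P e)"
  shows "\<exists>\<phi>. is_Pi 1 \<phi> \<and> npars \<phi> = {} \<and> spars \<phi> = {} \<and>
    (\<forall>\<rho>. names \<rho> \<longrightarrow> (sat M \<rho> snames \<phi> \<longleftrightarrow> P (denv \<rho> d)))"
proof -
  obtain Q where Q: "D0 (sets_of M) Q" "(\<lambda>e. \<not> P e) = (\<lambda>e. \<exists>y. Q (case_nat y e))"
    using assms by (auto simp: Sig1_def)
  from Q(2) have P: "P e \<longleftrightarrow> (\<forall>y. \<not> Q (case_nat y e))" for e by (metis (mono_tags))
  obtain \<phi> where \<phi>: "delta0 \<phi>" "npars \<phi> = {}" "spars \<phi> = {}"
    "\<And>\<rho>. names \<rho> \<Longrightarrow> sat M \<rho> snames \<phi> \<longleftrightarrow> Q (denv \<rho> (d + 1))"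
    using D0_formula[OF Q(1), of "d + 1"] by auto
  have "is_Pi (Suc 0) (AllN (nm (Inl (d + 1))) (\<^bold>\<not> \<phi>))"
    unfolding Neg_def using \<phi>(1) by (intro is_Sigma_is_Pi.intros delta0.intros)
  then show ?thesis using \<phi> P
    by (intro exI[of _ "AllN (nm (Inl (d + 1))) (\<^bold>\<not> \<phi>)"])
      (auto simp: denv_upd Neg_def simp del: fun_upd_apply)
qed

lemma Sig2_formula:
  assumes "Sig2 (sets_of M) P"
  shows "\<exists>\<phi>. is_Sigma 2 \<phi> \<and> npars \<phi> = {} \<and> spars \<phi> = {} \<and>
    (\<forall>\<rho>. names \<rho> \<longrightarrow> (sat M \<rho> snames \<phi> \<longleftrightarrow> P (denv \<rho> d)))"
proof -
  obtain Q where Q: "Sig1 (sets_of M) (\<lambda>e. \<not> Q e)" "P = (\<lambda>e. \<exists>y. Q (case_nat y e))"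
    using assms by (auto simp: Sig2_def)
  obtain \<phi> where \<phi>: "is_Pi 1 \<phi>" "npars \<phi> = {}" "spars \<phi> = {}"
    "\<And>\<rho>. names \<rho> \<Longrightarrow> sat M \<rho> snames \<phi> \<longleftrightarrow> Q (denv \<rho> (d + 1))"
    using Pi1_formula[OF Q(1), of "d + 1"] by auto
  have "is_Sigma (Suc 1) (ExN (nm (Inl (d + 1))) \<phi>)"
    using \<phi>(1) by (intro is_Sigma_is_Pi.intros)
  then show ?thesis using \<phi> Q(2)
    by (intro exI[of _ "ExN (nm (Inl (d + 1))) \<phi>"])
      (auto simp: denv_upd ExN_def Neg_def numeral_2_eq_2 simp del: fun_upd_apply)
qed

lemma sat_induction:
  assumes "\<forall>\<psi>\<in>universal_closures {induction_axiom n \<phi> | n \<phi>. is_Sigma k \<phi>}. \<forall>\<rho> E. sat M \<rho> E \<psi>"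
    and "is_Sigma k \<phi>" "npars \<phi> = {}" "spars \<phi> = {}"
    and "\<forall>\<rho>. names \<rho> \<longrightarrow> (sat M \<rho> snames \<phi> \<longleftrightarrow> P (\<rho> (nm (Inl 0))))"
    and "P 0" "\<And>v. P v \<Longrightarrow> P (v + 1)"
  shows "P v"
proof -
  let ?n = "nm (Inl 0)"
  have pars: "npars (nsubst x t \<psi>) \<subseteq> npars \<psi> \<union> tm_pars t" "spars (nsubst x t \<psi>) = spars \<psi>" for x t \<psi>
  proof -
    have *: "tm_pars (tm_subst x t s) \<subseteq> tm_pars s \<union> tm_pars t" for s by (induction s) auto
    show "npars (nsubst x t \<psi>) \<subseteq> npars \<psi> \<union> tm_pars t" "spars (nsubst x t \<psi>) = spars \<psi>"
      by (induction \<psi>) (use * in auto)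
  qed
  have "npars (induction_axiom ?n \<phi>) = {}" "spars (induction_axiom ?n \<phi>) = {}"
    using assms(3,4) pars(1)[of ?n "\<^bold>0" \<phi>] pars(1)[of ?n "NVar ?n \<^bold>+ \<^bold>1" \<phi>]
    by (auto simp: induction_axiom_def And_def Neg_def pars(2))
  moreover have "induction_axiom ?n \<phi> \<in> {induction_axiom n \<phi> | n \<phi>. is_Sigma k \<phi>}"
    using assms(2) by blast
  ultimately have ax: "sat M \<rho> snames (induction_axiom ?n \<phi>)" for \<rho>
    using sat_closure[OF assms(1)] snames_in by blast
  obtain \<rho> where \<rho>: "names \<rho>" using names_ex by blast
  have \<phi>: "sat M (\<rho>(?n := v)) snames \<phi> \<longleftrightarrow> P v" for v
    using assms(5)[rule_format, of "\<rho>(?n := v)"] \<rho> by simp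
  have zero: "sat M \<rho> snames (nsubst ?n \<^bold>0 \<phi>) \<longleftrightarrow> P 0"
    by (subst sat_nsubst) (simp_all add: \<phi> ops del: fun_upd_apply)
  have succ: "sat M (\<rho>(?n := v)) snames (nsubst ?n (NVar ?n \<^bold>+ \<^bold>1) \<phi>) \<longleftrightarrow> P (v + 1)" for v
    by (subst sat_nsubst) (simp_all only: eval_tm.simps ops fun_upd_same fun_upd_upd \<phi>, simp)
  have "P 0 \<and> (\<forall>v. P v \<longrightarrow> P (v + 1)) \<longrightarrow> (\<forall>v. P v)"
    using ax[of \<rho>] unfolding induction_axiom_def sat.simps sat_connectives zero succ \<phi> .
  then show ?thesis using assms(6,7) by blast
qed

lemma Sig1_induct:
  assumes "\<forall>\<psi>\<in>ISigma 1. \<forall>\<rho> E. sat M \<rho> E \<psi>"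
    and "Sig1 (sets_of M) (\<lambda>e. P (e 0))" "P 0" "\<And>v. P v \<Longrightarrow> P (v + 1)"
  shows "P v"
proof -
  obtain \<phi> where "is_Sigma 1 \<phi>" "npars \<phi> = {}" "spars \<phi> = {}"
    "\<forall>\<rho>. names \<rho> \<longrightarrow> (sat M \<rho> snames \<phi> \<longleftrightarrow> P (\<rho> (nm (Inl 0))))"
    using Sig1_formula[OF assms(2), of 0] by auto
  then show ?thesis using sat_induction[OF assms(1)[unfolded ISigma_def]] assms(3,4) by blast
qed

lemma Sig2_induct:
  assumes "\<forall>\<psi>\<in>ISigma 2. \<forall>\<rho> E. sat M \<rho> E \<psi>"
    and "Sig2 (sets_of M) (\<lambda>e. P (e 0))" "P 0" "\<And>v. P v \<Longrightarrow> P (v + 1)"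
  shows "P v"
proof -
  obtain \<phi> where "is_Sigma 2 \<phi>" "npars \<phi> = {}" "spars \<phi> = {}"
    "\<forall>\<rho>. names \<rho> \<longrightarrow> (sat M \<rho> snames \<phi> \<longleftrightarrow> P (\<rho> (nm (Inl 0))))"
    using Sig2_formula[OF assms(2), of 0] by auto
  then show ?thesis using sat_induction[OF assms(1)[unfolded ISigma_def]] assms(3,4) by blast
qed

lemma Delta1_comprehension:
  assumes "\<forall>\<psi>\<in>Delta1_CA. \<forall>\<rho> E. sat M \<rho> E \<psi>"
    and "Sig1 (sets_of M) (\<lambda>e. P (e 0))" "Sig1 (sets_of M) (\<lambda>e. \<not> P (e 0))"
  shows "{v. P v} \<in> sets_of M"
proof -
  let ?n = "nm (Inl 0)"
  obtain \<phi> where \<phi>: "is_Sigma 1 \<phi>" "npars \<phi> = {}" "spars \<phi> = {}"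
    "\<forall>\<rho>. names \<rho> \<longrightarrow> (sat M \<rho> snames \<phi> \<longleftrightarrow> P (\<rho> ?n))"
    using Sig1_formula[OF assms(2), of 0] by auto
  obtain \<psi> where \<psi>: "is_Pi 1 \<psi>" "npars \<psi> = {}" "spars \<psi> = {}"
    "\<forall>\<rho>. names \<rho> \<longrightarrow> (sat M \<rho> snames \<psi> \<longleftrightarrow> P (\<rho> ?n))"
    using Pi1_formula[OF assms(3), of 0] by auto
  obtain X where X: "X \<notin> free_svars \<phi>"
    using ex_new_if_finite[OF infinite_UNIV_listI free_vars_finite(2)] by blast
  let ?ax = "AllN ?n (\<phi> \<^bold>\<longleftrightarrow> \<psi>) \<^bold>\<longrightarrow> ExS X (AllN ?n (NVar ?n \<^bold>\<in> SVar X \<^bold>\<longleftrightarrow> \<phi>))"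
  have "npars ?ax = {}" "spars ?ax = {}"
    using \<phi> \<psi> by (auto simp: And_def Neg_def Iff_def ExS_def)
  then have ax: "sat M \<rho> snames ?ax" for \<rho>
    using \<phi>(1) \<psi>(1) X snames_in
    by (intro sat_closure[OF assms(1)[unfolded Delta1_CA_def]]) auto
  obtain \<rho> where \<rho>: "names \<rho>" using names_ex by blast
  have "sat M (\<rho>(?n := v)) snames (\<phi> \<^bold>\<longleftrightarrow> \<psi>)" for v
    using \<phi>(4)[rule_format, of "\<rho>(?n := v)"] \<psi>(4)[rule_format, of "\<rho>(?n := v)"] \<rho> by simp
  then have "sat M \<rho> snames (AllN ?n (\<phi> \<^bold>\<longleftrightarrow> \<psi>))" by (simp only: sat.simps simp_thms)
  then have "sat M \<rho> snames (ExS X (AllN ?n (NVar ?n \<^bold>\<in> SVar X \<^bold>\<longleftrightarrow> \<phi>)))"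
    using ax[of \<rho>] by (simp only: sat.simps simp_thms)
  then obtain V where V: "V \<in> sets_of M"
    "\<And>v. v \<in> V \<longleftrightarrow> sat M (\<rho>(?n := v)) (snames(X := V)) \<phi>"
    by (auto simp del: fun_upd_apply) (simp add: fun_upd_same)
  have "v \<in> V \<longleftrightarrow> P v" for v
  proof -
    have "sat M (\<rho>(?n := v)) (snames(X := V)) \<phi> \<longleftrightarrow> sat M (\<rho>(?n := v)) snames \<phi>"
      by (rule sat_cong) (use X in auto)
    then show ?thesis using V(2) \<phi>(4)[rule_format, of "\<rho>(?n := v)"] \<rho> by simp
  qed
  then have "{v. P v} = V" by auto
  then show ?thesis using V(1) by simp
qed

end

section \<open>Arithmetic in a model\<close>

text \<open>Discretely ordered commutative semirings, stated as one property of a type: it has to be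
  shown for \<open>hnum\<close> whether or not a counter model exists, before \<open>hnum\<close>
  has any ordered algebraic class.\<close>

definition pa_minus :: "'n::{zero,one,plus,times,ord} itself \<Rightarrow> bool" where
  "pa_minus _ \<longleftrightarrow> (\<forall>a b c :: 'n.
    a + b + c = a + (b + c) \<and> a + b = b + a \<and> 0 + a = a \<and>
    a * b * c = a * (b * c) \<and> a * b = b * a \<and> 1 * a = a \<and> (a + b) * c = a * c + b * c \<and> 0 * a = 0 \<and>
    (a + b = a + c \<longrightarrow> b = c) \<and> a + 1 \<noteq> 0 \<and> (a = 0 \<or> (\<exists>d. a = d + 1)) \<and>
    (a < b \<longleftrightarrow> (\<exists>d. b = a + d + 1)) \<and> (a < b \<or> a = b \<or> b < a))"

locale arith_struct = countable_struct +
  assumes basic: "\<forall>\<psi>\<in>universal_closures basic_axioms. \<forall>\<rho> E. sat M \<rho> E \<psi>"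
    and isigma1: "\<forall>\<psi>\<in>ISigma 1. \<forall>\<rho> E. sat M \<rho> E \<psi>"
begin

lemmas ind = Sig1_induct[OF isigma1]

lemma basic':
  assumes "\<phi> \<in> basic_axioms" "npars \<phi> = {}" "spars \<phi> = {}"
  shows "sat M \<rho> snames \<phi>"
  by (rule sat_closure[OF basic assms]) (simp add: snames_in)

lemma basic_facts:
  shows "(a::'a) + 1 \<noteq> 0" "a + 1 = b + 1 \<Longrightarrow> a = b" "a + 0 = a" "a + (b + 1) = a + b + 1"
    "a * 0 = 0" "a * (b + 1) = a * b + a" "\<not> a < 0" "a < b + 1 \<longleftrightarrow> a < b \<or> a = b"
proof -
  let ?m = "NVar ''m''" and ?n = "NVar ''n''" and ?\<rho> = "(\<lambda>_. a)(''n'' := b)"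
  show "a + 1 \<noteq> 0" using basic'[of "\<^bold>\<not> ?n \<^bold>+ \<^bold>1 \<^bold>= \<^bold>0" "\<lambda>_. a"]
    by (simp add: basic_axioms_def Let_def ops Neg_def)
  show "a + 1 = b + 1 \<Longrightarrow> a = b" using basic'[of "?m \<^bold>+ \<^bold>1 \<^bold>= ?n \<^bold>+ \<^bold>1 \<^bold>\<longrightarrow> ?m \<^bold>= ?n" ?\<rho>]
    by (simp add: basic_axioms_def Let_def ops)
  show "a + 0 = a" using basic'[of "?m \<^bold>+ \<^bold>0 \<^bold>= ?m" ?\<rho>]
    by (simp add: basic_axioms_def Let_def ops)
  show "a + (b + 1) = a + b + 1" using basic'[of "?m \<^bold>+ (?n \<^bold>+ \<^bold>1) \<^bold>= (?m \<^bold>+ ?n) \<^bold>+ \<^bold>1" ?\<rho>]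
    by (simp add: basic_axioms_def Let_def ops)
  show "a * 0 = 0" using basic'[of "?m \<^bold>* \<^bold>0 \<^bold>= \<^bold>0" ?\<rho>]
    by (simp add: basic_axioms_def Let_def ops)
  show "a * (b + 1) = a * b + a" using basic'[of "?m \<^bold>* (?n \<^bold>+ \<^bold>1) \<^bold>= (?m \<^bold>* ?n) \<^bold>+ ?m" ?\<rho>]
    by (simp add: basic_axioms_def Let_def ops)
  show "\<not> a < 0" using basic'[of "\<^bold>\<not> ?m \<^bold>< \<^bold>0" ?\<rho>]
    by (simp add: basic_axioms_def Let_def ops Neg_def)
  show "a < b + 1 \<longleftrightarrow> a < b \<or> a = b"
    using basic'[of "?m \<^bold>< ?n \<^bold>+ \<^bold>1 \<^bold>\<longleftrightarrow> (?m \<^bold>< ?n \<^bold>\<or> ?m \<^bold>= ?n)" ?\<rho>]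
    by (simp add: basic_axioms_def Let_def ops Iff_def And_def Or_def Neg_def) metis
qed

lemma add_assoc': "(a::'a) + b + c = a + (b + c)"
  by (rule ind[where P = "\<lambda>c. a + b + c = a + (b + c)"], intro D0_Sig1 D0_intros trm_intros)
    (auto simp: basic_facts(1,3-8))

lemma zero_add': "0 + (a::'a) = a"
  by (rule ind[where P = "\<lambda>a. 0 + a = a"], intro D0_Sig1 D0_intros trm_intros)
    (auto simp: basic_facts(1,3-8))

lemma succ_add': "(a + 1) + (b::'a) = a + b + 1"
  by (rule ind[where P = "\<lambda>b. (a + 1) + b = a + b + 1"], intro D0_Sig1 D0_intros trm_intros)
    (auto simp: basic_facts(1,3-8))

lemma add_comm': "(a::'a) + b = b + a"
  by (rule ind[where P = "\<lambda>b. a + b = b + a"], intro D0_Sig1 D0_intros trm_intros)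
    (auto simp: basic_facts(1,3-8) zero_add' succ_add')

lemma distrib_left': "(a::'a) * (b + c) = a * b + a * c"
proof (rule ind[where P = "\<lambda>c. a * (b + c) = a * b + a * c"])
  show "Sig1 (sets_of M) (\<lambda>e. a * (b + e 0) = a * b + a * e 0)"
    by (intro D0_Sig1 D0_intros trm_intros)
  fix v assume "a * (b + v) = a * b + a * v"
  then have "a * (b + (v + 1)) = a * b + a * v + a" by (simp only: basic_facts(4,6))
  then show "a * (b + (v + 1)) = a * b + a * (v + 1)" by (simp only: basic_facts(6) add_assoc')
qed (simp add: basic_facts(1,3-8))

lemma mul_assoc': "(a::'a) * b * c = a * (b * c)"
proof (rule ind[where P = "\<lambda>c. a * b * c = a * (b * c)"])
  show "Sig1 (sets_of M) (\<lambda>e. a * b * e 0 = a * (b * e 0))"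
    by (intro D0_Sig1 D0_intros trm_intros)
  fix v assume "a * b * v = a * (b * v)"
  then have "a * b * (v + 1) = a * (b * v) + a * b" by (simp only: basic_facts(6))
  also have "\<dots> = a * (b * (v + 1))" by (simp only: basic_facts(6) distrib_left'[of a "b * v"])
  finally show "a * b * (v + 1) = a * (b * (v + 1))" .
qed (simp add: basic_facts(1,3-8))

lemma zero_mul': "0 * (a::'a) = 0"
  by (rule ind[where P = "\<lambda>a. 0 * a = 0"], intro D0_Sig1 D0_intros trm_intros)
    (auto simp: basic_facts(1,3-8))

lemma succ_mul': "(a + 1) * (b::'a) = a * b + b"
proof (rule ind[where P = "\<lambda>b. (a + 1) * b = a * b + b"])
  fix v assume "(a + 1) * v = a * v + v"
  then have "(a + 1) * (v + 1) = (a * v + v) + (a + 1)" by (simp only: basic_facts(6))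
  also have "\<dots> = a * (v + 1) + (v + 1)"
    by (simp only: basic_facts(6) add_assoc') (metis add_comm' add_assoc')
  finally show "(a + 1) * (v + 1) = a * (v + 1) + (v + 1)" .
next
  show "Sig1 (sets_of M) (\<lambda>e. (a + 1) * e 0 = a * e 0 + e 0)"
    by (intro D0_Sig1 D0_intros trm_intros)
qed (auto simp: basic_facts(1,3-8))

lemma mul_comm': "(a::'a) * b = b * a"
  by (rule ind[where P = "\<lambda>b. a * b = b * a"], intro D0_Sig1 D0_intros trm_intros)
    (auto simp: basic_facts(1,3-8) zero_mul' succ_mul')

lemma one_mul': "1 * (a::'a) = a"
  using succ_mul'[of 0 a] by (simp add: zero_mul' zero_add')

lemma cancel': "(a::'a) + b = a + c \<Longrightarrow> b = c"
proof (rule ind[where P = "\<lambda>a. a + b = a + c \<longrightarrow> b = c", THEN mp])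
  show "Sig1 (sets_of M) (\<lambda>e. e 0 + b = e 0 + c \<longrightarrow> b = c)"
    by (intro D0_Sig1 D0_intros trm_intros)
qed (auto simp: zero_add' succ_add' dest: basic_facts(2))

lemma pred': "(a::'a) = 0 \<or> (\<exists>d. a = d + 1)"
proof (rule ind[where P = "\<lambda>a. a = 0 \<or> (\<exists>d. a = d + 1)"])
  \<comment> \<open>Moving the existential quantifier in front of the disjunction exhibits the
    \<open>Sig1\<close> form.\<close>
  have "Sig1 (sets_of M) (\<lambda>e. \<exists>d. e 0 = 0 \<or> e 0 = d + 1)"
    by (intro Sig1_exI D0_intros trm_intros)
  then show "Sig1 (sets_of M) (\<lambda>e. e 0 = 0 \<or> (\<exists>d. e 0 = d + 1))" by simp
qed auto

lemma less_iff': "(a::'a) < b \<longleftrightarrow> (\<exists>d. b = a + d + 1)"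
proof
  show "a < b \<Longrightarrow> \<exists>d. b = a + d + 1"
  proof (rule ind[where P = "\<lambda>b. a < b \<longrightarrow> (\<exists>d. b = a + d + 1)", THEN mp])
    have "Sig1 (sets_of M) (\<lambda>e. \<exists>d. a < e 0 \<longrightarrow> e 0 = a + d + 1)"
      by (intro Sig1_exI D0_intros trm_intros)
    then show "Sig1 (sets_of M) (\<lambda>e. a < e 0 \<longrightarrow> (\<exists>d. e 0 = a + d + 1))" by simp
    fix v assume IH: "a < v \<longrightarrow> (\<exists>d. v = a + d + 1)"
    show "a < v + 1 \<longrightarrow> (\<exists>d. v + 1 = a + d + 1)"
    proof
      assume "a < v + 1"
      then consider "a < v" | "a = v" unfolding basic_facts(8) by blast
      then show "\<exists>d. v + 1 = a + d + 1"
      proof cases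
        case 1
        then obtain d where "v = a + d + 1" using IH by blast
        then have "v + 1 = a + (d + 1) + 1" by (simp only: basic_facts(4))
        then show ?thesis by blast
      next
        case 2
        then have "v + 1 = a + 0 + 1" by (simp only: basic_facts(3))
        then show ?thesis by blast
      qed
    qed
  qed (simp_all add: basic_facts(7))
  have "a < a + d + 1" for d
  proof (rule ind[where P = "\<lambda>d. a < a + d + 1"])
    show "Sig1 (sets_of M) (\<lambda>e. a < a + e 0 + 1)" by (intro D0_Sig1 D0_intros trm_intros)
    show "a < a + 0 + 1" unfolding basic_facts(3,8) by simp
    show "a < a + (v + 1) + 1" if "a < a + v + 1" for v
      using that unfolding basic_facts(4) basic_facts(8)[of a "a + v + 1"] by blast
  qed
  then show "\<exists>d. b = a + d + 1 \<Longrightarrow> a < b" by blast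
qed

lemma trichotomy': "(a::'a) < b \<or> a = b \<or> b < a"
proof (rule ind[where P = "\<lambda>b. a < b \<or> a = b \<or> b < a"])
  show "Sig1 (sets_of M) (\<lambda>e. a < e 0 \<or> a = e 0 \<or> e 0 < a)"
    by (intro D0_Sig1 D0_intros trm_intros)
  show "a < 0 \<or> a = 0 \<or> 0 < a" using pred'[of a] by (auto simp: less_iff' zero_add')
  fix v assume "a < v \<or> a = v \<or> v < a"
  moreover have "v < a \<Longrightarrow> v + 1 = a \<or> v + 1 < a"
    unfolding less_iff' using pred' by (metis basic_facts(3,4) succ_add')
  ultimately show "a < v + 1 \<or> a = v + 1 \<or> v + 1 < a" by (auto simp: basic_facts(1,3-8))
qed

lemma pa_minus: "pa_minus TYPE('a)"
  unfolding pa_minus_def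
proof (intro allI conjI impI)
  fix a b c :: 'a
  show "(a + b) * c = a * c + b * c" using distrib_left'[of c a b] mul_comm' by simp
  show "a + b + c = a + (b + c)" "0 + a = a" "a * b * c = a * (b * c)" "1 * a = a" "0 * a = 0"
    "a + 1 \<noteq> 0" "a = 0 \<or> (\<exists>d. a = d + 1)" "(a < b) = (\<exists>d. b = a + d + 1)" "a < b \<or> a = b \<or> b < a"
    by (rule add_assoc' zero_add' mul_assoc' one_mul' zero_mul' basic_facts pred' less_iff' trichotomy')+
  show "a + b = b + a" "a * b = b * a" by (rule add_comm' mul_comm')+
  show "a + b = a + c \<Longrightarrow> b = c" by (rule cancel')
qed

end

section \<open>The model as an instance of ordered algebraic classes\<close>

class arith = discrete_linordered_semidom + canonically_ordered_monoid_add

text \<open>A copy of the natural numbers that merely provides a countably infinite carrier; its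
  arithmetic will be that of the model, which may be nonstandard.\<close>

datatype hnum = HNum (nat_of: nat)

instance hnum :: countable by countable_datatype

lemma infinite_hnum: "infinite (UNIV :: hnum set)"
  using range_inj_infinite[of HNum] infinite_super[of "range HNum" UNIV] by (simp add: inj_def)

definition counter_model :: "hnum struct \<Rightarrow> bool" where
  "counter_model M \<longleftrightarrow> countable (sets_of M) \<and> sets_of M \<noteq> {} \<and>
    (\<forall>\<phi>\<in>insert (\<^bold>\<not> (STS2 \<^bold>\<longrightarrow> SRRT22)) (RCA0 \<union> ISigma 2). \<forall>\<rho> E. sat M \<rho> E \<phi>)"

text \<open>The type class instance below must be unconditional, hence the standard numbers as a fallback.\<close>

definition the_model :: "hnum struct" where
  "the_model = (if \<exists>M. counter_model M then SOME M. counter_model M else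
    \<lparr>zero_of = HNum 0, one_of = HNum 1, add_of = (\<lambda>a b. HNum (nat_of a + nat_of b)),
     mul_of = (\<lambda>a b. HNum (nat_of a * nat_of b)), less_of = (\<lambda>a b. nat_of a < nat_of b),
     sets_of = {}, npar_of = (\<lambda>_. HNum 0), spar_of = (\<lambda>_. {})\<rparr>)"

instantiation hnum :: "{zero,one,plus,times,ord,minus}"
begin
definition "0 = zero_of the_model"
definition "1 = one_of the_model"
definition "(+) = add_of the_model"
definition "(*) = mul_of the_model"
definition "(<) = less_of the_model"
definition "(a::hnum) \<le> b \<longleftrightarrow> a < b \<or> a = b"
text \<open>Subtraction is not in the language. The type class asks for the truncated one, which
  cancellation makes definable from addition.\<close>

definition "(a::hnum) - b = (if b \<le> a then THE c. b + c = a else 0)"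
instance ..
end

lemmas hnum_ops = zero_hnum_def one_hnum_def plus_hnum_def times_hnum_def less_hnum_def

lemma the_model: "counter_model M \<Longrightarrow> counter_model the_model"
  unfolding the_model_def using someI[of counter_model M] by auto

lemma counter_model_struct: "counter_model M \<Longrightarrow> arith_struct the_model"
proof -
  assume "counter_model M"
  then have "counter_model the_model" by (rule the_model)
  then have "countable (sets_of the_model)" "sets_of the_model \<noteq> {}"
    "\<forall>\<phi>\<in>universal_closures basic_axioms. \<forall>\<rho> E. sat the_model \<rho> E \<phi>"
    "\<forall>\<phi>\<in>ISigma 1. \<forall>\<rho> E. sat the_model \<rho> E \<phi>"
    unfolding counter_model_def RCA0_def by (simp_all add: ball_Un)
  then show "arith_struct the_model"
    by unfold_locales (simp_all add: hnum_ops)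
qed

lemma hnum_pa_minus: "pa_minus TYPE(hnum)"
proof (cases "\<exists>M. counter_model M")
  case True
  then obtain M where "counter_model M" by blast
  then interpret arith_struct the_model by (rule counter_model_struct)
  show ?thesis by (rule pa_minus)
next
  case False
  then have ops: "0 = HNum 0" "1 = HNum 1" "HNum m + HNum n = HNum (m + n)" "HNum m * HNum n = HNum (m * n)"
    "HNum m < HNum n \<longleftrightarrow> m < n" for m n
    unfolding hnum_ops the_model_def if_not_P[OF False] by simp_all
  have all: "(\<forall>a. P a) \<longleftrightarrow> (\<forall>m. P (HNum m))" "(\<exists>a. P a) \<longleftrightarrow> (\<exists>m. P (HNum m))" for P
    by (metis hnum.exhaust)+
  show ?thesis
    unfolding pa_minus_def all ops hnum.inject
    by (auto simp: algebra_simps less_iff_Suc_add gr0_conv_Suc) presburger+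
qed

instance hnum :: arith
proof -
  have pa:
    "(a::hnum) + b + c = a + (b + c)" "a + b = b + a" "0 + a = a"
    "a * b * c = a * (b * c)" "a * b = b * a" "1 * a = a" "(a + b) * c = a * c + b * c" "0 * a = 0"
    "(a + b = a + c \<longrightarrow> b = c)" "a + 1 \<noteq> 0" "(a = 0 \<or> (\<exists>d. a = d + 1))"
    "(a < b \<longleftrightarrow> (\<exists>d. b = a + d + 1))" "(a < b \<or> a = b \<or> b < a)" for a b c
    using hnum_pa_minus unfolding pa_minus_def by blast+
  have le: "a \<le> b \<longleftrightarrow> (\<exists>d. b = a + d)" for a b :: hnum
    unfolding less_eq_hnum_def pa(12) by (metis pa(1,2,3,11))
  have irrefl: "\<not> a < a" for a :: hnum
    unfolding pa(12) by (metis pa(1,2,3,9,10))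
  have trans: "a < b \<Longrightarrow> b < c \<Longrightarrow> a < c" for a b c :: hnum
    unfolding pa(12) by (metis pa(1))
  have lt: "a < b \<longleftrightarrow> a \<le> b \<and> \<not> b \<le> a" for a b :: hnum
    unfolding less_eq_hnum_def by (metis irrefl trans)
  have zero_le: "0 \<le> a" for a :: hnum
    using le pa(3) by metis
  have diff: "a + b - a = b" for a b :: hnum
  proof -
    have "a \<le> a + b" using le by blast
    moreover have "(THE c. a + c = a + b) = b" using pa(9) by blast
    ultimately show ?thesis by (simp add: minus_hnum_def)
  qed
  have diff_0: "a - b = 0" if "\<not> b \<le> a" for a b :: hnum
    using that by (simp add: minus_hnum_def)
  have distrib: "a * (b + c) = a * b + a * c" for a b c :: hnum
    using pa(5,7) by metis
  have mono: "c * a < c * b" if ab: "a < b" and c: "0 < c" for a b c :: hnum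
  proof -
    obtain d where b: "b = a + d + 1" using ab pa(12) by blast
    obtain x where x: "c = x + 1" using c pa(12) pa(3) by metis
    have "c * b = c * a + (c * d + x) + 1"
      unfolding b distrib pa(5)[of c 1] pa(6) by (metis x pa(1))
    then show ?thesis using pa(12) by blast
  qed
  have zero_less: "0 < a" if "a \<noteq> 0" for a :: hnum
    using that zero_le by (metis less_eq_hnum_def)
  show "OFCLASS(hnum, arith_class)"
  proof
    fix a b c :: hnum
    show "a + b + c = a + (b + c)" "a + b = b + a" "0 + a = a" "a * b * c = a * (b * c)" "a * b = b * a"
      "1 * a = a" "(a + b) * c = a * c + b * c" "0 * a = 0"
      by (rule pa)+
    show "a * 0 = 0" using pa(5,8) by metis
    show "0 \<noteq> (1::hnum)" using pa(3,10) by metis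
    show "a + b - a = b" by (rule diff)
    show "a - b - c = a - (b + c)"
    proof (cases "b \<le> a")
      case True
      then obtain x where x: "a = b + x" using le by blast
      have eq: "c \<le> x \<longleftrightarrow> b + c \<le> b + x" unfolding le using pa(1,9) by metis
      show ?thesis
      proof (cases "c \<le> x")
        case True
        then obtain y where "x = c + y" using le by blast
        then show ?thesis unfolding x by (metis diff pa(1))
      next
        case False
        then show ?thesis unfolding x diff using diff_0 eq by simp
      qed
    next
      case False
      then have "\<not> b + c \<le> a" unfolding le using pa(1) by metis
      moreover have "0 - c = 0" by (metis diff diff_0 le pa(3) zero_le trans less_eq_hnum_def irrefl)
      ultimately show ?thesis using False diff_0 by simp
    qed
    show "a \<le> b \<Longrightarrow> c + a \<le> c + b" unfolding le using pa(1) by metis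
    show "a < b \<Longrightarrow> 0 < c \<Longrightarrow> c * a < c * b" by (rule mono)
    show "a * (b - c) = a * b - a * c"
    proof (cases "c \<le> b")
      case True
      then obtain x where x: "b = c + x" using le by blast
      show ?thesis unfolding x diff distrib ..
    next
      case False
      then have "b < c" using pa(13) by (auto simp: less_eq_hnum_def)
      show ?thesis
      proof (cases "a = 0")
        case True
        then show ?thesis by (metis diff pa(3,8))
      next
        case False
        then have "a * b < a * c" using mono zero_less \<open>b < c\<close> by blast
        then have "\<not> a * c \<le> a * b" using lt by blast
        then show ?thesis using \<open>\<not> c \<le> b\<close> diff_0 by (metis pa(5,8))
      qed
    qed
    show "a * (b + c) = a * b + a * c" by (rule distrib)
    show "a \<noteq> 0 \<Longrightarrow> b \<noteq> 0 \<Longrightarrow> a * b \<noteq> 0"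
      using mono[of 0 b a] zero_less irrefl by (metis pa(5,8))
    show "0 < (1::hnum)" using zero_less pa(3,10) by metis
    show "b \<le> a \<Longrightarrow> a - b + b = a" unfolding le using diff pa(2) by metis
    show "a < b \<longleftrightarrow> a + 1 \<le> b" unfolding pa(12) le by (metis pa(1,2))
    show "a < b \<longleftrightarrow> a \<le> b \<and> \<not> b \<le> a" by (rule lt)
    show "a \<le> a" "a \<le> b \<or> b \<le> a" using pa(13) by (auto simp: less_eq_hnum_def)
    show "a \<le> b \<Longrightarrow> b \<le> c \<Longrightarrow> a \<le> c" using trans by (auto simp: less_eq_hnum_def)
    show "a \<le> b \<Longrightarrow> b \<le> a \<Longrightarrow> a = b" by (metis irrefl trans less_eq_hnum_def)
    show "a \<le> b \<longleftrightarrow> (\<exists>c. b = a + c)" by (rule le)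
  qed
qed

section \<open>Closure properties of definable predicates\<close>

lemma Sig1_subst:
  assumes "Sig1 S P" "\<And>k. trm (\<sigma> k)"
  shows "Sig1 S (\<lambda>e. P (\<lambda>k. \<sigma> k e))"
proof -
  obtain Q where Q: "D0 S Q" "P = (\<lambda>e. \<exists>y. Q (case_nat y e))"
    using assms(1) by (auto simp: Sig1_def)
  let ?\<sigma> = "case_nat (\<lambda>e. e 0) (\<lambda>k e. \<sigma> k (\<lambda>i. e (Suc i)))"
  have "trm (?\<sigma> k)" for k
    using trm_shift[OF assms(2), of "k - 1" Suc] by (cases k) (auto intro: trm_var)
  then have "D0 S (\<lambda>e. Q (\<lambda>k. ?\<sigma> k e))" by (rule D0_subst[OF Q(1)])
  moreover have "(\<lambda>k. ?\<sigma> k (case_nat y e)) = case_nat y (\<lambda>k. \<sigma> k e)" for y e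
    by (auto split: nat.split)
  ultimately show ?thesis
    unfolding Sig1_def Q(2) by (intro exI[of _ "\<lambda>e. Q (\<lambda>k. ?\<sigma> k e)"]) simp
qed

lemma D0_reindex:
  assumes "D0 S P" "\<And>e k. g e k = e (f k)"
  shows "D0 S (\<lambda>e. P (g e))"
proof -
  have "g e = (\<lambda>k. e (f k))" for e using assms(2) by auto
  then show ?thesis using D0_shift[OF assms(1), of f] by simp
qed

lemma D0_const: "D0 S (\<lambda>e. c)"
  using D0_False D0_not[OF D0_False] by (cases c) auto

lemma D0_le: "trm t \<Longrightarrow> trm u \<Longrightarrow> D0 (S :: 'n::arith set set) (\<lambda>e. t e \<le> u e)"
  using D0_not[OF D0_less, of u t S] by (simp add: not_less)

lemma D0_bex:
  assumes "trm t" "D0 S (\<lambda>e. Q (e 0) (\<lambda>k. e (Suc k)))"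
  shows "D0 S (\<lambda>e. \<exists>y<t e. Q y e)"
  using D0_not[OF D0_ball[OF assms(1) D0_not[OF assms(2)]]] by simp

lemma D0_dvd:
  assumes "trm t" "trm u"
  shows "D0 (S :: 'n::arith set set) (\<lambda>e. t e dvd u e)"
proof -
  \<comment> \<open>Divisibility becomes a bounded statement: a cofactor of a nonzero
    \<open>a\<close> is at most \<open>b\<close>, and for \<open>a = 0\<close> also
    \<open>b = 0\<close>, so that the cofactor \<open>0\<close> will do.\<close>
  have "a dvd b \<longleftrightarrow> (\<exists>k<b + 1. b = a * k)" for a b :: 'n
  proof
    assume "a dvd b"
    then obtain k where k: "b = a * k" by blast
    show "\<exists>k<b + 1. b = a * k"
    proof (cases "a = 0")
      case True
      then show ?thesis using k by (intro exI[of _ 0]) simp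
    next
      case False
      then have "1 \<le> a" using less_iff_succ_less_eq[of 0 a] by (simp add: zero_less_iff_neq_zero)
      then have "k \<le> b" using mult_right_mono[of 1 a k] k by simp
      then show ?thesis using k by (auto simp: less_eq_iff_succ_less)
    qed
  qed auto
  moreover have "D0 S (\<lambda>e. \<exists>k<u e + 1. u e = t e * k)"
    using trm_shift[of t Suc] trm_shift[of u Suc] assms
    by (intro D0_bex D0_eq trm_intros)
  ultimately show ?thesis by simp
qed

text \<open>Two unbounded quantifiers are merged by searching for a single bound above both
  witnesses, which are then quantified below it.\<close>

lemma Sig1_ex:
  assumes "Sig1 (S :: 'n::arith set set) (\<lambda>e. Q (e 0) (\<lambda>k. e (Suc k)))"
  shows "Sig1 S (\<lambda>e. \<exists>y. Q y e)"
proof -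
  obtain R where R: "D0 S R" "(\<lambda>e. Q (e 0) (\<lambda>k. e (Suc k))) = (\<lambda>e. \<exists>y. R (case_nat y e))"
    using assms by (auto simp: Sig1_def)
  have Q: "Q x e \<longleftrightarrow> (\<exists>y. R (case_nat y (case_nat x e)))" for x e
    using fun_cong[OF R(2), of "case_nat x e"] by simp
  \<comment> \<open>The bound \<open>z\<close> sits at index \<open>2\<close>, between the two
    witnesses and the old environment.\<close>
  let ?f = "\<lambda>k. if k < 2 then k else Suc k"
  have "(\<exists>x. Q x e) \<longleftrightarrow> (\<exists>z. \<exists>x<z. \<exists>y<z. R (case_nat y (case_nat x e)))" for e
  proof
    assume "\<exists>x. Q x e"
    then obtain x y where "R (case_nat y (case_nat x e))" using Q by blast
    moreover have "x < max x y + 1" "y < max x y + 1" by (simp_all flip: less_eq_iff_succ_less)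
    ultimately show "\<exists>z. \<exists>x<z. \<exists>y<z. R (case_nat y (case_nat x e))" by blast
  qed (use Q in blast)
  moreover have "Sig1 S (\<lambda>e. \<exists>z. \<exists>x<z. \<exists>y<z. R (case_nat y (case_nat x e)))"
    by (rule Sig1_exI, (rule D0_bex, rule trm_var)+, rule D0_reindex[OF R(1), where f = ?f])
      (auto split: nat.split)
  ultimately show ?thesis by simp
qed

lemma Sig1_andor:
  assumes "Sig1 (S :: 'n::arith set set) P" "Sig1 S Q"
  shows "Sig1 S (\<lambda>e. P e \<and> Q e)" "Sig1 S (\<lambda>e. P e \<or> Q e)"
proof -
  obtain P' Q' where P': "D0 S P'" "P = (\<lambda>e. \<exists>y. P' (case_nat y e))"
    and Q': "D0 S Q'" "Q = (\<lambda>e. \<exists>y. Q' (case_nat y e))"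
    using assms by (auto simp: Sig1_def)
  let ?f = "\<lambda>k. if k = 0 then 0 else Suc k"
  have P'': "D0 S (\<lambda>e. P' (case_nat (e 0) (\<lambda>k. e (Suc (Suc k)))))"
    by (rule D0_reindex[OF P'(1), where f = ?f]) (auto split: nat.split)
  have Q'': "D0 S (\<lambda>e. Q' (case_nat (e (Suc 0)) (\<lambda>k. e (Suc (Suc k)))))"
    by (rule D0_reindex[OF Q'(1), where f = Suc]) (auto split: nat.split)
  have "Sig1 S (\<lambda>e. \<exists>x. \<exists>y. P' (case_nat y e) \<and> Q' (case_nat x e))"
    "Sig1 S (\<lambda>e. \<exists>x. \<exists>y. P' (case_nat y e) \<or> Q' (case_nat x e))"
    by (rule Sig1_ex, rule Sig1_exI, intro D0_and D0_or P'' Q'')+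
  then show "Sig1 S (\<lambda>e. P e \<and> Q e)" "Sig1 S (\<lambda>e. P e \<or> Q e)"
    unfolding P' Q' by (simp_all add: ex_disj_distrib)
qed

section \<open>Delta_1 predicates and collection\<close>

locale rca =
  fixes S :: "'n::arith set set"
  assumes sig1_induct: "\<And>P v. Sig1 S (\<lambda>e. P (e 0)) \<Longrightarrow> P 0 \<Longrightarrow> (\<And>v. P v \<Longrightarrow> P (v + 1)) \<Longrightarrow> P v"
    and sig2_induct: "\<And>P v. Sig2 S (\<lambda>e. P (e 0)) \<Longrightarrow> P 0 \<Longrightarrow> (\<And>v. P v \<Longrightarrow> P (v + 1)) \<Longrightarrow> P v"
    and comprehension: "\<And>P. Sig1 S (\<lambda>e. P (e 0)) \<Longrightarrow> Sig1 S (\<lambda>e. \<not> P (e 0)) \<Longrightarrow> {v. P v} \<in> S"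
begin

text \<open>Sigma_1 induction on the length of an initial segment; the new bound is the maximum of
  the old one and the successor of the new witness. The clause \<open>x < a\<close> keeps the
  statement true for every \<open>c\<close>, so the induction can run through all numbers.\<close>

lemma D0_collection:
  assumes "D0 S (\<lambda>e. R (e 0) (e (Suc 0)))" "\<forall>x<a. \<exists>y. R y x"
  shows "\<exists>b. \<forall>x<a. \<exists>y<b. R y x"
proof -
  have "\<exists>b. \<forall>x<c. x < a \<longrightarrow> (\<exists>y<b. R y x)" for c
  proof (rule sig1_induct[where P = "\<lambda>c. \<exists>b. \<forall>x<c. x < a \<longrightarrow> (\<exists>y<b. R y x)"])
    show "Sig1 S (\<lambda>e. \<exists>b. \<forall>x<e 0. x < a \<longrightarrow> (\<exists>y<b. R y x))"
      by (intro Sig1_exI D0_ball D0_imp D0_bex D0_less trm_intros assms(1))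
    fix c assume "\<exists>b. \<forall>x<c. x < a \<longrightarrow> (\<exists>y<b. R y x)"
    then obtain b where b: "\<forall>x<c. x < a \<longrightarrow> (\<exists>y<b. R y x)" by blast
    obtain y where y: "c < a \<longrightarrow> R y c" using assms(2) by blast
    have "\<exists>y'<max b (y + 1). R y' x" if "x < c + 1" "x < a" for x
    proof (cases "x = c")
      case True
      then show ?thesis using y that by (intro exI[of _ y]) (auto simp: less_max_iff_disj less_add_one)
    next
      case False
      then have "x < c" using that by (simp flip: less_eq_iff_succ_less)
      then show ?thesis using b that by (auto simp: less_max_iff_disj)
    qed
    then show "\<exists>b. \<forall>x<c + 1. x < a \<longrightarrow> (\<exists>y<b. R y x)" by blast
  qed simp
  then show ?thesis by blast
qed

text \<open>Collection moves the unbounded witness in front of the bounded quantifier.\<close>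

lemma Sig1_ball:
  assumes "trm t" "Sig1 S (\<lambda>e. Q (e 0) (\<lambda>k. e (Suc k)))"
  shows "Sig1 S (\<lambda>e. \<forall>x<t e. Q x e)"
proof -
  obtain R where R: "D0 S R" "(\<lambda>e. Q (e 0) (\<lambda>k. e (Suc k))) = (\<lambda>e. \<exists>y. R (case_nat y e))"
    using assms by (auto simp: Sig1_def)
  have Q: "Q x e \<longleftrightarrow> (\<exists>y. R (case_nat y (case_nat x e)))" for x e
    using fun_cong[OF R(2), of "case_nat x e"] by simp
  have "(\<forall>x<t e. Q x e) \<longleftrightarrow> (\<exists>b. \<forall>x<t e. \<exists>y<b. R (case_nat y (case_nat x e)))" for e
  proof
    assume "\<forall>x<t e. Q x e"
    \<comment> \<open>The environment \<open>e\<close> is frozen into constants, so that collection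
      sees a relation between two numbers.\<close>
    moreover have "D0 S (\<lambda>e'. R (case_nat (e' 0) (case_nat (e' (Suc 0)) e)))"
    proof -
      let ?\<sigma> = "\<lambda>k e'. case_nat (e' 0) (case_nat (e' (Suc 0)) e) k"
      have "trm (?\<sigma> k)" for k
        by (cases k; cases "k - 1") (auto intro: trm_intros)
      then show ?thesis by (rule D0_subst[OF R(1)])
    qed
    ultimately show "\<exists>b. \<forall>x<t e. \<exists>y<b. R (case_nat y (case_nat x e))"
      using Q by (intro D0_collection[of "\<lambda>y x. R (case_nat y (case_nat x e))"]) auto
  qed (use Q in blast)
  moreover have "Sig1 S (\<lambda>e. \<exists>b. \<forall>x<t e. \<exists>y<b. R (case_nat y (case_nat x e)))"
    by (rule Sig1_exI, rule D0_ball, rule trm_shift[OF assms(1)], rule D0_bex, rule trm_var,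
        rule D0_reindex[OF R(1), where f = "\<lambda>k. if k < 2 then k else Suc k"])
      (auto split: nat.split)
  ultimately show ?thesis by simp
qed

lemma Sig1_bex:
  assumes "trm t" "Sig1 S (\<lambda>e. Q (e 0) (\<lambda>k. e (Suc k)))"
  shows "Sig1 S (\<lambda>e. \<exists>x<t e. Q x e)"
  by (rule Sig1_ex, rule Sig1_andor, rule D0_Sig1[OF D0_less[OF trm_var trm_shift[OF assms(1)]]], rule assms(2))

definition D1 :: "((nat \<Rightarrow> 'n) \<Rightarrow> bool) \<Rightarrow> bool" where
  "D1 P \<longleftrightarrow> Sig1 S P \<and> Sig1 S (\<lambda>e. \<not> P e)"

lemma D1_D0: "D0 S P \<Longrightarrow> D1 P"
  unfolding D1_def by (intro conjI D0_Sig1 D0_not)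

lemma D1_not: "D1 P \<Longrightarrow> D1 (\<lambda>e. \<not> P e)"
  unfolding D1_def by simp

lemma D1_and: "D1 P \<Longrightarrow> D1 Q \<Longrightarrow> D1 (\<lambda>e. P e \<and> Q e)"
  unfolding D1_def de_Morgan_conj by (intro conjI Sig1_andor) auto

lemma D1_or: "D1 P \<Longrightarrow> D1 Q \<Longrightarrow> D1 (\<lambda>e. P e \<or> Q e)"
  unfolding D1_def de_Morgan_disj by (intro conjI Sig1_andor) auto

lemma D1_imp: "D1 P \<Longrightarrow> D1 Q \<Longrightarrow> D1 (\<lambda>e. P e \<longrightarrow> Q e)"
  unfolding imp_conv_disj by (intro D1_or D1_not)

lemma D1_iff: "D1 P \<Longrightarrow> D1 Q \<Longrightarrow> D1 (\<lambda>e. P e \<longleftrightarrow> Q e)"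
  unfolding iff_conv_conj_imp by (intro D1_and D1_imp)

lemma D1_ball: "trm t \<Longrightarrow> D1 (\<lambda>e. Q (e 0) (\<lambda>k. e (Suc k))) \<Longrightarrow> D1 (\<lambda>e. \<forall>x<t e. Q x e)"
  unfolding D1_def using Sig1_ball[of t Q] Sig1_bex[of t "\<lambda>x e. \<not> Q x e"] by simp

lemma D1_bex: "trm t \<Longrightarrow> D1 (\<lambda>e. Q (e 0) (\<lambda>k. e (Suc k))) \<Longrightarrow> D1 (\<lambda>e. \<exists>x<t e. Q x e)"
  using D1_not[OF D1_ball[OF _ D1_not], of t Q] by simp

lemma D1_ball_le: "trm t \<Longrightarrow> D1 (\<lambda>e. Q (e 0) (\<lambda>k. e (Suc k))) \<Longrightarrow> D1 (\<lambda>e. \<forall>x\<le>t e. Q x e)"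
  unfolding less_eq_iff_succ_less by (intro D1_ball trm_intros)

lemma D1_bex_le: "trm t \<Longrightarrow> D1 (\<lambda>e. Q (e 0) (\<lambda>k. e (Suc k))) \<Longrightarrow> D1 (\<lambda>e. \<exists>x\<le>t e. Q x e)"
  unfolding less_eq_iff_succ_less by (intro D1_bex trm_intros)

lemmas D1_atom = D0_const[THEN D1_D0] D0_eq[THEN D1_D0] D0_less[THEN D1_D0] D0_le[THEN D1_D0]
  D0_mem[THEN D1_D0] D0_dvd[THEN D1_D0]

lemmas D1_intros = D1_atom D1_not D1_and D1_or D1_imp D1_iff D1_ball D1_bex D1_ball_le D1_bex_le trm_intros

lemma D1_Sig1: "D1 P \<Longrightarrow> Sig1 S P" "D1 P \<Longrightarrow> Sig1 S (\<lambda>e. \<not> P e)"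
  unfolding D1_def by auto

lemma D1_subst: "D1 P \<Longrightarrow> (\<And>k. trm (\<sigma> k)) \<Longrightarrow> D1 (\<lambda>e. P (\<lambda>k. \<sigma> k e))"
  unfolding D1_def using Sig1_subst by blast

text \<open>With rules of this kind a relation is shown definable once, in its own arguments, and
  can then be used with arbitrary terms.\<close>

lemma D1_app2:
  assumes "D1 (\<lambda>e. R (e 0) (e 1))" "trm t" "trm u"
  shows "D1 (\<lambda>e. R (t e) (u e))"
  using D1_subst[OF assms(1), of "\<lambda>k. if k = 0 then t else u"] assms(2,3) by simp

lemma D1_app3:
  assumes "D1 (\<lambda>e. R (e 0) (e 1) (e 2))" "trm t" "trm u" "trm v"
  shows "D1 (\<lambda>e. R (t e) (u e) (v e))"
  using D1_subst[OF assms(1), of "\<lambda>k. if k = 0 then t else if k = 1 then u else v"] assms(2-) by simp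

lemma D1_app4:
  assumes "D1 (\<lambda>e. R (e 0) (e 1) (e 2) (e 3))" "trm t" "trm u" "trm v" "trm w"
  shows "D1 (\<lambda>e. R (t e) (u e) (v e) (w e))"
  using D1_subst[OF assms(1), of "\<lambda>k. if k = 0 then t else if k = 1 then u else if k = 2 then v else w"]
    assms(2-) by simp

lemma D1_induct: "D1 (\<lambda>e. P (e 0)) \<Longrightarrow> P 0 \<Longrightarrow> (\<And>v. P v \<Longrightarrow> P (v + 1)) \<Longrightarrow> P v"
  by (rule sig1_induct[OF D1_Sig1(1)])

lemma D1_least:
  assumes "D1 (\<lambda>e. P (e 0))" "P v"
  shows "\<exists>v. P v \<and> (\<forall>u<v. \<not> P u)"
proof (rule ccontr)
  assume no: "\<not> ?thesis"
  have "\<forall>u<w. \<not> P u" for w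
  proof (rule D1_induct[where P = "\<lambda>w. \<forall>u<w. \<not> P u"])
    show "D1 (\<lambda>e. \<forall>u<e 0. \<not> P u)" by (intro D1_intros assms(1))
    show "\<forall>u<w + 1. \<not> P u" if "\<forall>u<w. \<not> P u" for w
      using that no by (auto simp flip: less_eq_iff_succ_less simp: order.order_iff_strict)
  qed simp
  then show False using assms(2) less_add_one by blast
qed

lemma Sig2_exI:
  assumes "Sig1 S (\<lambda>e. \<not> Q (e 0) (\<lambda>k. e (Suc k)))"
  shows "Sig2 S (\<lambda>e. \<exists>y. Q y e)"
  unfolding Sig2_def by (rule exI[of _ "\<lambda>e. Q (e 0) (\<lambda>k. e (Suc k))"]) (use assms in simp)

text \<open>Collection for Pi_1 matrices, again by induction on an initial segment. The existence of
  a common bound is a Sigma_2 statement, since a counterexample \<open>s\<close> together with some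
  \<open>x < c\<close> is found by a Sigma_1 search.\<close>

lemma Pi1_bound:
  assumes "D1 (\<lambda>e. Q (e 0) (e 1))" "\<forall>x<a. \<exists>b. \<forall>s>b. Q s x"
  shows "\<exists>b. \<forall>x<a. \<forall>s>b. Q s x"
proof -
  have "\<exists>b. \<forall>x<c. x < a \<longrightarrow> (\<forall>s>b. Q s x)" for c
  proof (rule sig2_induct[where P = "\<lambda>c. \<exists>b. \<forall>x<c. x < a \<longrightarrow> (\<forall>s>b. Q s x)"])
    have "Sig1 S (\<lambda>e. \<exists>s. \<exists>x<e (Suc 0). x < a \<and> e 0 < s \<and> \<not> Q s x)"
      by (intro Sig1_ex D1_Sig1 D1_intros D1_app2[OF assms(1)])
    moreover have "(\<exists>s. \<exists>x<c. x < a \<and> b < s \<and> \<not> Q s x) \<longleftrightarrow> \<not> (\<forall>x<c. x < a \<longrightarrow> (\<forall>s>b. Q s x))" for b c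
      by blast
    ultimately show "Sig2 S (\<lambda>e. \<exists>b. \<forall>x<e 0. x < a \<longrightarrow> (\<forall>s>b. Q s x))"
      by (intro Sig2_exI) simp
    fix c assume "\<exists>b. \<forall>x<c. x < a \<longrightarrow> (\<forall>s>b. Q s x)"
    then obtain b where b: "\<forall>x<c. x < a \<longrightarrow> (\<forall>s>b. Q s x)" by blast
    obtain b' where b': "c < a \<longrightarrow> (\<forall>s>b'. Q s c)" using assms(2) by blast
    have "\<forall>x<c + 1. x < a \<longrightarrow> (\<forall>s>max b b'. Q s x)"
      using b b' by (auto simp flip: less_eq_iff_succ_less simp: order.order_iff_strict)
    then show "\<exists>b. \<forall>x<c + 1. x < a \<longrightarrow> (\<forall>s>b. Q s x)" by blast
  qed simp
  then show ?thesis by blast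
qed

end

section \<open>Coding finite sets\<close>

definition pr :: "'n::arith \<Rightarrow> 'n \<Rightarrow> 'n" where
  "pr a b = (a + b) * (a + b) + a"

lemma trm_pr: "trm t \<Longrightarrow> trm u \<Longrightarrow> trm (\<lambda>e. pr (t e) (u e))"
  unfolding pr_def by (intro trm_intros)

lemma pr_mono: "a \<le> a' \<Longrightarrow> b \<le> b' \<Longrightarrow> pr a b \<le> pr a' b'"
  unfolding pr_def by (intro add_mono mult_mono) auto

lemma le_square: "(a::'n::arith) \<le> a * a"
proof (cases "a = 0")
  case False
  then have "1 \<le> a" using less_iff_succ_less_eq[of 0 a] by (simp add: zero_less_iff_neq_zero)
  then show ?thesis using mult_left_mono[of 1 a a] by simp
qed simp

lemma le_pr: "a \<le> pr a b \<and> b \<le> pr a b"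
proof -
  have "a + b \<le> pr a b"
    unfolding pr_def using le_square[of "a + b"] by (simp add: add_increasing2)
  moreover have "a \<le> a + b" "b \<le> a + b" by (simp_all add: add_increasing add_increasing2)
  ultimately show ?thesis by (blast intro: order_trans)
qed

text \<open>With \<open>n = a + b\<close>, the value \<open>n * n + a\<close> lies from
  \<open>n * n\<close> up to below \<open>(n + 1) * (n + 1)\<close>. The intervals are disjoint, so
  the code determines \<open>n\<close>, and then \<open>a\<close> is the remainder.\<close>

lemma pr_less: "a + b < a' + b' \<Longrightarrow> pr a b < pr a' b'"
proof -
  assume "a + b < a' + b'"
  then have "a + b + 1 \<le> a' + b'" by (simp add: less_iff_succ_less_eq)
  then have "(a + b + 1) * (a + b + 1) \<le> (a' + b') * (a' + b')" by (intro mult_mono) auto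
  moreover have "pr a b < (a + b + 1) * (a + b + 1)"
  proof -
    have "(a + b + 1) * (a + b + 1) = pr a b + (a + b + b + 1)"
      unfolding pr_def by (simp add: algebra_simps)
    moreover have "0 < a + b + b + 1" by (simp add: add_nonneg_pos)
    ultimately show ?thesis by simp
  qed
  ultimately show ?thesis unfolding pr_def[of a' b'] by (simp add: less_le_trans add_increasing2)
qed

lemma pr_eq [simp]: "pr a b = pr a' b' \<longleftrightarrow> a = a' \<and> b = b'"
proof
  assume eq: "pr a b = pr a' b'"
  then have "a + b = a' + b'"
    using pr_less[of a b a' b'] pr_less[of a' b' a b] by (metis less_irrefl linorder_cases)
  then show "a = a' \<and> b = b'" using eq unfolding pr_def by simp
qed simp

text \<open>Codes \<open>((q, m), b)\<close> of bounded sets, as in Goedel's \<open>\<beta>\<close> function.\<close>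

definition elem :: "'n::arith \<Rightarrow> 'n \<Rightarrow> bool" where
  "elem x r \<longleftrightarrow> (\<exists>b\<le>r. \<exists>m\<le>r. \<exists>q\<le>r. r = pr (pr q m) b \<and> x < b \<and> (x + 1) * m + 1 dvd q)"

lemma elem_pr: "elem x (pr (pr q m) b) \<longleftrightarrow> x < b \<and> (x + 1) * m + 1 dvd q"
  unfolding elem_def using le_pr[of "pr q m" b] le_pr[of q m] by (auto intro: order_trans[of _ "pr q m"])

lemma elem_less: "elem x r \<Longrightarrow> x < r"
  unfolding elem_def by auto

text \<open>A replacement for coprimality of the moduli \<open>u = (x + 1) * m + 1\<close> and
  \<open>v = (n + 1) * m + 1\<close>. Since \<open>(n + 1) * u\<close> and
  \<open>(x + 1) * v\<close> differ by \<open>d\<close>, \<open>u dvd q * v\<close> gives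
  \<open>u dvd q * d\<close> and thus \<open>u dvd q * m\<close>. Finally \<open>q * u\<close> is
  \<open>(x + 1) * (q * m) + q\<close>, so \<open>u dvd q\<close>. The two cases stand for the sign
  of the difference.\<close>

lemma dvd_mult_coprime:
  fixes x n m q d :: "'n::arith"
  assumes n: "n = x + d \<or> x = n + d" and d: "d dvd m"
  shows "(x + 1) * m + 1 dvd q * ((n + 1) * m + 1) \<longleftrightarrow> (x + 1) * m + 1 dvd q"
proof
  let ?u = "(x + 1) * m + 1" and ?v = "(n + 1) * m + 1"
  assume u: "?u dvd q * ?v"
  have "?u dvd q * d"
    using n
  proof
    assume "n = x + d"
    then have eq: "(q * (n + 1)) * ?u = (x + 1) * (q * ?v) + q * d" by (simp add: algebra_simps)
    have "?u dvd (x + 1) * (q * ?v) + q * d" unfolding eq[symmetric] by simp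
    then show ?thesis using u by (metis dvd_add_right_iff dvd_mult)
  next
    assume "x = n + d"
    then have eq: "(x + 1) * (q * ?v) = (q * (n + 1)) * ?u + q * d" by (simp add: algebra_simps)
    have "?u dvd (q * (n + 1)) * ?u + q * d" unfolding eq[symmetric] using u by (rule dvd_mult)
    then show ?thesis by (metis dvd_add_right_iff dvd_triv_right)
  qed
  then have "?u dvd q * m" using d by (metis dvd_def dvd_mult2 mult.assoc)
  then have "?u dvd (x + 1) * (q * m)" by (rule dvd_mult)
  moreover have "q * ?u = (x + 1) * (q * m) + q" by (simp add: algebra_simps)
  ultimately show "?u dvd q" by (metis dvd_add_right_iff dvd_triv_right)
qed simp

context rca
begin

lemma D1_elem: "trm t \<Longrightarrow> trm u \<Longrightarrow> D1 (\<lambda>e. elem (t e) (u e))"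
proof (rule D1_app2)
  show "D1 (\<lambda>e. elem (e 0) (e 1))"
    unfolding elem_def by (intro D1_intros trm_pr)
qed

lemmas D1_intros' = D1_intros trm_pr D1_elem

text \<open>A substitute for the factorial: only the existence of a suitable multiple is carried
  through the induction. The lower bound \<open>c\<close> later makes codes large.\<close>

lemma common_multiple:
  fixes c n :: 'n
  shows "\<exists>m>c. \<forall>d<n. d + 1 dvd m"
proof (rule sig1_induct[where P = "\<lambda>n. \<exists>m>c. \<forall>d<n. d + 1 dvd m"])
  show "Sig1 S (\<lambda>e. \<exists>m>c. \<forall>d<e 0. d + 1 dvd m)"
    by (intro Sig1_ex D1_Sig1 D1_intros)
  show "\<exists>m>c. \<forall>d<0. d + 1 dvd m" using less_add_one[of c] by (intro exI[of _ "c + 1"]) simp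
  fix n assume "\<exists>m>c. \<forall>d<n. d + 1 dvd m"
  then obtain m where m: "c < m" "\<forall>d<n. d + 1 dvd m" by blast
  have "m \<le> m * (n + 1)" using mult_left_mono[of 1 "n + 1" m] by simp
  then have "c < m * (n + 1)" using m(1) by (rule less_le_trans[rotated])
  moreover have "d + 1 dvd m * (n + 1)" if "d < n + 1" for d
    using that m(2) by (cases "d = n") (auto simp flip: less_eq_iff_succ_less simp: order.order_iff_strict)
  ultimately show "\<exists>m>c. \<forall>d<n + 1. d + 1 dvd m" by blast
qed

text \<open>The number \<open>q\<close> is the product of the moduli of the members, built up one
  candidate at a time. Since \<open>m\<close> is a multiple of every nonzero difference of numbers
  below \<open>b\<close>, a new factor does not change which of the other moduli divide the
  product.\<close>

lemma code_exists:
  assumes Q: "D1 (\<lambda>e. Q (e 0))"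
  shows "\<exists>r>c. \<forall>x. elem x r \<longleftrightarrow> x < b \<and> Q x"
proof -
  obtain m where m: "c < m" "\<And>d. d < b \<Longrightarrow> d + 1 dvd m" using common_multiple by blast
  let ?u = "\<lambda>x. (x + 1) * m + 1"
  have "\<exists>q. \<forall>x<b. ?u x dvd q \<longleftrightarrow> x < n \<and> Q x" for n
  proof (rule sig1_induct[where P = "\<lambda>n. \<exists>q. \<forall>x<b. ?u x dvd q \<longleftrightarrow> x < n \<and> Q x"])
    show "Sig1 S (\<lambda>e. \<exists>q. \<forall>x<b. ?u x dvd q \<longleftrightarrow> x < e 0 \<and> Q x)"
      by (intro Sig1_ex D1_Sig1 D1_intros D1_subst[OF Q, of "\<lambda>_ e. e 0"])
    \<comment> \<open>The empty product \<open>1\<close> has to code the empty set: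
      \<open>m > c\<close> is positive, so every modulus exceeds \<open>1\<close>.\<close>
    have "\<not> ?u x dvd 1" for x
    proof
      assume "?u x dvd 1"
      then obtain k where "1 = ?u x * k" by blast
      moreover have "k \<noteq> 0" using calculation by auto
      then have "1 \<le> k" using less_iff_succ_less_eq[of 0 k] by (simp add: zero_less_iff_neq_zero)
      ultimately have "?u x \<le> 1" using mult_left_mono[of 1 k "?u x"] by simp
      then have "(x + 1) * m = 0" using add_le_cancel_right[of "(x + 1) * m" 1 0] by simp
      then show False using m(1) by auto
    qed
    then show "\<exists>q. \<forall>x<b. ?u x dvd q \<longleftrightarrow> x < 0 \<and> Q x" by (intro exI[of _ 1]) auto
    fix n assume "\<exists>q. \<forall>x<b. ?u x dvd q \<longleftrightarrow> x < n \<and> Q x"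
    then obtain q where q: "\<And>x. x < b \<Longrightarrow> ?u x dvd q \<longleftrightarrow> x < n \<and> Q x" by blast
    show "\<exists>q. \<forall>x<b. ?u x dvd q \<longleftrightarrow> x < n + 1 \<and> Q x"
    proof (cases "Q n \<and> n < b")
      case False
      then have "?u x dvd q \<longleftrightarrow> x < n + 1 \<and> Q x" if "x < b" for x
        using q[OF that] that by (auto simp flip: less_eq_iff_succ_less simp: order.order_iff_strict)
      then show ?thesis by blast
    next
      case True
      have "?u x dvd q * ?u n \<longleftrightarrow> x < n + 1 \<and> Q x" if x: "x < b" for x
      proof (cases "x = n")
        case True
        then show ?thesis using \<open>Q n \<and> n < b\<close> by (simp add: less_add_one)
      next
        case False
        have "\<exists>d. (n = x + d \<or> x = n + d) \<and> d dvd m"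
        proof -
          obtain d where d: "n = x + d \<or> x = n + d" using le_iff_add linear by metis
          then have "d \<noteq> 0" "d \<le> n \<or> d \<le> x" using False by (auto simp: add_increasing)
          then have "d < b" using x \<open>Q n \<and> n < b\<close> by (meson le_less_trans)
          moreover obtain d' where "d = d' + 1"
            using \<open>d \<noteq> 0\<close> less_iff_succ_less_eq[of 0 d] le_iff_add[of 1 d]
            by (auto simp: zero_less_iff_neq_zero add.commute)
          ultimately have "d dvd m" using m(2)[of d'] by (meson less_add_one less_trans)
          then show ?thesis using d by blast
        qed
        then have "?u x dvd q * ?u n \<longleftrightarrow> ?u x dvd q" using dvd_mult_coprime by metis
        then show ?thesis using q[OF x] False
          by (auto simp flip: less_eq_iff_succ_less simp: order.order_iff_strict)
      qed
      then show ?thesis by blast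
    qed
  qed
  then obtain q where q: "\<forall>x<b. ?u x dvd q \<longleftrightarrow> x < b \<and> Q x" by blast
  show ?thesis
  proof (intro exI conjI allI)
    show "c < pr (pr q m) b" using m(1) le_pr[of q m] le_pr[of "pr q m" b] by auto
    show "elem x (pr (pr q m) b) \<longleftrightarrow> x < b \<and> Q x" for x using q elem_pr by blast
  qed
qed

lemma code_relation:
  assumes J: "D1 (\<lambda>e. J (e 0) (e 1))"
  shows "\<exists>r. \<forall>x y. elem (pr x y) r \<longleftrightarrow> x < a \<and> y < b \<and> J x y"
proof -
  have "D1 (\<lambda>e. \<exists>x<a. \<exists>y<b. e 0 = pr x y \<and> J x y)"
    by (intro D1_intros' D1_app2[OF J])
  from code_exists[OF this, of "pr a b" "pr a b + 1"] obtain r where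
    r: "\<forall>z. elem z r \<longleftrightarrow> z < pr a b + 1 \<and> (\<exists>x<a. \<exists>y<b. z = pr x y \<and> J x y)" by blast
  have "pr x y < pr a b + 1" if "x < a" "y < b" for x y
    using pr_mono[of x a y b] that by (simp flip: less_eq_iff_succ_less)
  then show ?thesis by (intro exI[of _ r]) (auto simp: r)
qed

text \<open>The pigeonhole principle is obtained by shrinking a putative injection step by step, which is
  an upward induction for the \<open>\<Sigma>\<^sub>1\<close> existence of a code.\<close>

lemma pigeonhole:
  assumes J: "D1 (\<lambda>e. J (e 0) (e 1))"
    and total: "\<And>j. j \<le> n \<Longrightarrow> \<exists>k<n. J j k"
    and inj: "\<And>i j k. i \<le> n \<Longrightarrow> j \<le> n \<Longrightarrow> k < n \<Longrightarrow> J i k \<Longrightarrow> J j k \<Longrightarrow> i = j"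
  shows False
proof -
  define inject where "inject w l \<longleftrightarrow> (\<forall>j\<le>l. \<exists>k<l. elem (pr j k) w) \<and>
    (\<forall>i\<le>l. \<forall>j\<le>l. \<forall>k<l. elem (pr i k) w \<and> elem (pr j k) w \<longrightarrow> i = j)" for w l :: 'n
  have D1_inject: "D1 (\<lambda>e. inject (e 0) (e 1))"
    unfolding inject_def by (intro D1_intros')
  have step: "\<exists>w'. inject w' l" if "inject w (l + 1)" for w l
  proof -
    \<comment> \<open>An argument sent to the value \<open>l\<close>, which is to be dropped, is
      redirected to the value of the dropped argument \<open>l + 1\<close>.\<close>
    have "D1 (\<lambda>e. elem (pr (e 0) (e 1)) w \<or> elem (pr (e 0) l) w \<and> elem (pr (l + 1) (e 1)) w)"
      by (intro D1_intros')
    from code_relation[OF this, of "l + 1" l] obtain w' where w':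
      "\<And>j k. elem (pr j k) w' \<longleftrightarrow> j \<le> l \<and> k < l \<and>
        (elem (pr j k) w \<or> elem (pr j l) w \<and> elem (pr (l + 1) k) w)"
      unfolding less_eq_iff_succ_less by blast
    have tot: "\<exists>k\<le>l. elem (pr j k) w" if "j \<le> l + 1" for j
      using \<open>inject w (l + 1)\<close> that unfolding inject_def less_eq_iff_succ_less by blast
    have inj: "i = j" if "i \<le> l + 1" "j \<le> l + 1" "k \<le> l" "elem (pr i k) w" "elem (pr j k) w" for i j k
      using \<open>inject w (l + 1)\<close> that unfolding inject_def less_eq_iff_succ_less by blast
    have le: "j \<le> l + 1" if "j \<le> l" for j using that by (simp add: add_increasing2)
    have neq: "j \<noteq> l + 1" if "j \<le> l" for j using that less_add_one[of l] by auto
    have "inject w' l"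
      unfolding inject_def
    proof (intro conjI allI impI)
      fix j assume j: "j \<le> l"
      obtain k where k: "k \<le> l" "elem (pr j k) w" using tot le j by blast
      show "\<exists>k<l. elem (pr j k) w'"
      proof (cases "k = l")
        case False
        then show ?thesis using k w' j by (intro exI[of _ k]) auto
      next
        case True
        obtain k' where k': "k' \<le> l" "elem (pr (l + 1) k') w" using tot by blast
        then have "k' \<noteq> l" using inj[of j "l + 1" l] k True j le neq by auto
        then show ?thesis using k' k True w' j by (intro exI[of _ k']) auto
      qed
    next
      fix i j k assume "i \<le> l" "j \<le> l" "k < l" "elem (pr i k) w' \<and> elem (pr j k) w'"
      then show "i = j"
        using w' inj[of i j k] inj[of i j l] inj[of i "l + 1" k] inj[of j "l + 1" k] le neq
        by (auto simp: order_less_imp_le)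
    qed
    then show ?thesis by blast
  qed
  have "t \<le> n \<longrightarrow> (\<exists>w. \<exists>l\<le>n. l + t = n \<and> inject w l)" for t
  proof (rule sig1_induct[where P = "\<lambda>t. t \<le> n \<longrightarrow> (\<exists>w. \<exists>l\<le>n. l + t = n \<and> inject w l)"])
    have "Sig1 S (\<lambda>e. \<exists>w. e 0 \<le> n \<longrightarrow> (\<exists>l\<le>n. l + e 0 = n \<and> inject w l))"
      by (intro Sig1_ex D1_Sig1 D1_intros D1_app2[OF D1_inject])
    then show "Sig1 S (\<lambda>e. e 0 \<le> n \<longrightarrow> (\<exists>w. \<exists>l\<le>n. l + e 0 = n \<and> inject w l))" by simp
    obtain w where w: "\<forall>x y. elem (pr x y) w \<longleftrightarrow> x < n + 1 \<and> y < n \<and> J x y"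
      using code_relation[OF J] by blast
    have "inject w n"
      unfolding inject_def using w total inj by (simp flip: less_eq_iff_succ_less)
    then show "0 \<le> n \<longrightarrow> (\<exists>w. \<exists>l\<le>n. l + 0 = n \<and> inject w l)" by auto
    fix t assume IH: "t \<le> n \<longrightarrow> (\<exists>w. \<exists>l\<le>n. l + t = n \<and> inject w l)"
    show "t + 1 \<le> n \<longrightarrow> (\<exists>w. \<exists>l\<le>n. l + (t + 1) = n \<and> inject w l)"
    proof
      assume t: "t + 1 \<le> n"
      then obtain l' where l': "n = t + 1 + l'" by (auto simp: le_iff_add)
      have "t \<le> n" using t by (meson less_add_one less_imp_le order_trans)
      then obtain w l where "l + t = n" "inject w l" using IH by blast
      moreover have "l = l' + 1"
        using calculation(1) l' by (metis add.assoc add.commute add_left_cancel)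
      ultimately obtain w' where "inject w' l'" using step by blast
      moreover have "l' + (t + 1) = n" "l' \<le> n" using l' by (auto simp: add.commute)
      ultimately show "\<exists>w. \<exists>l\<le>n. l + (t + 1) = n \<and> inject w l" by blast
    qed
  qed
  \<comment> \<open>After \<open>n\<close> removals \<open>l = 0\<close>, and the argument
    \<open>0\<close> would need a value below \<open>0\<close>.\<close>
  from this[of n] obtain w l where "l + n = n" "inject w l" by auto
  then have "inject w 0" by simp
  then show False unfolding inject_def by auto
qed

text \<open>Course-of-values recursion on \<open>e\<close>, where \<open>p\<close> is a parameter
  that also bounds \<open>y\<close>. By \<open>local\<close> a step depends only on the finite table
  of earlier rows, which can be coded; correct tables of every length exist by Sigma_1 induction,
  and any two agree on their common part.\<close>

lemma recursion:
  assumes G: "D1 (\<lambda>e. G (e 0) (e 1) (e 2) (e 3))"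
    and local: "\<And>p w w' e y. y < p \<Longrightarrow> (\<And>e' y'. e' < e \<Longrightarrow> y' < p \<Longrightarrow> elem (pr e' y') w \<longleftrightarrow> elem (pr e' y') w')
      \<Longrightarrow> G p w e y \<longleftrightarrow> G p w' e y"
  shows "\<exists>T. D1 (\<lambda>e. T (e 0) (e 1) (e 2)) \<and> (\<forall>p e. \<exists>w.
    (\<forall>e'<e. \<forall>y'<p. elem (pr e' y') w \<longleftrightarrow> T p e' y') \<and> (\<forall>y. T p e y \<longleftrightarrow> y < p \<and> G p w e y))"
proof -
  define run where "run p n w \<longleftrightarrow> (\<forall>e<n. \<forall>y<p. elem (pr e y) w \<longleftrightarrow> G p w e y)" for p n w
  have D1_run: "D1 (\<lambda>e. run (e 0) (e 1) (e 2))"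
    unfolding run_def by (intro D1_intros' D1_app4[OF G])
  have ex: "\<exists>w. run p n w" for p n
  proof (rule sig1_induct[where P = "\<lambda>n. \<exists>w. run p n w"])
    show "Sig1 S (\<lambda>e. \<exists>w. run p (e 0) w)"
      by (intro Sig1_ex D1_Sig1 D1_intros D1_app3[OF D1_run])
    show "\<exists>w. run p 0 w" by (simp add: run_def)
    fix n assume "\<exists>w. run p n w"
    then obtain w where w: "run p n w" by blast
    \<comment> \<open>The old table supplies the rows below \<open>n\<close>, and \<open>G\<close>
      computes row \<open>n\<close> from it.\<close>
    have "D1 (\<lambda>e. if e 0 < n then elem (pr (e 0) (e 1)) w else G p w (e 0) (e 1))"
      unfolding if_bool_eq_conj by (intro D1_intros' D1_app4[OF G])
    from code_relation[OF this, of "n + 1" p] obtain w' where w': "elem (pr e y) w' \<longleftrightarrow>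
      e < n + 1 \<and> y < p \<and> (if e < n then elem (pr e y) w else G p w e y)" for e y
      by blast
    have "elem (pr e y) w' \<longleftrightarrow> G p w' e y" if "e < n + 1" "y < p" for e y
    proof -
      have "G p w e y \<longleftrightarrow> G p w' e y"
      proof (rule local[OF that(2)])
        fix e' y' assume "e' < e" "y' < p"
        moreover have "e' < n"
          using \<open>e' < e\<close> that(1) by (metis less_eq_iff_succ_less order_less_le_trans)
        ultimately show "elem (pr e' y') w \<longleftrightarrow> elem (pr e' y') w'"
          using w' by (simp add: add_strict_increasing2 less_trans[OF _ less_add_one])
      qed
      then show ?thesis using w' w that unfolding run_def by auto
    qed
    then show "\<exists>w. run p (n + 1) w" unfolding run_def by blast
  qed
  have unique: "\<forall>e<i. \<forall>y<p. elem (pr e y) w \<longleftrightarrow> elem (pr e y) w'"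
    if "run p n w" "run p n' w'" "i \<le> n" "i \<le> n'" for p n n' w w' i
  proof -
    have "i \<le> n \<and> i \<le> n' \<longrightarrow> (\<forall>e<i. \<forall>y<p. elem (pr e y) w \<longleftrightarrow> elem (pr e y) w')"
    proof (rule D1_induct[where P = "\<lambda>i. i \<le> n \<and> i \<le> n' \<longrightarrow> (\<forall>e<i. \<forall>y<p. elem (pr e y) w \<longleftrightarrow> elem (pr e y) w')"])
      show "D1 (\<lambda>e. e 0 \<le> n \<and> e 0 \<le> n' \<longrightarrow> (\<forall>i<e 0. \<forall>y<p. elem (pr i y) w \<longleftrightarrow> elem (pr i y) w'))"
        by (intro D1_intros')
      fix i assume IH: "i \<le> n \<and> i \<le> n' \<longrightarrow> (\<forall>e<i. \<forall>y<p. elem (pr e y) w \<longleftrightarrow> elem (pr e y) w')"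
      show "i + 1 \<le> n \<and> i + 1 \<le> n' \<longrightarrow> (\<forall>e<i + 1. \<forall>y<p. elem (pr e y) w \<longleftrightarrow> elem (pr e y) w')"
      proof (intro impI allI)
        fix e y assume i: "i + 1 \<le> n \<and> i + 1 \<le> n'" and e: "e < i + 1" and y: "y < p"
        then have lt: "i < n" "i < n'" by (simp_all add: less_iff_succ_less_eq)
        then have IH': "elem (pr e y) w \<longleftrightarrow> elem (pr e y) w'" if "e < i" "y < p" for e y
          using IH that by auto
        have "G p w i y \<longleftrightarrow> G p w' i y" by (rule local[OF y IH'])
        then have "elem (pr i y) w \<longleftrightarrow> elem (pr i y) w'"
          using that(1,2) lt y unfolding run_def by blast
        then show "elem (pr e y) w \<longleftrightarrow> elem (pr e y) w'"
          using IH' e y by (cases "e = i") (auto simp flip: less_eq_iff_succ_less)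
      qed
    qed simp
    then show ?thesis using that by blast
  qed
  define T where "T p e y \<longleftrightarrow> (\<exists>w. y < p \<and> run p (e + 1) w \<and> elem (pr e y) w)" for p e y
  have T: "T p e y \<longleftrightarrow> elem (pr e y) w" if "run p n w" "e < n" "y < p" for p n w e y
  proof -
    have "elem (pr e y) w \<longleftrightarrow> elem (pr e y) w'" if "run p (e + 1) w'" for w'
      using unique[OF \<open>run p n w\<close> that, of "e + 1"] \<open>e < n\<close> \<open>y < p\<close> less_add_one[of e]
      by (auto simp: less_iff_succ_less_eq)
    then show ?thesis using ex \<open>y < p\<close> unfolding T_def by blast
  qed
  \<comment> \<open>Some correct table exists and all of them agree, so a negative answer can also
    be read off from any one of them; hence the complement is Sigma_1 too.\<close>
  have not_T: "\<not> T p e y \<longleftrightarrow> (\<exists>w. \<not> y < p \<or> run p (e + 1) w \<and> \<not> elem (pr e y) w)" for p e y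
  proof (cases "y < p")
    case True
    obtain w where "run p (e + 1) w" using ex by blast
    then show ?thesis using T[of p "e + 1" _ e y] True less_add_one[of e] by blast
  qed (simp add: T_def)
  have "Sig1 S (\<lambda>e. T (e 0) (e 1) (e 2))"
    unfolding T_def by (intro Sig1_ex D1_Sig1 D1_intros' D1_app3[OF D1_run])
  moreover have "Sig1 S (\<lambda>e. \<not> T (e 0) (e 1) (e 2))"
    unfolding not_T by (intro Sig1_ex D1_Sig1(1) D1_intros' D1_app3[OF D1_run])
  ultimately have "D1 (\<lambda>e. T (e 0) (e 1) (e 2))" unfolding D1_def ..
  moreover have "\<exists>w. (\<forall>e'<e. \<forall>y'<p. elem (pr e' y') w \<longleftrightarrow> T p e' y') \<and> (\<forall>y. T p e y \<longleftrightarrow> y < p \<and> G p w e y)" for p e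
  proof -
    obtain w where w: "run p (e + 1) w" using ex by blast
    have "T p e y \<longleftrightarrow> y < p \<and> G p w e y" for y
    proof (cases "y < p")
      case True
      then show ?thesis using T[OF w, of e y] w less_add_one[of e] unfolding run_def by blast
    qed (simp add: T_def)
    moreover have "elem (pr e' y') w \<longleftrightarrow> T p e' y'" if "e' < e" "y' < p" for e' y'
      using T[OF w, of e' y'] that less_add_one[of e] by (metis less_trans)
    ultimately show ?thesis by blast
  qed
  ultimately show ?thesis by blast
qed

end

section \<open>Colorings\<close>

definition col :: "'n::arith set \<Rightarrow> 'n \<Rightarrow> 'n \<Rightarrow> 'n \<Rightarrow> bool" where
  "col F x s y \<longleftrightarrow> pr (pr x s) y \<in> F"

definition same_col :: "'n::arith set \<Rightarrow> 'n \<Rightarrow> 'n \<Rightarrow> 'n \<Rightarrow> 'n \<Rightarrow> bool" where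
  "same_col F x s x' s' \<longleftrightarrow> (\<exists>c. col F x s c \<and> col F x' s' c)"

definition is_coloring :: "'n::arith set \<Rightarrow> bool" where
  "is_coloring F \<longleftrightarrow> (\<forall>n. n \<in> F \<longrightarrow> (\<exists>x s y. x < s \<and> n = pr (pr x s) y)) \<and>
    (\<forall>x s. x < s \<longrightarrow> (\<exists>y. col F x s y)) \<and>
    (\<forall>x s y z. col F x s y \<and> col F x s z \<longrightarrow> y = z)"

definition is_stable :: "'n::arith set \<Rightarrow> bool" where
  "is_stable F \<longleftrightarrow> (\<forall>x. \<exists>y b. \<forall>s. b < s \<and> x < s \<longrightarrow> col F x s y)"

definition unbounded :: "'n::arith set \<Rightarrow> bool" where
  "unbounded A \<longleftrightarrow> (\<forall>b. \<exists>x. b < x \<and> x \<in> A)"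

definition is_thin :: "'n::arith set \<Rightarrow> 'n set \<Rightarrow> bool" where
  "is_thin A F \<longleftrightarrow> (\<exists>y. \<not> (\<exists>x s. x \<in> A \<and> s \<in> A \<and> x < s \<and> col F x s y))"

definition is_two_bounded :: "'n::arith set \<Rightarrow> bool" where
  "is_two_bounded F \<longleftrightarrow> (\<forall>y x1 s1 x2 s2 x3 s3. col F x1 s1 y \<and> col F x2 s2 y \<and> col F x3 s3 y \<longrightarrow>
    x1 = x2 \<and> s1 = s2 \<or> x1 = x3 \<and> s1 = s3 \<or> x2 = x3 \<and> s2 = s3)"

definition is_rainbow_stable :: "'n::arith set \<Rightarrow> bool" where
  "is_rainbow_stable F \<longleftrightarrow> (\<forall>x. (\<exists>y. y \<noteq> x \<and> (\<exists>b. \<forall>s. b < s \<longrightarrow> same_col F x s y s)) \<or>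
    (\<exists>b. \<forall>s. b < s \<longrightarrow> \<not> (\<exists>y. y \<noteq> x \<and> same_col F x s y s)))"

definition is_rainbow :: "'n::arith set \<Rightarrow> 'n set \<Rightarrow> bool" where
  "is_rainbow R F \<longleftrightarrow> (\<forall>x1 s1 x2 s2. x1 \<in> R \<and> s1 \<in> R \<and> x1 < s1 \<and> x2 \<in> R \<and> s2 \<in> R \<and> x2 < s2 \<and>
    same_col F x1 s1 x2 s2 \<longrightarrow> x1 = x2 \<and> s1 = s2)"

text \<open>The numbers marked on behalf of fewer than \<open>e + 1\<close> requirements cannot exhaust the \<open>e + 1\<close> values of
  such a code. Since only values \<open>\<ge> e\<close> count, the color of \<open>y\<close> depends on the finitely many
  requirements \<open>e \<le> y\<close> alone, and hence stabilizes.\<close>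

definition seq_code :: "'n::arith \<Rightarrow> 'n \<Rightarrow> bool" where
  "seq_code r e \<longleftrightarrow> (\<forall>j\<le>e. \<exists>y<r. e \<le> y \<and> elem (pr j y) r) \<and>
    (\<forall>i<r. \<forall>j<r. \<forall>y<r. elem (pr i y) r \<and> elem (pr j y) r \<longrightarrow> i = j)"

definition val :: "'n::arith \<Rightarrow> 'n \<Rightarrow> bool" where
  "val y r \<longleftrightarrow> (\<exists>j<r. elem (pr j y) r)"

lemma elem_pr_less: "elem (pr j y) r \<Longrightarrow> j < r \<and> y < r"
  using elem_less[of "pr j y" r] le_pr[of j y] by (auto intro: le_less_trans)

lemma val_less: "val y r \<Longrightarrow> y < r"
  unfolding val_def using elem_pr_less by blast

lemma seq_code_mono: "seq_code r n \<Longrightarrow> e \<le> n \<Longrightarrow> seq_code r e"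
  unfolding seq_code_def by (meson order_trans)

context rca
begin

lemma D1_comprehension: "D1 (\<lambda>e. P (e 0)) \<Longrightarrow> {v. P v} \<in> S"
  unfolding D1_def using comprehension by blast

lemma D1_seq_code: "D1 (\<lambda>e. seq_code (e 0) (e 1))"
  unfolding seq_code_def by (intro D1_intros')

lemma D1_val: "D1 (\<lambda>e. val (e 0) (e 1))"
  unfolding val_def by (intro D1_intros')

text \<open>The sequence is lengthened one entry at a time. Entries of a code lie below the code, so
  a new member of \<open>A\<close> above \<open>r\<close> differs from all old entries and the
  sequence stays injective.\<close>

lemma unbounded_seq_code:
  assumes A: "A \<in> S" "unbounded A"
  shows "\<exists>r>c. seq_code r n \<and> (\<forall>j<r. \<forall>y<r. elem (pr j y) r \<longrightarrow> y \<in> A)"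
proof -
  let ?P = "\<lambda>k r. (\<forall>j<r. \<forall>y<r. elem (pr j y) r \<longrightarrow> y \<in> A \<and> n \<le> y \<and> j < k) \<and>
    (\<forall>j<k. \<exists>y<r. elem (pr j y) r) \<and>
    (\<forall>i<r. \<forall>j<r. \<forall>y<r. elem (pr i y) r \<and> elem (pr j y) r \<longrightarrow> i = j)"
  have codes: "\<exists>r. c < r \<and> ?P k r" for k
  proof (rule sig1_induct[where P = "\<lambda>k. \<exists>r. c < r \<and> ?P k r"])
    show "Sig1 S (\<lambda>e. \<exists>r. c < r \<and> ?P (e 0) r)"
      by (intro Sig1_ex D1_Sig1 D1_intros' A)
    obtain r where "c < r" "\<forall>z. elem z r \<longleftrightarrow> z < 0 \<and> False"
      using code_exists[of "\<lambda>_. False" c 0] D1_atom(1) by blast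
    then show "\<exists>r. c < r \<and> ?P 0 r" by auto
    fix k assume "\<exists>r. c < r \<and> ?P k r"
    then obtain r where r: "c < r" "?P k r" by blast
    obtain a where a: "max r n < a" "a \<in> A" using A(2) unfolding unbounded_def by blast
    have "D1 (\<lambda>e. elem (e 0) r \<or> e 0 = pr k a)" by (intro D1_intros')
    then obtain r' where r': "c < r'" "\<forall>z. elem z r' \<longleftrightarrow> z < max r (pr k a + 1) \<and> (elem z r \<or> z = pr k a)"
      using code_exists[of "\<lambda>z. elem z r \<or> z = pr k a" c "max r (pr k a + 1)"] by blast
    have elem': "elem (pr j y) r' \<longleftrightarrow> elem (pr j y) r \<or> j = k \<and> y = a" for j y
    proof -
      have "pr k a < max r (pr k a + 1)" by (simp add: less_max_iff_disj less_add_one)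
      moreover have "elem (pr j y) r \<Longrightarrow> pr j y < max r (pr k a + 1)"
        using elem_less[of "pr j y" r] by (simp add: less_max_iff_disj)
      ultimately show ?thesis using r'(2) pr_eq by metis
    qed
    have old: "y \<in> A \<and> n \<le> y \<and> j < k \<and> y \<noteq> a" if "elem (pr j y) r" for j y
    proof -
      have "j < r" "y < r" using elem_pr_less[OF that] by auto
      then have "y \<in> A \<and> n \<le> y \<and> j < k" using r(2) that by blast
      then show ?thesis using a(1) \<open>y < r\<close> by auto
    qed
    have inj: "i = j" if "elem (pr i y) r" "elem (pr j y) r" for i j y
    proof -
      have "i < r" "j < r" "y < r" using elem_pr_less that by blast+
      then show ?thesis using r(2) that by blast
    qed
    have "?P (k + 1) r'"
    proof (intro conjI allI impI)
      show "\<exists>y<r'. elem (pr j y) r'" if "j < k + 1" for j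
      proof -
        have "\<exists>y. elem (pr j y) r'"
        proof (cases "j = k")
          case False
          then have "j < k" using that by (simp flip: less_eq_iff_succ_less)
          then show ?thesis using r(2) unfolding elem' by blast
        qed (use elem' in blast)
        then show ?thesis using elem_pr_less by blast
      qed
      show "i = j" if "elem (pr i y) r' \<and> elem (pr j y) r'" for i j y
        using that inj old unfolding elem' by blast
      show "y \<in> A" "n \<le> y" "j < k + 1" if "elem (pr j y) r'" for j y
      proof -
        have "elem (pr j y) r \<or> j = k \<and> y = a" using that elem' by blast
        then show "y \<in> A" "n \<le> y" "j < k + 1"
          using old[of j y] a less_add_one[of k] less_trans[of j k "k + 1"] by auto
      qed
    qed
    then show "\<exists>r. c < r \<and> ?P (k + 1) r" using r'(1) by blast
  qed
  \<comment> \<open>Length \<open>n + 1\<close>, because \<open>seq_code r n\<close> asks for an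
    entry at each index from \<open>0\<close> to \<open>n\<close>.\<close>
  obtain r where "c < r \<and> ?P (n + 1) r" using codes[of "n + 1"] by (rule exE)
  note r = conjunct1[OF this] conjunct2[OF this]
  have "\<exists>y<r. n \<le> y \<and> elem (pr j y) r" if "j \<le> n" for j
  proof -
    have "j < n + 1" using that by (simp add: less_eq_iff_succ_less)
    then obtain y where y: "y < r" "elem (pr j y) r" using conjunct1[OF conjunct2[OF r(2)]] by blast
    then have "j < r" using elem_pr_less by blast
    then have "n \<le> y" using conjunct1[OF r(2)] y by blast
    then show ?thesis using y by blast
  qed
  then have "seq_code r n" using conjunct2[OF conjunct2[OF r(2)]] unfolding seq_code_def by simp
  moreover have "\<forall>j<r. \<forall>y<r. elem (pr j y) r \<longrightarrow> y \<in> A" using conjunct1[OF r(2)] by blast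
  ultimately show ?thesis using r(1) by blast
qed

end

section \<open>Current partners and requirements\<close>

locale srrt_instance = rca +
  fixes F
  assumes F: "F \<in> S" and coloring: "is_coloring F" and two_bounded: "is_two_bounded F"
    and rainbow_stable: "is_rainbow_stable F"
begin

abbreviation same where "same \<equiv> same_col F"

lemma col_less: "col F x s y \<Longrightarrow> x < s"
  using coloring unfolding is_coloring_def col_def by fastforce

lemma col_ex: "x < s \<Longrightarrow> \<exists>y. col F x s y"
  using coloring unfolding is_coloring_def by blast

lemma col_unique: "col F x s y \<Longrightarrow> col F x s z \<Longrightarrow> y = z"
  using coloring unfolding is_coloring_def by blast

text \<open>Colors exist and are unique, so two pairs fail to agree exactly if one of them is not
  increasing or they have two different colors. This is a Sigma_1 condition, like agreement
  itself.\<close>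

lemma D1_same: "D1 (\<lambda>e. same (e 0) (e 1) (e 2) (e 3))"
proof -
  have D: "trm t \<Longrightarrow> trm u \<Longrightarrow> trm v \<Longrightarrow> D1 (\<lambda>e. col F (t e) (u e) (v e))" for t u v
    unfolding col_def by (intro D1_intros' F)
  have "\<not> same x s x' s' \<longleftrightarrow> (\<exists>c c'. \<not> x < s \<or> \<not> x' < s' \<or> col F x s c \<and> col F x' s' c' \<and> c \<noteq> c')" for x s x' s'
    unfolding same_col_def using col_less col_ex col_unique by metis
  then have "Sig1 S (\<lambda>e. \<not> same (e 0) (e 1) (e 2) (e 3))"
    by (simp only:) (intro Sig1_ex D1_Sig1(1) D1_intros' D)
  moreover have "Sig1 S (\<lambda>e. same (e 0) (e 1) (e 2) (e 3))"
    unfolding same_col_def by (intro Sig1_ex D1_Sig1(1) D1_intros' D)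
  ultimately show ?thesis unfolding D1_def by blast
qed

lemma same_sym: "same x s x' s' \<Longrightarrow> same x' s' x s"
  unfolding same_col_def by blast

lemma three_same:
  assumes "same x s x1 s1" "same x s x2 s2"
  shows "x = x1 \<and> s = s1 \<or> x = x2 \<and> s = s2 \<or> x1 = x2 \<and> s1 = s2"
proof -
  obtain c where "col F x s c" "col F x1 s1 c" using assms(1) unfolding same_col_def by blast
  moreover have "col F x2 s2 c" using assms(2) calculation(1) col_unique unfolding same_col_def by blast
  ultimately show ?thesis using two_bounded unfolding is_two_bounded_def by blast
qed

lemma partner_unique: "same x s y s \<Longrightarrow> same x s z s \<Longrightarrow> y \<noteq> x \<Longrightarrow> z \<noteq> x \<Longrightarrow> y = z"
  using three_same[of x s y s z s] by blast

text \<open>At stage \<open>s\<close>, requirement \<open>e = (x, i)\<close> looks at the current partner \<open>r\<close> of \<open>x\<close>. If \<open>r\<close> codes a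
  sequence of more than \<open>e\<close> numbers that are at least \<open>e\<close>, it marks the least of them which no
  requirement \<open>e' < e\<close> has marked, in order that this number gets color \<open>i\<close>.\<close>

definition marks :: "('a \<Rightarrow> 'a \<Rightarrow> bool) \<Rightarrow> 'a \<Rightarrow> 'a \<Rightarrow> 'a \<Rightarrow> bool" where
  "marks W s e y \<longleftrightarrow> e \<le> y \<and> (\<exists>x\<le>e. \<exists>i\<le>e. e = pr x i \<and> (\<exists>r<s. r \<noteq> x \<and> same x s r s \<and> seq_code r e \<and>
    val y r \<and> (\<forall>e'<e. \<not> W e' y) \<and> (\<forall>y'<y. val y' r \<and> e \<le> y' \<longrightarrow> (\<exists>e'<e. W e' y'))))"

text \<open>Each stage \<open>s\<close> computes its marks from scratch, by recursion on the
  requirement and without reference to earlier stages. The recursion is legitimate because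
  \<open>marks\<close> consults only smaller requirements, and of these only the marks on numbers up
  to \<open>y\<close>.\<close>

lemma marking_exists:
  "\<exists>T. D1 (\<lambda>e. T (e 0) (e 1) (e 2)) \<and> (\<forall>s e y. T s e y \<longleftrightarrow> y < s \<and> marks (T s) s e y)"
proof -
  let ?G = "\<lambda>s w e y. marks (\<lambda>e' y'. elem (pr e' y') w) s e y"
  have G: "D1 (\<lambda>e. ?G (e 0) (e 1) (e 2) (e 3))"
    unfolding marks_def
    by (intro D1_intros' D1_app4[OF D1_same] D1_app2[OF D1_seq_code] D1_app2[OF D1_val])
  have local: "marks W s e y \<longleftrightarrow> marks W' s e y"
    if "\<And>e' y'. e' < e \<Longrightarrow> y' < s \<Longrightarrow> W e' y' \<longleftrightarrow> W' e' y'" "y < s" for W W' s e y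
  proof -
    have "W e' y' \<longleftrightarrow> W' e' y'" if "e' < e" "y' \<le> y" for e' y'
      using that \<open>y < s\<close> by (intro \<open>\<And>e' y'. _ \<Longrightarrow> _ \<Longrightarrow> W e' y' \<longleftrightarrow> W' e' y'\<close>) auto
    then show ?thesis unfolding marks_def by (smt (verit, ccfv_threshold) order_less_imp_le order_refl)
  qed
  obtain T where T: "D1 (\<lambda>e. T (e 0) (e 1) (e 2))" "\<forall>p e. \<exists>w.
    (\<forall>e'<e. \<forall>y'<p. elem (pr e' y') w \<longleftrightarrow> T p e' y') \<and> (\<forall>y. T p e y \<longleftrightarrow> y < p \<and> ?G p w e y)"
    using recursion[of ?G, OF G local] by blast
  have "T s e y \<longleftrightarrow> y < s \<and> marks (T s) s e y" for s e y
  proof -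
    obtain w where w: "\<forall>e'<e. \<forall>y'<s. elem (pr e' y') w \<longleftrightarrow> T s e' y'" "T s e y \<longleftrightarrow> y < s \<and> ?G s w e y"
      using T(2) by blast
    show ?thesis using local[of e s "\<lambda>e' y'. elem (pr e' y') w" "T s" y] w by blast
  qed
  then show ?thesis using T(1) by blast
qed

end

section \<open>The stable coloring and the rainbow\<close>

locale marking = srrt_instance +
  fixes T
  assumes D1_T: "D1 (\<lambda>e. T (e 0) (e 1) (e 2))"
    and T_iff: "T s e y \<longleftrightarrow> y < s \<and> marks (T s) s e y"
begin

lemma T_requirement_unique: "T s e y \<Longrightarrow> T s e' y \<Longrightarrow> e = e'"
  using T_iff[of s e y] T_iff[of s e' y] unfolding marks_def by (metis linorder_cases)

text \<open>At a given stage the requirement determines \<open>x\<close>, which determines its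
  partner by 2-boundedness; and the marked number is the least one available.\<close>

lemma T_functional: "T s e y \<Longrightarrow> T s e y' \<Longrightarrow> y = y'"
proof (rule ccontr)
  have *: False if T: "T s e y" "T s e y'" and "y < y'" for y y'
  proof -
    obtain x i r where 1: "e = pr x i" "r \<noteq> x" "same x s r s" "val y r" "e \<le> y" "\<forall>e'<e. \<not> T s e' y"
      using T(1) unfolding T_iff[of s e y] marks_def by blast
    obtain x' i' r' where 2: "e = pr x' i'" "r' \<noteq> x'" "same x' s r' s"
      "\<forall>z<y'. val z r' \<and> e \<le> z \<longrightarrow> (\<exists>e'<e. T s e' z)"
      using T(2) unfolding T_iff[of s e y'] marks_def by blast
    have "x' = x" using 1(1) 2(1) by simp
    then have "r' = r" using partner_unique 1 2 by blast
    then show False using 1 2 \<open>y < y'\<close> by blast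
  qed
  assume "T s e y" "T s e y'" "y \<noteq> y'"
  then show False using *[of y y'] *[of y' y] by (metis linorder_cases)
qed

text \<open>This is the only place where \<open>\<Sigma>\<^sub>2\<close> induction is used beyond collection.\<close>

lemma marks_settle: "\<exists>b. \<forall>s>b. \<forall>e<n. \<forall>y<s. T s e y \<longleftrightarrow> T (b + 1) e y"
proof (rule sig2_induct[where P = "\<lambda>n. \<exists>b. \<forall>s>b. \<forall>e<n. \<forall>y<s. T s e y \<longleftrightarrow> T (b + 1) e y"])
  have "Sig1 S (\<lambda>e. \<exists>s. e 0 < s \<and> \<not> (\<forall>i<e (Suc 0). \<forall>y<s. T s i y \<longleftrightarrow> T (e 0 + 1) i y))"
    by (intro Sig1_ex D1_Sig1(1) D1_intros' D1_app3[OF D1_T])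
  then show "Sig2 S (\<lambda>e. \<exists>b. \<forall>s>b. \<forall>i<e 0. \<forall>y<s. T s i y \<longleftrightarrow> T (b + 1) i y)"
    by (intro Sig2_exI) simp
  fix n assume "\<exists>b. \<forall>s>b. \<forall>e<n. \<forall>y<s. T s e y \<longleftrightarrow> T (b + 1) e y"
  then obtain b where b: "\<forall>s>b. \<forall>e<n. \<forall>y<s. T s e y \<longleftrightarrow> T (b + 1) e y" by blast
  have IH: "T s e y \<longleftrightarrow> T (b + 1) e y" if "b < s" "e < n" for s e y
  proof (cases "y < s")
    case False
    then have "\<not> y < b + 1" using that(1) by (metis less_iff_succ_less_eq order_less_le_trans)
    then show ?thesis using False T_iff by blast
  qed (use b that in blast)
  \<comment> \<open>It remains to find the limit \<open>\<Phi>\<close> of row \<open>n\<close>.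
    Either \<open>n\<close> is not a pair, or its \<open>x\<close> is eventually without a partner,
    or \<open>x\<close> has a permanent partner \<open>r\<close> and the row depends only on
    \<open>r\<close> and the settled rows below.\<close>
  obtain c \<Phi> where c: "b \<le> c" and \<Phi>: "\<And>s y. c < s \<Longrightarrow> T s n y \<longleftrightarrow> \<Phi> y"
  proof (cases "\<exists>x i. n = pr x i")
    case False
    then have "T s n y \<longleftrightarrow> False" for s y unfolding T_iff[of s n y] marks_def by blast
    then show thesis using that[of b "\<lambda>_. False"] by blast
  next
    case True
    then obtain x i where n: "n = pr x i" by blast
    show thesis
    proof (cases "\<exists>c. \<forall>s. c < s \<longrightarrow> \<not> (\<exists>y. y \<noteq> x \<and> same x s y s)")
      case True
      then obtain c where "\<forall>s. c < s \<longrightarrow> \<not> (\<exists>y. y \<noteq> x \<and> same x s y s)" by blast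
      then have "T s n y \<longleftrightarrow> False" if "max b c < s" for s y
        using that n unfolding T_iff[of s n y] marks_def by auto
      then show thesis using that[of "max b c" "\<lambda>_. False"] by auto
    next
      case False
      then obtain r c where r: "r \<noteq> x" "\<forall>s. c < s \<longrightarrow> same x s r s"
        using rainbow_stable unfolding is_rainbow_stable_def by blast
      let ?\<Phi> = "\<lambda>y. n \<le> y \<and> seq_code r n \<and> val y r \<and> (\<forall>e'<n. \<not> T (b + 1) e' y) \<and>
        (\<forall>y'<y. val y' r \<and> n \<le> y' \<longrightarrow> (\<exists>e'<n. T (b + 1) e' y'))"
      \<comment> \<open>The stage also has to pass \<open>r\<close> itself, as only partners below
        the stage are inspected.\<close>
      have "T s n y \<longleftrightarrow> ?\<Phi> y" if s: "max b (max c r) < s" for s y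
      proof -
        have sr: "same x s r s" "r < s" "b < s" using s r by auto
        have "marks (T s) s n y \<longleftrightarrow> n \<le> y \<and> seq_code r n \<and> val y r \<and> (\<forall>e'<n. \<not> T s e' y) \<and>
          (\<forall>y'<y. val y' r \<and> n \<le> y' \<longrightarrow> (\<exists>e'<n. T s e' y'))" (is "?l \<longleftrightarrow> ?r")
        proof
          assume ?l
          then obtain x' i' r' where *: "n = pr x' i'" "r' \<noteq> x'" "same x' s r' s" "n \<le> y" "seq_code r' n"
            "val y r'" "\<forall>e'<n. \<not> T s e' y" "\<forall>y'<y. val y' r' \<and> n \<le> y' \<longrightarrow> (\<exists>e'<n. T s e' y')"
            unfolding marks_def by blast
          have "x' = x" using *(1) n by simp
          then have "r' = r" using partner_unique * r(1) sr(1) by blast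
          then show ?r using * by blast
        next
          assume ?r
          then show ?l unfolding marks_def using n r(1) sr le_pr[of x i] by blast
        qed
        also have "\<dots> \<longleftrightarrow> ?\<Phi> y"
        proof -
          have 1: "(\<exists>e'<n. T s e' y') \<longleftrightarrow> (\<exists>e'<n. T (b + 1) e' y')" for y' using IH[OF sr(3)] by blast
          have 2: "(\<forall>e'<n. \<not> T s e' y) \<longleftrightarrow> (\<forall>e'<n. \<not> T (b + 1) e' y)" using IH[OF sr(3)] by blast
          show ?thesis unfolding 1 2 ..
        qed
        finally show ?thesis using T_iff[of s n y] val_less[of y r] sr(2) by (auto intro: less_trans)
      qed
      then show thesis using that[of "max b (max c r)" ?\<Phi>] by simp
    qed
  qed
  have "T s e y \<longleftrightarrow> T (c + 1) e y" if "c < s" "e < n + 1" for s e y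
  proof (cases "e = n")
    case True
    then show ?thesis using \<Phi>[OF that(1)] \<Phi>[OF less_add_one] by simp
  next
    case False
    then have "e < n" using that(2) by (simp flip: less_eq_iff_succ_less)
    moreover have "b < s" "b < c + 1" using c that(1) by (auto intro: le_less_trans less_add_one)
    ultimately show ?thesis using IH by blast
  qed
  then show "\<exists>b. \<forall>s>b. \<forall>e<n + 1. \<forall>y<s. T s e y \<longleftrightarrow> T (b + 1) e y" by blast
qed simp

text \<open>The color is the second component of the requirement that marks \<open>y\<close>; an
  unmarked number gets the default color \<open>0\<close>. A requirement marks only numbers at least
  as large as itself, so the search for it is bounded by \<open>y\<close>.\<close>

definition mark_col :: "'a \<Rightarrow> 'a \<Rightarrow> 'a \<Rightarrow> bool" where
  "mark_col y s i \<longleftrightarrow> y < s \<and> ((\<exists>e\<le>y. \<exists>x\<le>e. e = pr x i \<and> T s e y) \<or> i = 0 \<and> (\<forall>e\<le>y. \<not> T s e y))"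

definition mark_coloring :: "'a set" where
  "mark_coloring = {v. \<exists>y\<le>v. \<exists>s\<le>v. \<exists>i\<le>v. v = pr (pr y s) i \<and> mark_col y s i}"

lemma mark_coloring_in: "mark_coloring \<in> S"
proof -
  have D1_mark_col: "D1 (\<lambda>e. mark_col (e 0) (e 1) (e 2))"
    unfolding mark_col_def by (intro D1_intros' D1_app3[OF D1_T])
  have "D1 (\<lambda>e. \<exists>y\<le>e 0. \<exists>s\<le>e 0. \<exists>i\<le>e 0. e 0 = pr (pr y s) i \<and> mark_col y s i)"
    by (intro D1_intros' D1_app3[OF D1_mark_col])
  then show ?thesis unfolding mark_coloring_def by (rule D1_comprehension)
qed

lemma col_mark_coloring: "col mark_coloring y s i \<longleftrightarrow> mark_col y s i"
proof -
  let ?v = "pr (pr y s) i"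
  have "y \<le> ?v" "s \<le> ?v" "i \<le> ?v"
    using le_pr[of y s] le_pr[of "pr y s" i] order_trans[of _ "pr y s" ?v] by blast+
  then show ?thesis unfolding col_def mark_coloring_def mem_Collect_eq pr_eq by blast
qed

lemma mark_coloring: "is_coloring mark_coloring"
  unfolding is_coloring_def col_mark_coloring
proof (intro conjI allI impI)
  fix n assume "n \<in> mark_coloring"
  then show "\<exists>x s y. x < s \<and> n = pr (pr x s) y"
    unfolding mark_coloring_def mark_col_def by blast
next
  fix y s :: 'a assume "y < s"
  show "\<exists>i. mark_col y s i"
  proof (cases "\<exists>e\<le>y. T s e y")
    case True
    then obtain e where e: "e \<le> y" "T s e y" by blast
    then obtain x i where "x \<le> e" "e = pr x i" unfolding T_iff[of s e y] marks_def by blast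
    then show ?thesis using e \<open>y < s\<close> unfolding mark_col_def by blast
  next
    case False
    then show ?thesis using \<open>y < s\<close> unfolding mark_col_def by blast
  qed
next
  fix y s i i' assume "mark_col y s i \<and> mark_col y s i'"
  then show "i = i'" unfolding mark_col_def using T_requirement_unique by (metis pr_eq)
qed

lemma mark_coloring_stable: "is_stable mark_coloring"
  unfolding is_stable_def col_mark_coloring
proof
  fix y
  obtain b where b: "\<forall>s>b. \<forall>e<y + 1. \<forall>z<s. T s e z \<longleftrightarrow> T (b + 1) e z"
    using marks_settle by blast
  let ?c = "max b y"
  have T: "T s e y \<longleftrightarrow> T (b + 1) e y" if "?c < s" "e \<le> y" for s e
    using b that by (simp add: less_eq_iff_succ_less)
  have "y < ?c + 1" by (simp flip: less_eq_iff_succ_less)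
  then obtain i where "mark_col y (?c + 1) i"
    using mark_coloring unfolding is_coloring_def col_mark_coloring by blast
  then have "mark_col y s i" if "?c < s" for s
    using T[of s] T[of "?c + 1"] that less_add_one[of ?c] unfolding mark_col_def by auto
  then show "\<exists>i b. \<forall>s. b < s \<and> y < s \<longrightarrow> mark_col y s i" by blast
qed

text \<open>Put \<open>e = pr x i\<close> and take a late stage \<open>s\<close> in
  \<open>A\<close>. If some value of \<open>r\<close> that is at least \<open>e\<close> were free of
  marks by requirements below \<open>e\<close>, then \<open>e\<close> would mark the least such
  value and give it color \<open>i\<close> at stage \<open>s\<close>, though both numbers lie in
  \<open>A\<close>. So the \<open>e + 1\<close> values are all marked by the \<open>e\<close>
  smaller requirements, each of which marks only one number: this contradicts the pigeonhole
  principle.\<close>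

lemma thin_no_partner:
  assumes A: "unbounded A" and thin: "\<And>x s. x \<in> A \<Longrightarrow> s \<in> A \<Longrightarrow> x < s \<Longrightarrow> \<not> mark_col x s i"
    and r: "r \<noteq> x" "seq_code r (pr x i)" "\<And>y. val y r \<Longrightarrow> y \<in> A"
    and partner: "\<forall>s>b. same x s r s"
  shows False
proof -
  let ?e = "pr x i"
  \<comment> \<open>The stage itself is taken from \<open>A\<close>, so that colors of values of
    \<open>r\<close> at this stage count for thinness.\<close>
  obtain s where s: "max b r < s" "s \<in> A" using A unfolding unbounded_def by blast
  have taken: "\<exists>e'<?e. T s e' y" if y: "val y r" "?e \<le> y" for y
  proof (rule ccontr)
    let ?P = "\<lambda>y. val y r \<and> ?e \<le> y \<and> (\<forall>e'<?e. \<not> T s e' y)"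
    assume "\<not> (\<exists>e'<?e. T s e' y)"
    then have "?P y" using y by blast
    moreover have "D1 (\<lambda>e. ?P (e 0))" by (intro D1_intros' D1_app3[OF D1_T] D1_app2[OF D1_val])
    ultimately obtain z where z: "?P z" "\<forall>u<z. \<not> ?P u" using D1_least[of ?P] by blast
    then have "marks (T s) s ?e z"
      unfolding marks_def using r(1,2) partner s(1) le_pr[of x i] by auto
    moreover have "z < s" using val_less[of z r] z(1) s(1) by auto
    ultimately have "mark_col z s i"
      using T_iff[of s ?e z] z(1) le_pr[of x i] unfolding mark_col_def by blast
    then show False using thin[of z s] r(3)[of z] z(1) s(2) \<open>z < s\<close> by blast
  qed
  let ?J = "\<lambda>j e'. \<exists>y<r. ?e \<le> y \<and> elem (pr j y) r \<and> T s e' y"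
  show False
  proof (rule pigeonhole[of ?J ?e])
    show "D1 (\<lambda>e. ?J (e 0) (e 1))" by (intro D1_intros' D1_app3[OF D1_T])
    show "\<exists>k<?e. ?J j k" if j: "j \<le> ?e" for j
    proof -
      obtain y where y: "y < r" "?e \<le> y" "elem (pr j y) r" using r(2) j unfolding seq_code_def by blast
      then have "val y r" unfolding val_def using elem_pr_less by blast
      then show ?thesis using taken[of y] y by blast
    qed
    show "j = j'" if J: "?J j k" "?J j' k" for j j' k
    proof -
      obtain y where y: "elem (pr j y) r" "T s k y" using J(1) by blast
      obtain y' where y': "elem (pr j' y') r" "T s k y'" using J(2) by blast
      have "y' = y" using T_functional y(2) y'(2) by blast
      then show ?thesis using r(2) y(1) y'(1) elem_pr_less unfolding seq_code_def by blast
    qed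
  qed
qed

text \<open>Membership of \<open>x\<close> in \<open>R\<close> is decided from the smaller members.
  Were \<open>R\<close> bounded, two distinct members would eventually have different colors at
  every stage, and no late pair would repeat a color used inside \<open>R\<close>; a long code from
  \<open>A\<close> beyond these bounds would then have to enter \<open>R\<close>.\<close>

lemma rainbow_exists:
  assumes A: "A \<in> S" "unbounded A" "is_thin A mark_coloring"
  shows "\<exists>R\<in>S. unbounded R \<and> is_rainbow R F"
proof -
  obtain i where thin: "\<And>x s. x \<in> A \<Longrightarrow> s \<in> A \<Longrightarrow> x < s \<Longrightarrow> \<not> mark_col x s i"
    using A(3) unfolding is_thin_def col_mark_coloring by blast
  \<comment> \<open>The predicate \<open>Q\<close> stands for the earlier members. The first two
    conditions make \<open>x\<close> a code from \<open>A\<close> that is long relative to each of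
    them, in order to exclude partners. The last two forbid clashes between two pairs ending in
    \<open>x\<close>, and between such a pair and an earlier one.\<close>
  define ext where "ext Q x \<longleftrightarrow> (\<forall>j<x. \<forall>y<x. elem (pr j y) x \<longrightarrow> y \<in> A) \<and>
    (\<forall>u<x. Q u \<longrightarrow> seq_code x (pr u i)) \<and>
    (\<forall>u<x. \<forall>v<x. Q u \<and> Q v \<and> u \<noteq> v \<longrightarrow> \<not> same u x v x) \<and>
    (\<forall>u<x. \<forall>a<x. \<forall>b<x. Q u \<and> Q a \<and> Q b \<longrightarrow> \<not> same u x a b)" for Q x
  \<comment> \<open>The recursion yields tables, but a set needs a single column: hence
    \<open>p = 1\<close> and the entry \<open>0\<close> below.\<close>
  let ?G = "\<lambda>(p::'a) w x (y::'a). ext (\<lambda>u. elem (pr u 0) w) x"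
  have G: "D1 (\<lambda>e. ?G (e 0) (e 1) (e 2) (e 3))"
    unfolding ext_def by (intro D1_intros' D1_app4[OF D1_same] D1_app2[OF D1_seq_code] A(1))
  have ext_cong: "ext Q x \<longleftrightarrow> ext Q' x" if "\<And>u. u < x \<Longrightarrow> Q u \<longleftrightarrow> Q' u" for Q Q' x
    using that unfolding ext_def by (auto 0 0)
  have local: "?G p w x y \<longleftrightarrow> ?G p w' x y"
    if "y < p" "\<And>u y'. u < x \<Longrightarrow> y' < p \<Longrightarrow> elem (pr u y') w \<longleftrightarrow> elem (pr u y') w'" for p w w' x y
    using that(2)[of _ 0] le_less_trans[OF zero_le that(1)] by (intro ext_cong) blast
  have "\<exists>T'. D1 (\<lambda>e. T' (e 0) (e 1) (e 2)) \<and> (\<forall>p x. \<exists>w.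
    (\<forall>u<x. \<forall>y'<p. elem (pr u y') w \<longleftrightarrow> T' p u y') \<and> (\<forall>y. T' p x y \<longleftrightarrow> y < p \<and> ?G p w x y))"
    by (rule recursion[where G = ?G, OF G]) (rule local)
  then obtain T' where T': "D1 (\<lambda>e. T' (e 0) (e 1) (e 2))" "\<forall>p x. \<exists>w.
    (\<forall>u<x. \<forall>y'<p. elem (pr u y') w \<longleftrightarrow> T' p u y') \<and> (\<forall>y. T' p x y \<longleftrightarrow> y < p \<and> ?G p w x y)"
    by blast
  define R where "R = {x. T' 1 x 0}"
  have "D1 (\<lambda>e. T' 1 (e 0) 0)" by (intro D1_app3[OF T'(1)] trm_intros)
  then have R_in: "R \<in> S" unfolding R_def by (rule D1_comprehension)
  have R: "x \<in> R \<longleftrightarrow> ext (\<lambda>u. u \<in> R) x" for x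
  proof -
    obtain w where w: "\<forall>u<x. \<forall>y'<1. elem (pr u y') w \<longleftrightarrow> T' 1 u y'" "\<forall>y. T' 1 x y \<longleftrightarrow> y < 1 \<and> ?G 1 w x y"
      using T'(2) by blast
    have "x \<in> R \<longleftrightarrow> ?G 1 w x 0" using w(2) by (simp add: R_def)
    also have "\<dots> \<longleftrightarrow> ext (\<lambda>u. u \<in> R) x" using w(1) by (intro ext_cong) (simp add: R_def)
    finally show ?thesis .
  qed
  have "is_rainbow R F"
    unfolding is_rainbow_def
  proof (intro allI impI)
    fix x1 s1 x2 s2
    assume *: "x1 \<in> R \<and> s1 \<in> R \<and> x1 < s1 \<and> x2 \<in> R \<and> s2 \<in> R \<and> x2 < s2 \<and> same x1 s1 x2 s2"
    have "\<not> same u x a b" if "x \<in> R" "u \<in> R" "a \<in> R" "b \<in> R" "u < x" "a < x" "b < x" for u x a b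
      using that R[of x] unfolding ext_def by blast
    then have "s1 = s2" using * same_sym by (metis less_trans linorder_cases)
    moreover have "\<not> same u x v x" if "x \<in> R" "u \<in> R" "v \<in> R" "u < x" "v < x" "u \<noteq> v" for u x v
      using that R[of x] unfolding ext_def by blast
    ultimately show "x1 = x2 \<and> s1 = s2" using * by blast
  qed
  moreover have "unbounded R"
  proof (rule ccontr)
    assume "\<not> unbounded R"
    then obtain B where "\<And>x. x \<in> R \<Longrightarrow> x \<le> B" unfolding unbounded_def by (auto simp: not_less)
    then have B: "x < B + 1" if "x \<in> R" for x using that by (simp add: less_eq_iff_succ_less)
    \<comment> \<open>The later of two members is a long code from \<open>A\<close>, so it cannot be
      the lasting partner of the earlier one.\<close>
    have no_partner: "\<not> (\<forall>s>b. same u s v s)" if "u \<in> R" "v \<in> R" "u < v" for u v b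
    proof
      assume "\<forall>s>b. same u s v s"
      moreover have ext_v: "ext (\<lambda>u. u \<in> R) v" using R that(2) by blast
      moreover have "seq_code v (pr u i)" using ext_v that unfolding ext_def by blast
      moreover have "y \<in> A" if "val y v" for y
      proof -
        obtain j where "elem (pr j y) v" using \<open>val y v\<close> unfolding val_def by blast
        then show ?thesis using ext_v elem_pr_less[of j y v] unfolding ext_def by blast
      qed
      ultimately show False using thin_no_partner[OF A(2) thin, of v u b] that(3) by blast
    qed
    \<comment> \<open>A lasting partner of \<open>u\<close> is not \<open>v\<close>: this is
      \<open>no_partner\<close>, read in whichever order the two numbers come. Uniqueness of the
      partner then separates \<open>u\<close> from \<open>v\<close>.\<close>
    have differ: "\<exists>b. \<forall>s>b. \<not> same u s v s" if uv: "u \<in> R" "v \<in> R" "u \<noteq> v" for u v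
    proof (cases "\<exists>b. \<forall>s. b < s \<longrightarrow> \<not> (\<exists>y. y \<noteq> u \<and> same u s y s)")
      case True
      then show ?thesis using uv(3) by metis
    next
      case False
      then obtain r b where r: "r \<noteq> u" "\<forall>s>b. same u s r s"
        using rainbow_stable unfolding is_rainbow_stable_def by blast
      have "r \<noteq> v"
        using no_partner[of u v b] no_partner[of v u b] uv r(2) same_sym by (metis linorder_cases)
      then show ?thesis using r partner_unique uv(3) by metis
    qed
    \<comment> \<open>Pairs are coded by one number \<open>z\<close>, so that
      \<open>Pi1_bound\<close> treats all pairs from \<open>R\<close> at once; \<open>?N\<close>
      exceeds all their codes.\<close>
    let ?Q1 = "\<lambda>s z. \<forall>u\<le>z. \<forall>v\<le>z. z = pr u v \<and> u \<in> R \<and> v \<in> R \<and> u \<noteq> v \<longrightarrow> \<not> same u s v s"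
    let ?Q2 = "\<lambda>s z. \<forall>a\<le>z. \<forall>b\<le>z. z = pr a b \<longrightarrow> (\<forall>u<s. \<not> same u s a b)"
    let ?N = "pr (B + 1) (B + 1) + 1"
    have "\<exists>b. \<forall>s>b. ?Q1 s z" for z
    proof (cases "\<exists>u v. z = pr u v \<and> u \<in> R \<and> v \<in> R \<and> u \<noteq> v")
      case True
      then obtain u v where uv: "z = pr u v" "u \<in> R" "v \<in> R" "u \<noteq> v" by blast
      then obtain b where "\<forall>s>b. \<not> same u s v s" using differ by blast
      then show ?thesis using uv(1) by (intro exI[of _ b]) auto
    qed blast
    moreover have "D1 (\<lambda>e. ?Q1 (e 0) (e 1))" by (intro D1_intros' D1_app4[OF D1_same] R_in)
    ultimately obtain b1 where b1: "\<forall>z<?N. \<forall>s>b1. ?Q1 s z" using Pi1_bound[of ?Q1 ?N] by blast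
    \<comment> \<open>At most two pairs share a color. If a pair ending at \<open>s0 > b\<close> has
      the color of \<open>(a, b)\<close>, then a pair ending beyond \<open>s0\<close> would be a
      third one.\<close>
    have "\<exists>c. \<forall>s>c. \<forall>u<s. \<not> same u s a b" for a b
    proof (cases "\<exists>u0 s0. b < s0 \<and> same u0 s0 a b")
      case True
      then obtain u0 s0 where *: "b < s0" "same u0 s0 a b" by blast
      have "\<not> same u s a b" if "s0 < s" for u s
      proof
        assume "same u s a b"
        then show False
          using three_same[OF same_sym same_sym, of u0 s0 a b u s] * that by auto
      qed
      then show ?thesis by blast
    qed blast
    then have eventually_new: "\<exists>c. \<forall>s>c. \<forall>u<s. \<not> same u s a b" for a b .
    have "\<exists>c. \<forall>s>c. ?Q2 s z" for z
    proof (cases "\<exists>a b. z = pr a b")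
      case True
      then obtain a b c where "z = pr a b" "\<forall>s>c. \<forall>u<s. \<not> same u s a b" using eventually_new by blast
      then show ?thesis by (intro exI[of _ c]) simp
    qed blast
    moreover have "D1 (\<lambda>e. ?Q2 (e 0) (e 1))" by (intro D1_intros' D1_app4[OF D1_same])
    ultimately obtain b2 where b2: "\<forall>z<?N. \<forall>s>b2. ?Q2 s z" using Pi1_bound[of ?Q2 ?N] by blast
    \<comment> \<open>The length \<open>pr (B + 1) i\<close> covers the length \<open>pr u i\<close>
      demanded for every \<open>u \<in> R\<close>, as these lie below \<open>B + 1\<close>.\<close>
    obtain x where x: "max (max b1 b2) (B + 1) < x" "seq_code x (pr (B + 1) i)"
      "\<forall>j<x. \<forall>y<x. elem (pr j y) x \<longrightarrow> y \<in> A"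
      using unbounded_seq_code[OF A(1,2)] by blast
    have N: "pr u v < ?N" if "u \<in> R" "v \<in> R" for u v
      using pr_mono[OF less_imp_le[OF B[OF that(1)]] less_imp_le[OF B[OF that(2)]]]
      by (simp flip: less_eq_iff_succ_less)
    have "ext (\<lambda>u. u \<in> R) x"
      unfolding ext_def
    proof (intro conjI allI impI)
      show "seq_code x (pr u i)" if "u \<in> R" for u
        using seq_code_mono[OF x(2)] pr_mono[of u "B + 1" i i] B[OF that] by simp
      show "\<not> same u x v x" if "u \<in> R \<and> v \<in> R \<and> u \<noteq> v" for u v
        using b1[rule_format, OF N[of u v], of x u v] that x(1) le_pr[of u v] by auto
      show "\<not> same u x a b" if "u < x" "u \<in> R \<and> a \<in> R \<and> b \<in> R" for u a b
        using b2[rule_format, OF N[of a b], of x a b u] that x(1) le_pr[of a b] by auto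
      show "y \<in> A" if "j < x" "y < x" "elem (pr j y) x" for j y using x(3) that by blast
    qed
    then have "x < B + 1" using R B by blast
    then show False using x(1) by auto
  qed
  ultimately show ?thesis using R_in by blast
qed

end

theorem (in rca) srrt:
  assumes sts: "\<And>G. G \<in> S \<Longrightarrow> is_coloring G \<Longrightarrow> is_stable G \<Longrightarrow> \<exists>A\<in>S. unbounded A \<and> is_thin A G"
    and "F \<in> S" "is_coloring F" "is_two_bounded F" "is_rainbow_stable F"
  shows "\<exists>R\<in>S. unbounded R \<and> is_rainbow R F"
proof -
  interpret srrt_instance S F by unfold_locales (fact assms(2-5))+
  obtain T where "D1 (\<lambda>e. T (e 0) (e 1) (e 2))" "\<forall>s e y. T s e y \<longleftrightarrow> y < s \<and> marks (T s) s e y"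
    using marking_exists by blast
  then interpret marking S F T by unfold_locales auto
  show ?thesis
    using sts[OF mark_coloring_in mark_coloring mark_coloring_stable] rainbow_exists by blast
qed

section \<open>The theorem\<close>

locale arith_countable_struct = countable_struct M for M :: "'n::{arith,countable} struct"
begin

lemma eval_pair: "eval_tm M \<rho> (pair t u) = pr (eval_tm M \<rho> t) (eval_tm M \<rho> u)"
  by (simp add: pair_def pr_def ops)

lemma sat_color: "sat M \<rho> E (color F x s y) \<longleftrightarrow> col (E F) (eval_tm M \<rho> x) (eval_tm M \<rho> s) (eval_tm M \<rho> y)"
  by (simp add: color_def col_def eval_pair)

lemma sat_same_color:
  assumes "x \<noteq> ''c''" "s \<noteq> ''c''" "x' \<noteq> ''c''" "s' \<noteq> ''c''"
  shows "sat M \<rho> E (same_color F (NVar x) (NVar s) (NVar x') (NVar s')) \<longleftrightarrow>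
    same_col (E F) (\<rho> x) (\<rho> s) (\<rho> x') (\<rho> s')"
  using assms by (simp add: same_color_def same_col_def sat_color)

lemma sat_coloring: "sat M \<rho> E (coloring F) \<longleftrightarrow> is_coloring (E F)"
  by (simp add: coloring_def is_coloring_def Let_def sat_color eval_pair ops)

lemma sat_stable: "sat M \<rho> E (stable F) \<longleftrightarrow> is_stable (E F)"
  by (simp add: stable_def is_stable_def Let_def sat_color ops)

lemma sat_infinite_set: "sat M \<rho> E (infinite_set A) \<longleftrightarrow> unbounded (E A)"
  by (simp add: infinite_set_def unbounded_def ops)

lemma sat_thin: "sat M \<rho> E (thin A F) \<longleftrightarrow> is_thin (E A) (E F)"
  by (simp add: thin_def is_thin_def Let_def sat_color ops)

lemma sat_two_bounded: "sat M \<rho> E (two_bounded F) \<longleftrightarrow> is_two_bounded (E F)"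
  by (simp add: two_bounded_def is_two_bounded_def Let_def sat_color ops)

lemma sat_rainbow_stable: "sat M \<rho> E (rainbow_stable F) \<longleftrightarrow> is_rainbow_stable (E F)"
  by (simp add: rainbow_stable_def is_rainbow_stable_def Let_def sat_same_color ops)

lemma sat_rainbow: "sat M \<rho> E (rainbow R F) \<longleftrightarrow> is_rainbow (E R) (E F)"
  by (simp add: rainbow_def is_rainbow_def Let_def sat_same_color ops)

lemmas sat_colorings = sat_coloring sat_stable sat_infinite_set sat_thin sat_two_bounded
  sat_rainbow_stable sat_rainbow

lemma sat_STS2: "sat M \<rho> E STS2 \<longleftrightarrow>
    (\<forall>G\<in>sets_of M. is_coloring G \<and> is_stable G \<longrightarrow> (\<exists>A\<in>sets_of M. unbounded A \<and> is_thin A G))"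
  by (simp add: STS2_def sat_colorings)

lemma sat_SRRT22: "sat M \<rho> E SRRT22 \<longleftrightarrow>
    (\<forall>F\<in>sets_of M. is_coloring F \<and> is_rainbow_stable F \<and> is_two_bounded F \<longrightarrow>
      (\<exists>R\<in>sets_of M. unbounded R \<and> is_rainbow R F))"
  by (simp add: SRRT22_def sat_colorings)

end

lemma sentence_goal: "sentence (\<^bold>\<not> (STS2 \<^bold>\<longrightarrow> SRRT22))"
  unfolding sentence_def STS2_def SRRT22_def Neg_def Or_def And_def ExN_def ExS_def coloring_def stable_def
    infinite_set_def thin_def two_bounded_def rainbow_stable_def rainbow_def same_color_def color_def
    pair_def Let_def
  by (simp add: insert_Diff_if)

text \<open>If there is a counter model, then \<open>the_model\<close> is one, and its operations
  are by definition the arithmetic of \<open>hnum\<close>. The axioms turn its sets into an instance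
  of \<open>rca\<close>, where the implication has been proved semantically.\<close>

lemma no_counter_model: "\<not> counter_model M"
proof
  assume M: "counter_model M"
  then have model: "\<forall>\<phi>\<in>insert (\<^bold>\<not> (STS2 \<^bold>\<longrightarrow> SRRT22)) (RCA0 \<union> ISigma 2). \<forall>\<rho> E. sat the_model \<rho> E \<phi>"
    using the_model unfolding counter_model_def by blast
  interpret arith_struct the_model using M by (rule counter_model_struct)
  interpret arith_countable_struct the_model ..
  have ax: "\<forall>\<psi>\<in>ISigma 2. \<forall>\<rho> E. sat the_model \<rho> E \<psi>" "\<forall>\<psi>\<in>Delta1_CA. \<forall>\<rho> E. sat the_model \<rho> E \<psi>"
    using model by (simp_all add: RCA0_def ball_Un)
  interpret rca "sets_of the_model"
  proof
    show "P v" if "Sig1 (sets_of the_model) (\<lambda>e. P (e 0))" "P 0" "\<And>v. P v \<Longrightarrow> P (v + 1)" for P v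
      by (rule ind[OF that])
    show "P v" if "Sig2 (sets_of the_model) (\<lambda>e. P (e 0))" "P 0" "\<And>v. P v \<Longrightarrow> P (v + 1)" for P v
      by (rule Sig2_induct[OF ax(1) that])
    show "{v. P v} \<in> sets_of the_model"
      if "Sig1 (sets_of the_model) (\<lambda>e. P (e 0))" "Sig1 (sets_of the_model) (\<lambda>e. \<not> P (e 0))" for P
      by (rule Delta1_comprehension[OF ax(2) that])
  qed
  have "sat the_model \<rho> E STS2" "\<not> sat the_model \<rho> E SRRT22" for \<rho> E
    using model by simp_all
  then show False unfolding sat_STS2 sat_SRRT22 using srrt by blast
qed

theorem corollary5p30:
  shows "RCA0 \<union> ISigma 2 \<^bold>\<turnstile> (STS2 \<^bold>\<longrightarrow> SRRT22)"
proof (rule Contr, rule ccontr)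
  let ?\<Gamma> = "insert (\<^bold>\<not> (STS2 \<^bold>\<longrightarrow> SRRT22)) (RCA0 \<union> ISigma 2)"
  assume "\<not> (?\<Gamma> \<^bold>\<turnstile> \<^bold>\<bottom>)"
  then have "consistent ?\<Gamma>" by (simp add: consistent_def)
  moreover have "\<forall>\<phi>\<in>?\<Gamma>. sentence \<phi>"
    using sentence_goal by (auto simp: RCA0_def ISigma_def Delta1_CA_def universal_closures_def)
  moreover have "universal_closures basic_axioms \<subseteq> ?\<Gamma>"
    by (auto simp: RCA0_def)
  \<comment> \<open>Consistency of the axioms with the negated implication yields a model on the
    fixed carrier \<open>hnum\<close>.\<close>
  ultimately have "\<exists>M. counter_model M"
    unfolding counter_model_def by (rule model_existence[OF _ _ _ infinite_hnum])
  then show False using no_counter_model by simp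
qed

end
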